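(* Let $p>5$, let $\gamma<0$ (strictly negative), and let $\omega>0$. Then the following hold. (1) $n_\omega=l_\omega$, and $n_\omega$ is not attained. (2) $n_\omega<r_\omega$, and $$r_\omega=2l_\omega\ \text{ if } 0<\omega\le \gamma^2/2,\qquad r_\omega<2l_\omega\ \text{ if } \omega>\gamma^2/2 .$$ (3) If $\omega>\gamma^2/2$, then $r_\omega$ is attained by $$Q_{\omega,\gamma}(x):=\left\{\frac{(p+1)\omega}{2}\,\mathrm{sech}^2\left(\frac{(p-1)\sqrt{\omega}}{\sqrt2}|x|+\tanh^{-1}\left(\frac{\gamma}{\sqrt{2\omega}}\right)\right)\right\}^{\frac1{p-1}},$$ which is the unique positive solution of $-\frac12\partial_x^2Q+\omega Q-\gamma\delta_0Q=|Q|^{p-1}Q$. On the other hand, $r_\omega$ is not attained if $0<\omega\le\gamma^2/2$.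
   Context: Functions are complex-valued on $\mathbb{R}$, $\delta_0$ is the Dirac delta at the origin ($\delta_0Q=Q(0)\delta_0$, equation understood in the sense of distributions for $Q\in H^1(\mathbb R)$), and $H^1_{rad}(\mathbb{R}):=\{\varphi\in H^1(\mathbb{R}):\varphi(x)=\varphi(-x)\}$. For $\phi\in H^1(\mathbb{R})$ set $$S_{\omega}(\phi)=S_{\omega,\gamma}(\phi):=\tfrac14\|\partial_x\phi\|_{L^2}^2-\tfrac{\gamma}{2}|\phi(0)|^2+\tfrac{\omega}{2}\|\phi\|_{L^2}^2-\tfrac1{p+1}\|\phi\|_{L^{p+1}}^{p+1},$$ $$P(\phi)=P_\gamma(\phi):=\tfrac12\|\partial_x\phi\|_{L^2}^2-\tfrac{\gamma}{2}|\phi(0)|^2-\tfrac{p-1}{2(p+1)}\|\phi\|_{L^{p+1}}^{p+1},$$ and let $S_{\omega,0}$, $P_0$ be the same functionals with $\gamma$ replaced by $0$. Define $$n_\omega:=\inf\{S_\omega(\phi):\phi\in H^1(\mathbb{R})\setminus\{0\},\ P(\phi)=0\},$$ $$r_\omega:=\inf\{S_\omega(\phi):\phi\in H^1_{rad}(\mathbb{R})\setminus\{0\},\ P(\phi)=0\},$$ $$l_\omega:=\inf\{S_{\omega,0}(\phi):\phi\in H^1(\mathbb{R})\setminus\{0\},\ P_0(\phi)=0\}.$$ An infimum is attained if some admissible $\phi$ in the corresponding set realizes it. *)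

theory Defs
  imports "HOL-Analysis.Analysis"
begin

abbreviation vderiv :: "(real \<Rightarrow> complex) \<Rightarrow> real \<Rightarrow> complex" where
  "vderiv f \<equiv> \<lambda>x. vector_derivative f (at x)"

definition test_fun :: "(real \<Rightarrow> complex) \<Rightarrow> bool" where
  "test_fun \<psi> \<longleftrightarrow>
     (\<forall>n x. (vderiv ^^ n) \<psi> differentiable (at x)) \<and> compact (closure {x. \<psi> x \<noteq> 0})"

definition Lp :: "real \<Rightarrow> (real \<Rightarrow> complex) set" where
  "Lp q = {f. f \<in> borel_measurable lborel \<and> integrable lborel (\<lambda>x. norm (f x) powr q)}"

definition Lp_norm :: "real \<Rightarrow> (real \<Rightarrow> complex) \<Rightarrow> real" where
  "Lp_norm q f = (LINT x|lborel. norm (f x) powr q) powr (1 / q)"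

definition is_weak_deriv :: "(real \<Rightarrow> complex) \<Rightarrow> (real \<Rightarrow> complex) \<Rightarrow> bool" where
  "is_weak_deriv f g \<longleftrightarrow> g \<in> Lp 2 \<and>
     (\<forall>\<psi>. test_fun \<psi> \<longrightarrow>
        (LINT x|lborel. f x * vderiv \<psi> x) = - (LINT x|lborel. g x * \<psi> x))"

text \<open>Elements of \<open>H\<^sup>1(\<real>)\<close> are represented by their continuous representatives, which exist
  and are unique. Hence the point value \<open>\<phi> 0\<close> makes sense, and equality in \<open>H\<^sup>1(\<real>)\<close> is equality
  of functions.\<close>

definition H1 :: "(real \<Rightarrow> complex) set" where
  "H1 = {\<phi>. continuous_on UNIV \<phi> \<and> \<phi> \<in> Lp 2 \<and> (\<exists>g. is_weak_deriv \<phi> g)}"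

definition H1_rad :: "(real \<Rightarrow> complex) set" where
  "H1_rad = {\<phi> \<in> H1. \<forall>x. \<phi> x = \<phi> (- x)}"

text \<open>The weak derivative is unique only up to null sets; \<open>weak_deriv \<phi>\<close> is an arbitrary
  representative and is used only under an \<open>L\<^sup>2\<close> norm.\<close>

definition weak_deriv :: "(real \<Rightarrow> complex) \<Rightarrow> real \<Rightarrow> complex" where
  "weak_deriv \<phi> = (SOME g. is_weak_deriv \<phi> g)"

definition action :: "real \<Rightarrow> real \<Rightarrow> real \<Rightarrow> (real \<Rightarrow> complex) \<Rightarrow> real" where
  "action p \<omega> \<gamma> \<phi> =
     1/4 * (Lp_norm 2 (weak_deriv \<phi>))\<^sup>2 - \<gamma>/2 * (norm (\<phi> 0))\<^sup>2
     + \<omega>/2 * (Lp_norm 2 \<phi>)\<^sup>2 - 1/(p+1) * Lp_norm (p+1) \<phi> powr (p+1)"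

definition virial :: "real \<Rightarrow> real \<Rightarrow> (real \<Rightarrow> complex) \<Rightarrow> real" where
  "virial p \<gamma> \<phi> =
     1/2 * (Lp_norm 2 (weak_deriv \<phi>))\<^sup>2 - \<gamma>/2 * (norm (\<phi> 0))\<^sup>2
     - (p-1)/(2*(p+1)) * Lp_norm (p+1) \<phi> powr (p+1)"

definition admissible :: "(real \<Rightarrow> complex) set \<Rightarrow> real \<Rightarrow> real \<Rightarrow> (real \<Rightarrow> complex) set" where
  "admissible X p \<gamma> = {\<phi> \<in> X. \<phi> \<noteq> (\<lambda>x. 0) \<and> virial p \<gamma> \<phi> = 0}"

text \<open>The infima are taken in the reals: for \<open>p > 5\<close>, \<open>\<gamma> \<le> 0\<close> and \<open>\<omega> > 0\<close> the admissible sets are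
  nonempty, and the action is nonnegative on them, because \<open>action - virial * 2 / (p - 1)\<close> is then
  a sum of nonnegative terms.\<close>

definition n_inf :: "real \<Rightarrow> real \<Rightarrow> real \<Rightarrow> real" where
  "n_inf p \<omega> \<gamma> = Inf (action p \<omega> \<gamma> ` admissible H1 p \<gamma>)"

definition r_inf :: "real \<Rightarrow> real \<Rightarrow> real \<Rightarrow> real" where
  "r_inf p \<omega> \<gamma> = Inf (action p \<omega> \<gamma> ` admissible H1_rad p \<gamma>)"

definition l_inf :: "real \<Rightarrow> real \<Rightarrow> real" where
  "l_inf p \<omega> = Inf (action p \<omega> 0 ` admissible H1 p 0)"

definition n_attained_by :: "real \<Rightarrow> real \<Rightarrow> real \<Rightarrow> (real \<Rightarrow> complex) \<Rightarrow> bool" where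
  "n_attained_by p \<omega> \<gamma> \<phi> \<longleftrightarrow> \<phi> \<in> admissible H1 p \<gamma> \<and> action p \<omega> \<gamma> \<phi> = n_inf p \<omega> \<gamma>"

definition r_attained_by :: "real \<Rightarrow> real \<Rightarrow> real \<Rightarrow> (real \<Rightarrow> complex) \<Rightarrow> bool" where
  "r_attained_by p \<omega> \<gamma> \<phi> \<longleftrightarrow> \<phi> \<in> admissible H1_rad p \<gamma> \<and> action p \<omega> \<gamma> \<phi> = r_inf p \<omega> \<gamma>"

text \<open>Here \<open>sech\<^sup>2 = 1 / cosh\<^sup>2\<close>.\<close>

definition Q_prof :: "real \<Rightarrow> real \<Rightarrow> real \<Rightarrow> real \<Rightarrow> complex" where
  "Q_prof p \<omega> \<gamma> x = complex_of_real
     (((p+1) * \<omega> / 2 *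
        (1 / (cosh ((p-1) * sqrt \<omega> / sqrt 2 * \<bar>x\<bar> + artanh (\<gamma> / sqrt (2*\<omega>))))\<^sup>2))
      powr (1 / (p-1)))"

text \<open>The equation \<open>- (1/2) Q'' + \<omega> Q - \<gamma> \<delta>\<^sub>0 Q = \<bar>Q\<bar>\<^sup>p\<^sup>-\<^sup>1 Q\<close> in the sense of distributions, tested
  against \<open>\<psi>\<close>: the distributional \<open>Q''\<close> acts as \<open>\<psi> \<mapsto> \<integral> Q \<psi>''\<close>, and \<open>\<delta>\<^sub>0 Q\<close> as \<open>\<psi> \<mapsto> Q 0 * \<psi> 0\<close>.\<close>

definition solves_delta_NLS :: "real \<Rightarrow> real \<Rightarrow> real \<Rightarrow> (real \<Rightarrow> complex) \<Rightarrow> bool" where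
  "solves_delta_NLS p \<omega> \<gamma> Q \<longleftrightarrow> Q \<in> H1 \<and>
     (\<forall>\<psi>. test_fun \<psi> \<longrightarrow>
        - (1/2) * (LINT x|lborel. Q x * vderiv (vderiv \<psi>) x)
        + of_real \<omega> * (LINT x|lborel. Q x * \<psi> x)
        - of_real \<gamma> * (Q 0 * \<psi> 0)
        = (LINT x|lborel. of_real (norm (Q x) powr (p-1)) * Q x * \<psi> x))"

definition positive_fun :: "(real \<Rightarrow> complex) \<Rightarrow> bool" where
  "positive_fun \<phi> \<longleftrightarrow> (\<forall>x. \<phi> x \<in> \<real> \<and> 0 < Re (\<phi> x))"

end

theory Submission
  imports Defs
begin

text \<open>Write \<open>K\<close>, \<open>D\<close>, \<open>M\<close>, \<open>N\<close> for \<open>\<parallel>\<phi>'\<parallel>\<^sup>2\<close>, \<open>|\<phi> 0|\<^sup>2\<close>, \<open>\<parallel>\<phi>\<parallel>\<^sup>2\<close> and the integral of \<open>|\<phi>|\<close> to the power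
\<open>p + 1\<close>. All the minimisation problems can be solved without any compactness argument, by comparing
\<open>|\<phi>|\<close> with the solitary wave in the phase plane.

The virial \<open>P\<close> is the derivative at \<open>\<mu> = 1\<close> of the action along the mass preserving dilations
\<open>\<phi>\<^sub>\<mu> x = \<mu>\<^sup>1\<^sup>/\<^sup>2 \<phi> (\<mu> x)\<close>. For \<open>p > 5\<close> and \<open>\<gamma> \<le> 0\<close> the condition \<open>P \<phi> = 0\<close> makes \<open>\<mu> = 1\<close> the maximum of the
action on this orbit (\<open>orbit_action_le_action\<close>), so that \<open>S \<phi>\<close> is bounded below by \<open>S \<phi>\<^sub>\<mu>\<close> for any
convenient \<open>\<mu>\<close>. The convenient \<open>\<mu>\<close> is the one for which the maximum of \<open>|\<phi>\<^sub>\<mu>|\<close> is the height \<open>peak\<close> of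
the free soliton: then \<open>W s = 2 \<omega> s\<^sup>2 - 4 s\<^sup>p\<^sup>+\<^sup>1 / (p + 1)\<close> is nonnegative at every value \<open>s\<close> of \<open>|\<phi>\<^sub>\<mu>|\<close>, the
action density without the delta term is \<open>(|\<phi>'|\<^sup>2 + W |\<phi>|) / 4\<close>, and completing the square gives
\<open>(|\<phi>'|\<^sup>2 + W |\<phi>|) / 4 \<ge> |\<phi>'| (W |\<phi>|)\<^sup>1\<^sup>/\<^sup>2 / 2\<close>. The right hand side is half the arclength element
for the metric with primitive \<open>cost\<close>. A path that starts at \<open>0\<close>, climbs to \<open>peak\<close> and returns to
\<open>0\<close> therefore costs at least \<open>cost peak\<close>, which is the action of the soliton; this is \<open>l\<close>. An even
path with value \<open>a\<close> at the origin climbs to \<open>peak\<close> twice and descends to \<open>a\<close> in between, so that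
together with the delta term it costs at least \<open>barrier a = 2 cost peak - cost a - \<gamma> a\<^sup>2 / 2\<close>.

The rest is one-variable calculus. If \<open>\<omega> \<le> \<gamma>\<^sup>2 / 2\<close> the barrier is smallest at \<open>a = 0\<close> only, where it is
\<open>2 l\<close>; otherwise its minimum is at the height of \<open>Q\<close> at the origin and lies strictly between \<open>l\<close>
and \<open>2 l\<close> (\<open>barrier_strict_min_0\<close>, \<open>barrier_min_at_delta_height\<close>). A nonzero value at the origin makes
the delta term, respectively the excess of the barrier over \<open>2 l\<close>, strictly positive, and with the value \<open>0\<close> there
equality never happens: it forces \<open>|\<phi>'| \<le> C |\<phi>|\<close>, and such a function cannot leave the value \<open>0\<close>
(\<open>energy_Icc_strict\<close>). Hence \<open>n\<close> is not attained, and neither is \<open>r\<close> for \<open>\<omega> \<le> \<gamma>\<^sup>2 / 2\<close>. The upper bounds come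
from solitons moved far away from the origin, one for \<open>n\<close> and a symmetric pair for \<open>r\<close>, dilated
slightly to restore \<open>P = 0\<close> (\<open>near_optimal\<close>); \<open>Q\<close> itself realises the minimum of the barrier because
its profile satisfies \<open>Q'\<^sup>2 = W Q\<close>.

For uniqueness, a positive distributional solution is twice differentiable off the origin with a
prescribed jump of the derivative, and its first integral \<open>Q'\<^sup>2 = W Q\<close> on both half-lines fixes \<open>Q 0\<close> and the
one-sided derivatives there. The substitution \<open>v = Q\<^sup>-\<^sup>(\<^sup>p\<^sup>-\<^sup>1\<^sup>)\<^sup>/\<^sup>2\<close> turns the equation into \<open>v'' = \<beta>\<^sup>2 v\<close>,
whose solutions are determined by these data.\<close>

section \<open>Smooth functions and a mollifier\<close>

text \<open>Existence of \<open>n\<close> successive derivatives. Counting them from the function downwards makes the closure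
properties of smooth functions provable by induction on \<open>n\<close>.\<close>

primrec diff_upto :: "nat \<Rightarrow> (real \<Rightarrow> complex) \<Rightarrow> bool" where
  "diff_upto 0 f \<longleftrightarrow> True"
| "diff_upto (Suc n) f \<longleftrightarrow> (\<forall>x. f differentiable (at x)) \<and> diff_upto n (vderiv f)"

definition smooth :: "(real \<Rightarrow> complex) \<Rightarrow> bool" where
  "smooth f \<longleftrightarrow> (\<forall>n. diff_upto n f)"

lemma diff_upto_iff: "diff_upto n f \<longleftrightarrow> (\<forall>m<n. \<forall>x. (vderiv ^^ m) f differentiable (at x))"
proof (induction n arbitrary: f)
  case (Suc n)
  show ?case
    unfolding diff_upto.simps Suc less_Suc_eq_0_disj
    by (auto simp: funpow_Suc_right simp del: funpow.simps(2))
qed simp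

lemma smooth_iff: "smooth f \<longleftrightarrow> (\<forall>n x. (vderiv ^^ n) f differentiable (at x))"
  unfolding smooth_def diff_upto_iff by blast

lemma vderiv_eqI: "(\<And>x. (f has_vector_derivative f' x) (at x)) \<Longrightarrow> vderiv f = f'"
  by (rule ext) (rule vector_derivative_at)

lemma has_vderiv: "f differentiable (at x) \<Longrightarrow> (f has_vector_derivative vderiv f x) (at x)"
  by (simp add: vector_derivative_works)

lemma diff_upto_SucI:
  assumes "\<And>x. (f has_vector_derivative f' x) (at x)" "diff_upto n f'"
  shows "diff_upto (Suc n) f"
  using assms vderiv_eqI[of f f'] by (auto intro: differentiableI_vector)

lemma diff_upto_mono: "diff_upto (Suc n) f \<Longrightarrow> diff_upto n f"
  by (induction n arbitrary: f) auto

lemma diff_upto_add: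
  "diff_upto n f \<Longrightarrow> diff_upto n g \<Longrightarrow> diff_upto n (\<lambda>x. f x + g x)"
proof (induction n arbitrary: f g)
  case (Suc n)
  then have "((\<lambda>x. f x + g x) has_vector_derivative vderiv f x + vderiv g x) (at x)" for x
    by (auto intro!: has_vector_derivative_add has_vderiv)
  then show ?case by (rule diff_upto_SucI) (use Suc in auto)
qed simp

lemma diff_upto_mult:
  "diff_upto n f \<Longrightarrow> diff_upto n g \<Longrightarrow> diff_upto n (\<lambda>x. f x * g x)"
proof (induction n arbitrary: f g)
  case (Suc n)
  have "((\<lambda>x. f x * g x) has_vector_derivative f x * vderiv g x + vderiv f x * g x) (at x)" for x
    using Suc.prems by (auto intro!: has_vector_derivative_mult has_vderiv)
  moreover have "diff_upto n f" "diff_upto n g" using Suc.prems diff_upto_mono by auto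
  then have "diff_upto n (\<lambda>x. f x * vderiv g x + vderiv f x * g x)"
    using Suc by (intro diff_upto_add) auto
  ultimately show ?case by (rule diff_upto_SucI)
qed simp

lemma diff_upto_const: "diff_upto n (\<lambda>x. c)"
proof (induction n arbitrary: c)
  case (Suc n)
  show ?case by (rule diff_upto_SucI[of _ "\<lambda>x. 0"]) (use Suc in auto)
qed simp

lemma diff_upto_affine:
  "diff_upto n f \<Longrightarrow> diff_upto n (\<lambda>x. f (a * x + b))"
proof (induction n arbitrary: f)
  case (Suc n)
  have "((\<lambda>x. f (a * x + b)) has_vector_derivative complex_of_real a * vderiv f (a * x + b)) (at x)" for x
  proof -
    have "((f \<circ> (\<lambda>x. a * x + b)) has_vector_derivative a *\<^sub>R vderiv f (a * x + b)) (at x)"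
      using Suc.prems
      by (intro vector_diff_chain_at has_vderiv)
         (auto intro!: derivative_eq_intros simp: has_real_derivative_iff_has_vector_derivative[symmetric])
    then show ?thesis by (simp add: o_def scaleR_conv_of_real)
  qed
  then show ?case
    by (rule diff_upto_SucI) (use Suc in \<open>auto intro!: diff_upto_mult diff_upto_const\<close>)
qed simp

lemma smooth_vderiv: "smooth f \<Longrightarrow> smooth (vderiv f)"
  unfolding smooth_def by (metis diff_upto.simps(2))

lemma smooth_differentiable: "smooth f \<Longrightarrow> f differentiable (at x)"
  unfolding smooth_def by (metis diff_upto.simps(2))

lemma smooth_continuous: "smooth f \<Longrightarrow> continuous_on A f"
  by (meson continuous_at_imp_continuous_on differentiable_imp_continuous_within smooth_differentiable)

lemma smooth_antiderivative:
  assumes "\<And>x. (f has_vector_derivative g x) (at x)" "smooth g"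
  shows "smooth f"
  unfolding smooth_def
proof
  fix n show "diff_upto n f"
    by (cases n) (use assms in \<open>auto intro!: diff_upto_SucI simp: smooth_def simp del: diff_upto.simps(2)\<close>)
qed

lemma test_fun_iff:
  "test_fun \<psi> \<longleftrightarrow> smooth \<psi> \<and> (\<exists>R>0. \<forall>x. \<psi> x \<noteq> 0 \<longrightarrow> \<bar>x\<bar> \<le> R)"
proof -
  have "compact (closure {x. \<psi> x \<noteq> 0}) \<longleftrightarrow> (\<exists>R>0. \<forall>x. \<psi> x \<noteq> 0 \<longrightarrow> \<bar>x\<bar> \<le> R)"
    by (auto simp: bounded_pos)
  then show ?thesis unfolding test_fun_def smooth_iff by blast
qed

lemma test_fun_vderiv:
  assumes "test_fun \<psi>" shows "test_fun (vderiv \<psi>)"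
proof -
  obtain R where R: "R > 0" "\<And>x. \<psi> x \<noteq> 0 \<Longrightarrow> \<bar>x\<bar> \<le> R" and s: "smooth \<psi>"
    using assms unfolding test_fun_iff by blast
  have "vderiv \<psi> x = 0" if "\<bar>x\<bar> > R" for x
  proof -
    have "open {x::real. \<bar>x\<bar> > R}"
      by (intro open_Collect_less continuous_intros)
    have "(\<psi> has_vector_derivative 0) (at x)"
      by (rule has_vector_derivative_transform_within_open[OF _ \<open>open _\<close>, of "\<lambda>x. 0"])
         (use that R(2) in \<open>auto simp: not_le[symmetric]\<close>)
    then show ?thesis by (rule vector_derivative_at)
  qed
  then show ?thesis unfolding test_fun_iff using R(1) smooth_vderiv[OF s] by (meson not_le)
qed

text \<open>The derivative of \<open>t\<^sup>-\<^sup>k exp (- 1 / t)\<close> is a combination of the next two members of the family, so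
the whole family is smooth at once; \<open>k = 0\<close> is the classical flat function.\<close>

definition flat :: "nat \<Rightarrow> real \<Rightarrow> real" where
  "flat k t = (if t > 0 then (1 / t) ^ k * exp (- (1 / t)) else 0)"

lemma flat_tendsto_0: "(flat k \<longlongrightarrow> 0) (at 0)"
proof -
  have "((\<lambda>t::real. (inverse t) ^ k / exp (inverse t)) \<longlongrightarrow> 0) (at_right 0)"
    by (rule filterlim_compose[OF tendsto_power_div_exp_0 filterlim_inverse_at_top_right])
  then have "(flat k \<longlongrightarrow> 0) (at_right 0)"
    by (rule Lim_transform_eventually)
       (auto simp: eventually_at_filter flat_def exp_minus divide_inverse)
  moreover have "(flat k \<longlongrightarrow> 0) (at_left 0)"
    by (rule Lim_transform_eventually[of "\<lambda>_. 0"]) (auto simp: eventually_at_filter flat_def)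
  ultimately show ?thesis by (simp add: filterlim_at_split)
qed

lemma flat_deriv: "(flat k has_real_derivative flat (k+2) t - real k * flat (k+1) t) (at t)"
proof -
  consider "t > 0" | "t < 0" | "t = 0" by linarith
  then show ?thesis
  proof cases
    case 1
    have "((\<lambda>t. (1 / t) ^ k * exp (- (1 / t))) has_real_derivative
       real k * (1 / t) ^ (k - 1) * (- (1 / t\<^sup>2)) * exp (- (1 / t)) + (1 / t) ^ k * (exp (- (1 / t)) * (1 / t\<^sup>2))) (at t)"
    proof -
      have i: "((\<lambda>t. 1 / t) has_real_derivative - (1 / t\<^sup>2)) (at t)"
        using 1 by (auto intro!: derivative_eq_intros simp: power2_eq_square)
      show ?thesis
        by (rule DERIV_cong[OF DERIV_mult[OF DERIV_power[OF i, of k] DERIV_chain2[OF DERIV_exp DERIV_minus[OF i]]]])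
           simp
    qed
    also have "real k * (1 / t) ^ (k - 1) * (- (1 / t\<^sup>2)) * exp (- (1 / t)) + (1 / t) ^ k * (exp (- (1 / t)) * (1 / t\<^sup>2))
       = flat (k+2) t - real k * flat (k+1) t"
      using 1 by (cases k) (auto simp: flat_def field_simps power2_eq_square)
    finally have "((\<lambda>t. (1 / t) ^ k * exp (- (1 / t))) has_real_derivative
       flat (k+2) t - real k * flat (k+1) t) (at t)" .
    then show ?thesis
      by (rule has_field_derivative_transform_within_open[where S="{0<..}"]) (use 1 in \<open>auto simp: flat_def\<close>)
  next
    case 2
    have "((\<lambda>t. 0) has_real_derivative flat (k+2) t - real k * flat (k+1) t) (at t)"
      using 2 by (auto simp: flat_def)
    then show ?thesis
      by (rule has_field_derivative_transform_within_open[where S="{..<0}"]) (use 2 in \<open>auto simp: flat_def\<close>)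
  next
    case 3
    have "((\<lambda>h. (flat k (0 + h) - flat k 0) / h) \<longlongrightarrow> 0) (at 0)"
      by (rule Lim_transform_eventually[OF flat_tendsto_0[of "Suc k"]])
         (auto simp: eventually_at_filter flat_def)
    then show ?thesis unfolding 3 DERIV_def by (simp add: flat_def)
  qed
qed

lemma smooth_flat: "smooth (\<lambda>t. complex_of_real (flat k t))"
  unfolding smooth_def
proof
  fix n show "diff_upto n (\<lambda>t. complex_of_real (flat k t))"
  proof (induction n arbitrary: k)
    case (Suc n)
    show ?case
    proof (rule diff_upto_SucI)
      show "((\<lambda>t. complex_of_real (flat k t)) has_vector_derivative
        complex_of_real (flat (k+2) x) + complex_of_real (- real k) * complex_of_real (flat (k+1) x)) (at x)" for x
        using has_vector_derivative_of_real[OF flat_deriv[of k x]] by simp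
    qed (intro diff_upto_add diff_upto_mult diff_upto_const Suc)
  qed simp
qed

lemma smooth_mult: "smooth f \<Longrightarrow> smooth g \<Longrightarrow> smooth (\<lambda>x. f x * g x)"
  and smooth_add: "smooth f \<Longrightarrow> smooth g \<Longrightarrow> smooth (\<lambda>x. f x + g x)"
  and smooth_const: "smooth (\<lambda>x. c)"
  and smooth_affine: "smooth f \<Longrightarrow> smooth (\<lambda>x. f (a * x + b))"
  unfolding smooth_def by (simp_all add: diff_upto_mult diff_upto_add diff_upto_const diff_upto_affine)

text \<open>A smooth probability density supported on \<open>[-1, 1]\<close>.\<close>

definition bump :: "real \<Rightarrow> real" where
  "bump t = flat 0 (1 + t) * flat 0 (1 - t) / integral {-1..1} (\<lambda>t. flat 0 (1 + t) * flat 0 (1 - t))"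

lemma smooth_bump: "smooth (\<lambda>t. complex_of_real (bump t))"
proof -
  have "smooth (\<lambda>t. complex_of_real (flat 0 (1 * t + 1)) * complex_of_real (flat 0 ((-1) * t + 1))
     * complex_of_real (1 / integral {-1..1} (\<lambda>t. flat 0 (1 + t) * flat 0 (1 - t))))"
    by (intro smooth_mult smooth_const smooth_affine[where f="\<lambda>t. complex_of_real (flat 0 t)"] smooth_flat)
  then show ?thesis by (simp add: bump_def add.commute)
qed

lemma flat_nonneg: "flat k t \<ge> 0" by (simp add: flat_def)

lemma continuous_flat: "continuous_on A (flat k)"
  by (meson DERIV_continuous continuous_at_imp_continuous_on flat_deriv)

lemma bump_raw_integral_pos: "integral {-1..1} (\<lambda>t. flat 0 (1 + t) * flat 0 (1 - t)) > 0"
proof -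
  have c: "continuous_on {-1..1} (\<lambda>t. flat 0 (1 + t) * flat 0 (1 - t))"
    by (intro continuous_intros continuous_on_compose2[OF continuous_flat[of UNIV 0]]) auto
  have "integral {-1..1} (\<lambda>t. flat 0 (1 + t) * flat 0 (1 - t)) \<noteq> 0"
  proof
    assume "integral {-1..1} (\<lambda>t. flat 0 (1 + t) * flat 0 (1 - t)) = 0"
    then have "\<forall>x\<in>{-1..1}. flat 0 (1 + x) * flat 0 (1 - x) = 0"
      using integral_eq_0_iff[OF c] by (simp add: flat_nonneg)
    from this[THEN bspec, of 0] show False by (simp add: flat_def)
  qed
  moreover have "integral {-1..1} (\<lambda>t. flat 0 (1 + t) * flat 0 (1 - t)) \<ge> 0"
    by (intro integral_nonneg integrable_continuous_real c) (simp add: flat_nonneg)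
  ultimately show ?thesis by linarith
qed

lemma bump_nonneg: "bump t \<ge> 0"
  using bump_raw_integral_pos by (simp add: bump_def flat_nonneg)

lemma bump_eq_0: "\<bar>t\<bar> \<ge> 1 \<Longrightarrow> bump t = 0"
  by (auto simp: bump_def flat_def)

lemma continuous_bump: "continuous_on A bump"
  using bump_raw_integral_pos unfolding bump_def
  by (intro continuous_intros continuous_on_compose2[OF continuous_flat[of UNIV 0]]) auto

lemma integral_bump: "integral {-1..1} bump = 1"
  using bump_raw_integral_pos unfolding bump_def by simp

text \<open>The distribution function of \<open>bump\<close>: a smooth Heaviside function.\<close>

definition step :: "real \<Rightarrow> real" where
  "step t = (if t \<le> -1 then 0 else integral {-1..t} bump)"

lemma step_deriv: "(step has_real_derivative bump t) (at t)"
proof -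
  define m where "m = min t (-1) - 1"
  have *: "step s = integral {m..s} bump" if "s > m" for s
  proof (cases "s \<le> -1")
    case True
    then have "integral {m..s} bump = integral {m..s} (\<lambda>_. 0)"
      by (intro integral_cong bump_eq_0) auto
    then show ?thesis using True by (simp add: step_def)
  next
    case False
    have "integral {m..s} bump = integral {m..-1} bump + integral {-1..s} bump"
      by (rule Henstock_Kurzweil_Integration.integral_combine[symmetric])
         (use False in \<open>auto simp: m_def intro!: integrable_continuous_real continuous_bump\<close>)
    also have "integral {m..-1} bump = integral {m..-1} (\<lambda>_. 0)"
      by (intro integral_cong bump_eq_0) auto
    finally show ?thesis using False by (simp add: step_def)
  qed
  have "((\<lambda>s. integral {m..s} bump) has_real_derivative bump t) (at t within {m..t+1})"
    by (rule integral_has_real_derivative) (auto simp: m_def continuous_bump)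
  then have "((\<lambda>s. integral {m..s} bump) has_real_derivative bump t) (at t)"
    using at_within_interior[of t "{m..t+1}"] by (simp add: m_def)
  then show ?thesis
    by (rule has_field_derivative_transform_within_open[where S="{m<..}"]) (auto simp: * m_def)
qed

lemma step_left: "t \<le> -1 \<Longrightarrow> step t = 0" by (simp add: step_def)

lemma step_mono: "s \<le> t \<Longrightarrow> step s \<le> step t"
  by (rule DERIV_nonneg_imp_nondecreasing) (use step_deriv bump_nonneg in blast)+

lemma step_right: assumes "t \<ge> 1" shows "step t = 1"
proof -
  have "step t = step 1"
  proof (cases "t > 1")
    case True
    then have "step 1 = step t"
      by (intro DERIV_isconst_end[symmetric])
         (auto intro!: continuous_at_imp_continuous_on DERIV_isCont[OF step_deriv] step_deriv[THEN DERIV_cong] bump_eq_0)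
    then show ?thesis by simp
  qed (use assms in auto)
  then show ?thesis by (simp add: step_def integral_bump)
qed

lemma step_bounds: "0 \<le> step t" "step t \<le> 1"
proof -
  show "0 \<le> step t"
    using step_mono[of "min t (-1)" t] step_left[of "min t (-1)"] by simp
  show "step t \<le> 1"
    using step_mono[of t "max t 1"] step_right[of "max t 1"] by simp
qed

lemma smooth_step: "smooth (\<lambda>t. complex_of_real (step t))"
  by (rule smooth_antiderivative[OF has_vector_derivative_of_real[OF step_deriv] smooth_bump])

section \<open>Weak derivatives and their primitives\<close>

definition locally_integrable :: "(real \<Rightarrow> complex) \<Rightarrow> bool" where
  "locally_integrable g \<longleftrightarrow> (\<forall>a b. set_integrable lborel {a..b} g)"

lemma continuous_locally_integrable: "continuous_on UNIV f \<Longrightarrow> locally_integrable f"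
  unfolding locally_integrable_def
  by (meson borel_integrable_atLeastAtMost' continuous_on_subset subset_UNIV)

lemma locally_integrable_mult_test:
  assumes "locally_integrable g" "test_fun \<psi>"
  shows "integrable lborel (\<lambda>x. g x * \<psi> x)"
proof -
  obtain R where R: "\<And>x. \<psi> x \<noteq> 0 \<Longrightarrow> \<bar>x\<bar> \<le> R" and s: "smooth \<psi>"
    using assms unfolding test_fun_iff by blast
  have "compact (\<psi> ` {-R..R})"
    by (intro compact_continuous_image smooth_continuous s) auto
  then obtain B where B: "\<And>x. x \<in> {-R..R} \<Longrightarrow> norm (\<psi> x) \<le> B"
    by (meson bounded_iff compact_imp_bounded imageI)
  have [measurable]: "\<psi> \<in> borel_measurable borel"
    by (intro borel_measurable_continuous_onI smooth_continuous s)
  have i: "integrable lborel (\<lambda>x. indicator {-R..R} x *\<^sub>R g x)"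
    using assms(1) unfolding locally_integrable_def set_integrable_def by blast
  have "integrable lborel (\<lambda>x. (indicator {-R..R} x *\<^sub>R g x) * \<psi> x)"
  proof (rule Bochner_Integration.integrable_bound)
    show "integrable lborel (\<lambda>x. B *\<^sub>R (indicator {-R..R} x *\<^sub>R g x))"
      using i by (rule integrable_scaleR_right)
    show "(\<lambda>x. (indicator {-R..R} x *\<^sub>R g x) * \<psi> x) \<in> borel_measurable lborel"
      using borel_measurable_integrable[OF i] by (intro borel_measurable_times) simp_all
    show "AE x in lborel. norm ((indicator {-R..R} x *\<^sub>R g x) * \<psi> x) \<le> norm (B *\<^sub>R (indicator {-R..R} x *\<^sub>R g x))"
    proof (rule AE_I2)
      fix x
      show "norm ((indicator {-R..R} x *\<^sub>R g x) * \<psi> x) \<le> norm (B *\<^sub>R (indicator {-R..R} x *\<^sub>R g x))"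
      proof (cases "x \<in> {-R..R}")
        case True
        then show ?thesis
          using B[of x] order_trans[OF norm_ge_zero B[of x]]
          by (simp add: norm_mult mult.commute mult_right_mono)
      qed simp
    qed
  qed
  also have "(\<lambda>x. (indicator {-R..R} x *\<^sub>R g x) * \<psi> x) = (\<lambda>x. g x * \<psi> x)"
    using R by (fastforce simp: indicator_def abs_le_iff)
  finally show ?thesis .
qed

lemma integrable_bump: "integrable lborel bump" and LINT_bump: "(LINT x|lborel. bump x) = 1"
proof -
  have "indicator {-1..1} x *\<^sub>R bump x = bump x" for x
    using bump_eq_0[of x] by (cases "\<bar>x\<bar> \<ge> 1") (auto simp: indicator_def)
  then have eq: "(\<lambda>x. indicator {-1..1} x *\<^sub>R bump x) = bump" by (rule ext)
  have si: "set_integrable lborel {-1..1} bump"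
    by (intro borel_integrable_atLeastAtMost' continuous_bump)
  then show "integrable lborel bump" unfolding set_integrable_def eq .
  have "(LINT x|lborel. bump x) = (LINT x:{-1..1}|lborel. bump x)"
    unfolding set_lebesgue_integral_def eq ..
  also have "\<dots> = integral {-1..1} bump" by (rule set_borel_integral_eq_integral[OF si])
  finally show "(LINT x|lborel. bump x) = 1" by (simp add: integral_bump)
qed

lemma bump_measurable [measurable]: "bump \<in> borel_measurable borel"
  by (intro borel_measurable_continuous_onI continuous_bump)

lemma bump_approximates_delta:
  fixes f :: "real \<Rightarrow> complex"
  assumes f: "continuous_on UNIV f"
  shows "(\<lambda>n. LINT t|lborel. f t * complex_of_real (real (Suc n) * bump (real (Suc n) * (t - x)))) \<longlonglongrightarrow> f x"
proof -
  have [measurable]: "f \<in> borel_measurable borel"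
    by (intro borel_measurable_continuous_onI f)
  have "(LINT t|lborel. f t * complex_of_real (real (Suc n) * bump (real (Suc n) * (t - x))))
     = (LINT s|lborel. f (x + (1 / real (Suc n)) * s) * complex_of_real (bump s))" for n
  proof -
    define c where "c = real (Suc n)"
    have c: "c > 0" by (simp add: c_def)
    have "(LINT t|lborel. f t * complex_of_real (c * bump (c * (t - x))))
      = \<bar>1 / c\<bar> *\<^sub>R (LINT s|lborel. f (x + (1 / c) * s) * complex_of_real (c * bump (c * (x + (1 / c) * s - x))))"
      by (rule lborel_integral_real_affine) (use c in simp)
    also have "\<dots> = (LINT s|lborel. f (x + (1 / c) * s) * complex_of_real (bump s))"
      using c unfolding integral_scaleR_right[symmetric]
      by (intro Bochner_Integration.integral_cong) (simp_all add: scaleR_conv_of_real)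
    finally show ?thesis unfolding c_def .
  qed
  moreover have "(\<lambda>n. LINT s|lborel. f (x + (1 / real (Suc n)) * s) * complex_of_real (bump s))
     \<longlonglongrightarrow> (LINT s|lborel. f x * complex_of_real (bump s))"
  proof -
    have "compact (f ` {x-1..x+1})"
      by (intro compact_continuous_image continuous_on_subset[OF f]) auto
    then obtain B where B: "\<And>y. y \<in> {x-1..x+1} \<Longrightarrow> norm (f y) \<le> B"
      by (meson bounded_iff compact_imp_bounded imageI)
    show ?thesis
    proof (rule integral_dominated_convergence[where w="\<lambda>s. B * bump s"])
      show "integrable lborel (\<lambda>s. B * bump s)" using integrable_bump by simp
      have "(\<lambda>n. f (x + (1 / real (Suc n)) * s)) \<longlonglongrightarrow> f (x + 0 * s)" for s
        by (intro isCont_tendsto_compose[of _ f] tendsto_intros LIMSEQ_Suc[OF lim_1_over_n])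
           (use f in \<open>auto simp: continuous_on_eq_continuous_at\<close>)
      then show "AE s in lborel. (\<lambda>n. f (x + (1 / real (Suc n)) * s) * complex_of_real (bump s)) \<longlonglongrightarrow> f x * complex_of_real (bump s)"
        by (intro AE_I2 tendsto_mult_right) simp
      fix n
      show "AE s in lborel. norm (f (x + (1 / real (Suc n)) * s) * complex_of_real (bump s)) \<le> B * bump s"
      proof (rule AE_I2)
        fix s
        show "norm (f (x + (1 / real (Suc n)) * s) * complex_of_real (bump s)) \<le> B * bump s"
        proof (cases "\<bar>s\<bar> < 1")
          case True
          then have "\<bar>(1 / real (Suc n)) * s\<bar> \<le> 1"
            by (simp add: abs_mult field_simps)
          then have "norm (f (x + (1 / real (Suc n)) * s)) \<le> B"
            using B[of "x + (1 / real (Suc n)) * s"] by (simp only: atLeastAtMost_iff abs_le_iff) linarith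
          then show ?thesis by (simp add: norm_mult bump_nonneg mult_right_mono)
        qed (simp add: bump_eq_0)
      qed
    qed measurable
  qed
  moreover have "(LINT s|lborel. f x * complex_of_real (bump s)) = f x"
    using LINT_bump integrable_bump by simp
  ultimately show ?thesis by (simp only:)
qed

lemma smooth_zoom: "smooth f \<Longrightarrow> smooth (\<lambda>x. f (c * (x - z)))"
  using smooth_affine[of f c "- (c * z)"] by (simp add: right_diff_distrib)

text \<open>Tested against a smoothed indicator of \<open>[x, y]\<close>, whose derivative is a difference of two approximate
Dirac masses, the definition of the weak derivative becomes the fundamental theorem of calculus. Only
local integrability of \<open>g\<close> is assumed, so that the result also covers constant \<open>g\<close>.\<close>

lemma weak_derivative_FTC:
  assumes f: "continuous_on UNIV f" and g: "locally_integrable g"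
    and weak: "\<And>\<psi>. test_fun \<psi> \<Longrightarrow> (LINT x|lborel. f x * vderiv \<psi> x) = - (LINT x|lborel. g x * \<psi> x)"
    and "x \<le> y"
  shows "f y - f x = (LINT t:{x..y}|lborel. g t)"
proof -
  define \<psi> where "\<psi> n t = complex_of_real (step (real (Suc n) * (t - x)) - step (real (Suc n) * (t - y)))" for n t
  define \<psi>' where "\<psi>' n t = complex_of_real (real (Suc n) * bump (real (Suc n) * (t - x)))
     - complex_of_real (real (Suc n) * bump (real (Suc n) * (t - y)))" for n t
  have z: "\<psi> n t = 0" if "t \<notin> {x-1..y+1}" for n t
  proof (cases "t < x - 1")
    case True
    have 1: "real (Suc n) * (t - x) \<le> 1 * (t - x)"
      using True by (intro mult_right_mono_neg) auto
    have 2: "real (Suc n) * (t - y) \<le> 1 * (t - y)"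
      using True \<open>x \<le> y\<close> by (intro mult_right_mono_neg) auto
    have "real (Suc n) * (t - x) \<le> -1" "real (Suc n) * (t - y) \<le> -1"
      by (rule order_trans[OF 1], use True in simp, rule order_trans[OF 2], use True \<open>x \<le> y\<close> in simp)
    then show ?thesis unfolding \<psi>_def by (simp only: step_left) simp
  next
    case False
    have 1: "real (Suc n) * (t - x) \<ge> 1 * (t - x)"
      using that False \<open>x \<le> y\<close> by (intro mult_right_mono) auto
    have 2: "real (Suc n) * (t - y) \<ge> 1 * (t - y)"
      using that False by (intro mult_right_mono) auto
    have "real (Suc n) * (t - x) \<ge> 1" "real (Suc n) * (t - y) \<ge> 1"
      by (rule order_trans[OF _ 1], use that False \<open>x \<le> y\<close> in simp, rule order_trans[OF _ 2], use that False in simp)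
    then show ?thesis unfolding \<psi>_def by (simp only: step_right) simp
  qed
  have b: "norm (\<psi> n t) \<le> 1" for n t
  proof -
    have "step (real (Suc n) * (t - y)) \<le> step (real (Suc n) * (t - x))"
      using \<open>x \<le> y\<close> by (intro step_mono mult_left_mono) auto
    then show ?thesis
      unfolding \<psi>_def using step_bounds[of "real (Suc n) * (t - y)"] step_bounds[of "real (Suc n) * (t - x)"] 
      by (simp only: norm_of_real)
  qed
  have d: "(\<psi> n has_vector_derivative \<psi>' n t) (at t)" for n t
  proof -
    have "((\<lambda>t. step (real (Suc n) * (t - x)) - step (real (Suc n) * (t - y))) has_real_derivative
       real (Suc n) * bump (real (Suc n) * (t - x)) - real (Suc n) * bump (real (Suc n) * (t - y))) (at t)"
      by (auto intro!: derivative_eq_intros DERIV_chain'[OF _ step_deriv])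
    from has_vector_derivative_of_real[OF this] show ?thesis
      unfolding \<psi>_def \<psi>'_def by (simp only: of_real_diff)
  qed
  have "smooth (\<psi> n)" for n
  proof -
    have "smooth (\<lambda>t. complex_of_real (step (real (Suc n) * (t - x)))
       + (-1) * complex_of_real (step (real (Suc n) * (t - y))))"
      by (intro smooth_add smooth_mult smooth_const smooth_zoom[OF smooth_step])
    then show ?thesis unfolding \<psi>_def by (simp del: of_nat_Suc)
  qed
  then have "test_fun (\<psi> n)" for n
    unfolding test_fun_iff
  proof (intro conjI exI[of _ "\<bar>x\<bar> + \<bar>y\<bar> + 1"] allI impI)
    fix t assume "\<psi> n t \<noteq> 0"
    then have "t \<in> {x-1..y+1}" using z by blast
    then show "\<bar>t\<bar> \<le> \<bar>x\<bar> + \<bar>y\<bar> + 1" by auto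
  qed auto
  note test = this
  have w: "(LINT t|lborel. f t * \<psi>' n t) = - (LINT t|lborel. g t * \<psi> n t)" for n
    using weak[OF test[of n]] by (simp only: vector_derivative_at[OF d])
  have i: "integrable lborel (\<lambda>t. f t * complex_of_real (real (Suc n) * bump (real (Suc n) * (t - z))))" for n z
  proof -
    have "smooth (\<lambda>t. complex_of_real (real (Suc n)) * complex_of_real (bump (real (Suc n) * (t - z))))"
      by (intro smooth_mult smooth_const smooth_zoom[OF smooth_bump])
    then have s: "smooth (\<lambda>t. complex_of_real (real (Suc n) * bump (real (Suc n) * (t - z))))"
      by (simp del: of_nat_Suc)
    have "\<bar>t\<bar> \<le> \<bar>z\<bar> + 1" if "bump (real (Suc n) * (t - z)) \<noteq> 0" for t
    proof -
      have "\<bar>real (Suc n) * (t - z)\<bar> < 1" using that bump_eq_0 by force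
      then have "real (Suc n) * \<bar>t - z\<bar> < 1" by (simp only: abs_mult abs_of_nat)
      moreover have "1 * \<bar>t - z\<bar> \<le> real (Suc n) * \<bar>t - z\<bar>" by (intro mult_right_mono) auto
      ultimately have "1 * \<bar>t - z\<bar> < 1" by (rule le_less_trans[rotated])
      then show ?thesis using abs_triangle_ineq2[of t z] by simp
    qed
    then have "test_fun (\<lambda>t. complex_of_real (real (Suc n) * bump (real (Suc n) * (t - z))))"
      unfolding test_fun_iff using s by (auto intro!: exI[of _ "\<bar>z\<bar> + 1"])
    then show ?thesis by (intro locally_integrable_mult_test continuous_locally_integrable f)
  qed
  have "(LINT t|lborel. f t * \<psi>' n t) =
    (LINT t|lborel. f t * complex_of_real (real (Suc n) * bump (real (Suc n) * (t - x))))
    - (LINT t|lborel. f t * complex_of_real (real (Suc n) * bump (real (Suc n) * (t - y))))" for n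
    using Bochner_Integration.integral_diff[OF i[of n x] i[of n y]]
    unfolding \<psi>'_def right_diff_distrib[of "f _" "complex_of_real _"] .
  then have "(\<lambda>n. LINT t|lborel. f t * \<psi>' n t) \<longlonglongrightarrow> f x - f y"
    by (simp only:) (intro tendsto_diff bump_approximates_delta f)
  \<comment> \<open>The functions \<open>\<psi> n\<close> are supported in \<open>[x - 1, y + 1]\<close> and converge to the indicator except at the two end points.\<close>
  moreover have "(\<lambda>n. LINT t|lborel. g t * \<psi> n t) \<longlonglongrightarrow> (LINT t|lborel. indicator {x..y} t *\<^sub>R g t)"
  proof (rule integral_dominated_convergence[where w="\<lambda>t. norm (indicator {x-1..y+1} t *\<^sub>R g t)"])
    have i: "integrable lborel (\<lambda>t. indicator {a..b} t *\<^sub>R g t)" for a b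
      using g unfolding locally_integrable_def set_integrable_def by blast
    show "integrable lborel (\<lambda>t. norm (indicator {x-1..y+1} t *\<^sub>R g t))"
      using i by (rule integrable_norm)
    show "(\<lambda>t. indicator {x..y} t *\<^sub>R g t) \<in> borel_measurable lborel"
      using i by (rule borel_measurable_integrable)
    show "(\<lambda>t. g t * \<psi> n t) \<in> borel_measurable lborel" for n
      using locally_integrable_mult_test[OF g test[of n]] by (rule borel_measurable_integrable)
    show "AE t in lborel. norm (g t * \<psi> n t) \<le> norm (indicator {x-1..y+1} t *\<^sub>R g t)" for n
    proof (rule AE_I2)
      fix t show "norm (g t * \<psi> n t) \<le> norm (indicator {x-1..y+1} t *\<^sub>R g t)"
        using z[of t n] b[of n t] by (cases "t \<in> {x-1..y+1}") (auto simp: norm_mult mult_left_le)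
    qed
    have ne: "(\<lambda>n. step (real (Suc n) * s)) \<longlonglongrightarrow> (if s > 0 then 1 else 0)" if s: "s \<noteq> 0" for s
    proof (rule tendsto_eventually)
      obtain N :: nat where N: "real N * \<bar>s\<bar> > 1"
        using ex_less_of_nat_mult[of "\<bar>s\<bar>" 1] s by auto
      show "\<forall>\<^sub>F n in sequentially. step (real (Suc n) * s) = (if s > 0 then 1 else 0)"
      proof (rule eventually_sequentiallyI)
        fix n assume "n \<ge> N"
        then have "real N * \<bar>s\<bar> \<le> real (Suc n) * \<bar>s\<bar>" by (intro mult_right_mono) auto
        then have "real (Suc n) * \<bar>s\<bar> \<ge> 1" using N by linarith
        then show "step (real (Suc n) * s) = (if s > 0 then 1 else 0)"
          using s by (cases "s > 0") (simp_all add: step_left step_right abs_if)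
      qed
    qed
    have "AE t in lborel. t \<noteq> x \<and> t \<noteq> y"
      using AE_lborel_singleton[of x] AE_lborel_singleton[of y] by eventually_elim auto
    then show "AE t in lborel. (\<lambda>n. g t * \<psi> n t) \<longlonglongrightarrow> indicator {x..y} t *\<^sub>R g t"
    proof eventually_elim
      case (elim t)
      have "(\<lambda>n. \<psi> n t) \<longlonglongrightarrow> complex_of_real ((if t - x > 0 then 1 else 0) - (if t - y > 0 then 1 else 0))"
        unfolding \<psi>_def by (intro tendsto_of_real tendsto_diff ne) (use elim in auto)
      then have "(\<lambda>n. g t * \<psi> n t) \<longlonglongrightarrow> g t * complex_of_real ((if t - x > 0 then 1 else 0) - (if t - y > 0 then 1 else 0))"
        by (rule tendsto_mult_left)
      moreover have "g t * complex_of_real ((if t - x > 0 then 1 else 0) - (if t - y > 0 then 1 else 0)) = indicator {x..y} t *\<^sub>R g t"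
        using elim \<open>x \<le> y\<close> by (auto simp: indicator_def)
      ultimately show ?case by simp
    qed
  qed
  then have "(\<lambda>n. LINT t|lborel. f t * \<psi>' n t) \<longlonglongrightarrow> - (LINT t|lborel. indicator {x..y} t *\<^sub>R g t)"
    unfolding w by (rule tendsto_minus)
  ultimately have "f x - f y = - (LINT t|lborel. indicator {x..y} t *\<^sub>R g t)"
    by (rule LIMSEQ_unique)
  then show ?thesis unfolding set_lebesgue_integral_def by (simp add: algebra_simps)
qed

text \<open>The Borel sets on which \<open>h\<close>, cut off to \<open>[-n, n]\<close>, integrates to \<open>0\<close> form a Dynkin system containing the
intervals.\<close>

lemma AE_eq_0_if_integrals_eq_0:
  assumes h: "locally_integrable h"
    and 0: "\<And>x y. x \<le> y \<Longrightarrow> (LINT t:{x..y}|lborel. h t) = 0"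
  shows "AE t in lborel. h t = 0"
proof -
  have "AE t in lborel. indicator {-real n..real n} t *\<^sub>R h t = 0" for n
  proof (rule sigma_finite_measure.density_zero)
    show "sigma_finite_measure (lborel :: real measure)" by (rule sigma_finite_lborel)
    show i: "integrable lborel (\<lambda>t. indicator {-real n..real n} t *\<^sub>R h t)"
      using h unfolding locally_integrable_def set_integrable_def by blast
    then have si: "set_integrable lborel A (\<lambda>t. indicator {-real n..real n} t *\<^sub>R h t)" if "A \<in> sets borel" for A
      unfolding set_integrable_def using integrable_mult_indicator[OF _ i] that by simp
    fix A :: "real set" assume "A \<in> sets lborel"
    then have "A \<in> sets borel" by simp
    then show "set_lebesgue_integral lborel A (\<lambda>t. indicator {-real n..real n} t *\<^sub>R h t) = 0"
    proof (induction rule: borel_set_induct)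
      case empty
      then show ?case by (simp add: set_lebesgue_integral_def)
    next
      case (interval a b)
      have "set_lebesgue_integral lborel {a..b} (\<lambda>t. indicator {-real n..real n} t *\<^sub>R h t)
        = (LINT t:{max a (-real n)..min b (real n)}|lborel. h t)"
        unfolding set_lebesgue_integral_def
        by (intro Bochner_Integration.integral_cong) (auto simp: indicator_def)
      also have "\<dots> = 0"
        using 0[of "max a (-real n)" "min b (real n)"]
        by (cases "max a (-real n) \<le> min b (real n)") (auto simp: set_lebesgue_integral_def)
      finally show ?case .
    next
      case (compl A)
      have "(LINT t|lborel. indicator {-real n..real n} t *\<^sub>R h t) = 0"
        using 0[of "-real n" "real n"] by (simp add: set_lebesgue_integral_def)
      moreover have "set_lebesgue_integral lborel (A \<union> -A) (\<lambda>t. indicator {-real n..real n} t *\<^sub>R h t)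
        = set_lebesgue_integral lborel A (\<lambda>t. indicator {-real n..real n} t *\<^sub>R h t)
        + set_lebesgue_integral lborel (-A) (\<lambda>t. indicator {-real n..real n} t *\<^sub>R h t)"
        by (rule set_integral_Un) (use compl si in auto)
      ultimately show ?case using compl by (simp add: set_lebesgue_integral_def)
    next
      case (union F)
      have "set_lebesgue_integral lborel (\<Union>i. F i) (\<lambda>t. indicator {-real n..real n} t *\<^sub>R h t)
        = (\<Sum>i. set_lebesgue_integral lborel (F i) (\<lambda>t. indicator {-real n..real n} t *\<^sub>R h t))"
        by (rule lebesgue_integral_countable_add)
           (use union si in \<open>auto simp: disjoint_family_on_def\<close>)
      then show ?case using union by simp
    qed
  qed
  then have "AE t in lborel. \<forall>n. indicator {-real n..real n} t *\<^sub>R h t = 0"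
    by (subst AE_all_countable) blast
  then show ?thesis
  proof eventually_elim
    case (elim t)
    obtain n where "\<bar>t\<bar> \<le> real n" using real_arch_simple by blast
    then show ?case using elim[rule_format, of n] by (auto simp: indicator_def abs_le_iff split: if_splits)
  qed
qed

lemma Lp_2_iff: "f \<in> Lp 2 \<longleftrightarrow> f \<in> borel_measurable borel \<and> integrable lborel (\<lambda>x. (norm (f x))\<^sup>2)"
  unfolding Lp_def by simp

lemma Lp_norm_2_power2: "(Lp_norm 2 f)\<^sup>2 = (LINT x|lborel. (norm (f x))\<^sup>2)"
proof -
  have "(LINT x|lborel. (norm (f x))\<^sup>2) \<ge> 0" by simp
  then show ?thesis
    unfolding Lp_norm_def by (simp add: powr_half_sqrt)
qed

lemma Lp_2_locally_integrable:
  assumes "f \<in> Lp 2" shows "locally_integrable f"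
  unfolding locally_integrable_def set_integrable_def
proof (intro allI)
  fix a b :: real
  have f: "f \<in> borel_measurable borel" "integrable lborel (\<lambda>x. (norm (f x))\<^sup>2)"
    using assms unfolding Lp_2_iff by auto
  show "integrable lborel (\<lambda>x. indicator {a..b} x *\<^sub>R f x)"
  proof (rule Bochner_Integration.integrable_bound)
    show "integrable lborel (\<lambda>x. indicator {a..b} x + (norm (f x))\<^sup>2)"
      using f by (auto intro!: Bochner_Integration.integrable_add integrable_real_indicator simp: emeasure_lborel_Icc_eq)
    show "(\<lambda>x. indicator {a..b} x *\<^sub>R f x) \<in> borel_measurable lborel" using f by simp
    have "n \<le> 1 + n\<^sup>2" for n :: real
      using sum_squares_bound[of n 1] zero_le_power2[of n] by (simp only: power_one mult_1_right)
    then show "AE x in lborel. norm (indicator {a..b} x *\<^sub>R f x) \<le> norm (indicator {a..b} x + (norm (f x))\<^sup>2)"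
      by (auto simp: indicator_def)
  qed
qed

lemma weak_deriv_AE_unique:
  assumes "continuous_on UNIV \<phi>" "is_weak_deriv \<phi> g" "is_weak_deriv \<phi> g'"
  shows "AE x in lborel. g x = g' x"
proof -
  have l: "locally_integrable g" "locally_integrable g'"
    using assms Lp_2_locally_integrable unfolding is_weak_deriv_def by auto
  have "AE x in lborel. g x - g' x = 0"
  proof (rule AE_eq_0_if_integrals_eq_0)
    show "locally_integrable (\<lambda>x. g x - g' x)"
      using l unfolding locally_integrable_def by (auto intro: set_integral_diff)
    fix x y :: real assume "x \<le> y"
    have "\<phi> y - \<phi> x = (LINT t:{x..y}|lborel. g t)" "\<phi> y - \<phi> x = (LINT t:{x..y}|lborel. g' t)"
      by (rule weak_derivative_FTC; use assms l \<open>x \<le> y\<close> in \<open>auto simp: is_weak_deriv_def\<close>)+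
    then show "(LINT t:{x..y}|lborel. g t - g' t) = 0"
      using l by (subst set_integral_diff) (auto simp: locally_integrable_def)
  qed
  then show ?thesis by simp
qed

text \<open>The kinetic energy does not depend on which representative of the weak derivative is chosen.\<close>

lemma kinetic_eq:
  assumes "continuous_on UNIV \<phi>" "is_weak_deriv \<phi> g"
  shows "(Lp_norm 2 (weak_deriv \<phi>))\<^sup>2 = (LINT x|lborel. (norm (g x))\<^sup>2)"
proof -
  have w: "is_weak_deriv \<phi> (weak_deriv \<phi>)"
    using someI[of "is_weak_deriv \<phi>", OF assms(2)] by (simp add: weak_deriv_def)
  have [measurable]: "g \<in> borel_measurable borel" "weak_deriv \<phi> \<in> borel_measurable borel"
    using w assms(2) unfolding is_weak_deriv_def Lp_2_iff by auto
  have "AE x in lborel. weak_deriv \<phi> x = g x"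
    by (rule weak_deriv_AE_unique[OF assms(1) w assms(2)])
  then show ?thesis
    unfolding Lp_norm_2_power2 by (intro integral_cong_AE) auto
qed

section \<open>Arclength along functions of class H1\<close>

lemma set_integrable_mult_continuous:
  fixes h G :: "real \<Rightarrow> real"
  assumes G: "set_integrable lborel {a..b} G" and h: "continuous_on {a..b} h"
  shows "set_integrable lborel {a..b} (\<lambda>t. h t * G t)"
proof -
  have "compact (h ` {a..b})" using h by (intro compact_continuous_image) auto
  then obtain B where B: "\<And>x. x \<in> {a..b} \<Longrightarrow> norm (h x) \<le> B"
    by (meson bounded_iff compact_imp_bounded imageI)
  have h': "(\<lambda>t. indicator {a..b} t *\<^sub>R h t) \<in> borel_measurable borel"
    using borel_integrable_atLeastAtMost'[OF h] unfolding set_integrable_def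
    by (auto dest: borel_measurable_integrable)
  have i: "integrable lborel (\<lambda>t. indicator {a..b} t *\<^sub>R G t)"
    using G unfolding set_integrable_def .
  show ?thesis unfolding set_integrable_def
  proof (rule Bochner_Integration.integrable_bound)
    show "integrable lborel (\<lambda>t. B * (indicator {a..b} t *\<^sub>R G t))"
      using i by (rule integrable_mult_right)
    have "(\<lambda>t. indicator {a..b} t *\<^sub>R (h t * G t)) = (\<lambda>t. (indicator {a..b} t *\<^sub>R h t) * (indicator {a..b} t *\<^sub>R G t))"
      by (auto simp: indicator_def)
    also have "\<dots> \<in> borel_measurable lborel"
      using h' borel_measurable_integrable[OF i] by (intro borel_measurable_times) simp_all
    finally show "(\<lambda>t. indicator {a..b} t *\<^sub>R (h t * G t)) \<in> borel_measurable lborel" .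
    show "AE x in lborel. norm (indicator {a..b} x *\<^sub>R (h x * G x)) \<le> norm (B * (indicator {a..b} x *\<^sub>R G x))"
    proof (rule AE_I2)
      fix x show "norm (indicator {a..b} x *\<^sub>R (h x * G x)) \<le> norm (B * (indicator {a..b} x *\<^sub>R G x))"
        using B[of x] by (cases "x \<in> {a..b}") (auto simp: abs_mult intro!: mult_right_mono)
    qed
  qed
qed

lemma set_integrable_integrable_on:
  fixes G :: "real \<Rightarrow> real"
  shows "set_integrable lborel S G \<Longrightarrow> G integrable_on S"
  by (rule set_borel_integral_eq_integral)

lemma set_integrable_Icc_subset:
  fixes G :: "real \<Rightarrow> real"
  shows "set_integrable lborel {a..b} G \<Longrightarrow> a \<le> x \<Longrightarrow> y \<le> b \<Longrightarrow> set_integrable lborel {x..y} G"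
  by (erule set_integrable_subset) auto

text \<open>The length of the path \<open>u\<close> in the metric \<open>w\<close> dominates the distance \<open>\<bar>F (u b) - F (u a)\<bar>\<close> of its end
points. Differentiability of \<open>u\<close> is replaced by the integrated bound \<open>lip\<close>, which is all
that \<open>|\<phi>|\<close> inherits from the weak derivative of \<open>\<phi>\<close>; the chain rule is replaced by cutting \<open>[a, b]\<close>
into pieces on which \<open>w \<circ> u\<close> varies by less than \<open>e\<close>.\<close>

lemma arclength_bound:
  fixes u G F w :: "real \<Rightarrow> real"
  assumes "a \<le> b"
    and u: "continuous_on {a..b} u" and u0: "\<And>x. u x \<ge> 0"
    and G: "set_integrable lborel {a..b} G" and G0: "\<And>x. G x \<ge> 0"
    and lip: "\<And>x y. a \<le> x \<Longrightarrow> x \<le> y \<Longrightarrow> y \<le> b \<Longrightarrow> \<bar>u y - u x\<bar> \<le> integral {x..y} G"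
    and F: "\<And>s. s \<ge> 0 \<Longrightarrow> (F has_real_derivative w s) (at s)"
    and w: "continuous_on {0..} w" and w0: "\<And>s. s \<ge> 0 \<Longrightarrow> w s \<ge> 0"
  shows "\<bar>F (u b) - F (u a)\<bar> \<le> integral {a..b} (\<lambda>t. w (u t) * G t)"
proof -
  have wu: "continuous_on {a..b} (\<lambda>t. w (u t))"
    by (rule continuous_on_compose2[OF w u]) (use u0 in auto)
  have swG: "set_integrable lborel {a..b} (\<lambda>t. w (u t) * G t)"
    by (intro set_integrable_mult_continuous G wu)
  have main: "\<bar>F (u b) - F (u a)\<bar> \<le> integral {a..b} (\<lambda>t. (w (u t) + e) * G t)" if e: "e > 0" for e
  proof -
    have si: "set_integrable lborel {a..b} (\<lambda>t. (w (u t) + e) * G t)"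
      by (intro set_integrable_mult_continuous G continuous_intros wu)
    have ion: "(\<lambda>t. (w (u t) + e) * G t) integrable_on {x..y}" if "a \<le> x" "y \<le> b" for x y
      using set_integrable_integrable_on[OF set_integrable_Icc_subset[OF si that]] .
    define P where "P x y \<longleftrightarrow> (a \<le> x \<longrightarrow> y \<le> b \<longrightarrow>
      \<bar>F (u y) - F (u x)\<bar> \<le> integral {x..y} (\<lambda>t. (w (u t) + e) * G t))" for x y
    have "P a b"
      using \<open>a \<le> b\<close>
    proof (induction rule: Bolzano)
      case (trans x y z)
      show ?case unfolding P_def
      proof (intro impI)
        assume "a \<le> x" "z \<le> b"
        then have "\<bar>F (u y) - F (u x)\<bar> \<le> integral {x..y} (\<lambda>t. (w (u t) + e) * G t)"
          "\<bar>F (u z) - F (u y)\<bar> \<le> integral {y..z} (\<lambda>t. (w (u t) + e) * G t)"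
          using trans by (auto simp: P_def)
        moreover have "integral {x..y} (\<lambda>t. (w (u t) + e) * G t) + integral {y..z} (\<lambda>t. (w (u t) + e) * G t)
          = integral {x..z} (\<lambda>t. (w (u t) + e) * G t)"
          by (rule Henstock_Kurzweil_Integration.integral_combine)
             (use trans ion \<open>a \<le> x\<close> \<open>z \<le> b\<close> in auto)
        ultimately show "\<bar>F (u z) - F (u x)\<bar> \<le> integral {x..z} (\<lambda>t. (w (u t) + e) * G t)"
          by linarith
      qed
    next
      case (local x)
      have "x \<in> {a..b}" "e / 2 > 0" using local e by auto
      then have "\<exists>d>0. \<forall>t\<in>{a..b}. dist t x < d \<longrightarrow> dist (w (u t)) (w (u x)) < e / 2"
        using wu unfolding continuous_on_iff by blast
      then obtain d where d: "d > 0" "\<And>t. t \<in> {a..b} \<Longrightarrow> dist t x < d \<Longrightarrow> dist (w (u t)) (w (u x)) < e / 2"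
        by blast
      show ?case unfolding P_def
      proof (intro exI[of _ d] conjI allI impI)
        show "d > 0" by fact
        fix a' b' assume x: "a' \<le> x \<and> x \<le> b' \<and> b' - a' < d" and ab: "a \<le> a'" "b' \<le> b"
        have wle: "w (u s) \<le> w (u t) + e" if "s \<in> {a'..b'}" "t \<in> {a'..b'}" for s t
        proof -
          have "\<bar>w (u s) - w (u x)\<bar> < e / 2" "\<bar>w (u t) - w (u x)\<bar> < e / 2"
            using d(2)[of s] d(2)[of t] that x ab by (auto simp: dist_real_def)
          then show ?thesis by linarith
        qed
        have le: "\<bar>F (u b') - F (u a')\<bar> \<le> (w (u t) + e) * \<bar>u b' - u a'\<bar>" if t: "t \<in> {a'..b'}" for t
        proof (cases "u a' = u b'")
          case False
          define m M where "m = min (u a') (u b')" and "M = max (u a') (u b')"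
          have mM: "m < M" "m \<ge> 0" using False u0 by (auto simp: m_def M_def)
          obtain \<xi> where \<xi>: "m < \<xi>" "\<xi> < M" "F M - F m = (M - m) * w \<xi>"
            using MVT2[OF \<open>m < M\<close>, of F w] F mM by auto
          have cu: "continuous_on {a'..b'} u" by (rule continuous_on_subset[OF u]) (use ab in auto)
          have "\<exists>s. a' \<le> s \<and> s \<le> b' \<and> u s = \<xi>"
          proof (cases "u a' \<le> u b'")
            case True
            then show ?thesis using IVT'[of u a' \<xi> b'] \<xi> cu x by (auto simp: m_def M_def)
          next
            case F: False
            then show ?thesis using IVT2'[of u b' \<xi> a'] \<xi> cu x by (auto simp: m_def M_def)
          qed
          then obtain s where s: "s \<in> {a'..b'}" "u s = \<xi>" by auto
          have "\<bar>F (u b') - F (u a')\<bar> = \<bar>F M - F m\<bar>"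
            by (auto simp: m_def M_def min_def max_def)
          also have "\<dots> = w \<xi> * \<bar>u b' - u a'\<bar>"
            unfolding \<xi>(3) using w0[of \<xi>] \<xi> mM by (auto simp: m_def M_def min_def max_def abs_mult)
          also have "\<dots> \<le> (w (u t) + e) * \<bar>u b' - u a'\<bar>"
            using wle[OF s(1) t] s(2) by (intro mult_right_mono) auto
          finally show ?thesis .
        qed (use w0[OF u0] e in simp)
        \<comment> \<open>The infimum is a constant that can be moved under the integral of \<open>G\<close>.\<close>
        define c where "c = Inf ((\<lambda>t. w (u t) + e) ` {a'..b'})"
        have ne: "{a'..b'} \<noteq> {}" using x by auto
        have "c \<ge> 0" unfolding c_def
          using ne w0[OF u0] e by (intro cInf_greatest) (auto intro: add_nonneg_nonneg less_imp_le)
        have c_le: "c \<le> w (u t) + e" if "t \<in> {a'..b'}" for t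
          unfolding c_def using that w0[OF u0] e
          by (intro cInf_lower bdd_belowI[of _ 0]) (auto intro: add_nonneg_nonneg less_imp_le)
        have "\<bar>F (u b') - F (u a')\<bar> \<le> c * \<bar>u b' - u a'\<bar>"
        proof (cases "\<bar>u b' - u a'\<bar> = 0")
          case False
          have "\<bar>F (u b') - F (u a')\<bar> / \<bar>u b' - u a'\<bar> \<le> c"
            unfolding c_def using ne le False
            by (intro cInf_greatest) (auto simp: divide_le_eq)
          then show ?thesis using False by (simp add: divide_le_eq)
        qed simp
        also have "\<dots> \<le> c * integral {a'..b'} G"
          using lip[of a' b'] x ab \<open>c \<ge> 0\<close> by (intro mult_left_mono) auto
        also have "\<dots> = integral {a'..b'} (\<lambda>t. c * G t)" by simp
        also have "\<dots> \<le> integral {a'..b'} (\<lambda>t. (w (u t) + e) * G t)"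
        proof (rule integral_le)
          show "(\<lambda>t. c * G t) integrable_on {a'..b'}"
            by (intro set_integrable_integrable_on set_integrable_mult_right set_integrable_Icc_subset[OF G] ab)
        qed (use ion ab c_le G0 in \<open>auto intro: mult_right_mono\<close>)
        finally show "\<bar>F (u b') - F (u a')\<bar> \<le> integral {a'..b'} (\<lambda>t. (w (u t) + e) * G t)" .
      qed
    qed
    then show ?thesis by (simp add: P_def)
  qed
  \<comment> \<open>Adding \<open>1\<close> to \<open>I\<close> below avoids a division by zero when \<open>G\<close> vanishes.\<close>
  define I where "I = integral {a..b} G"
  have I: "I \<ge> 0" unfolding I_def
    using G0 by (intro integral_nonneg set_integrable_integrable_on G) auto
  have ex: "integral {a..b} (\<lambda>t. (w (u t) + e) * G t) = integral {a..b} (\<lambda>t. w (u t) * G t) + e * I" for e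
    unfolding I_def distrib_right
    by (subst integral_add) (auto intro!: set_integrable_integrable_on swG integrable_on_cmult_left G)
  show ?thesis
  proof (rule field_le_epsilon)
    fix d :: real assume "d > 0"
    have "\<bar>F (u b) - F (u a)\<bar> \<le> integral {a..b} (\<lambda>t. w (u t) * G t) + d / (I + 1) * I"
      using main[of "d / (I + 1)"] ex \<open>d > 0\<close> I by simp
    also have "d / (I + 1) * I \<le> d" using I \<open>d > 0\<close> by (simp add: field_simps)
    finally show "\<bar>F (u b) - F (u a)\<bar> \<le> integral {a..b} (\<lambda>t. w (u t) * G t) + d" by simp
  qed
qed

text \<open>What the lower bounds use of \<open>\<phi> \<in> H1\<close>, with \<open>u\<close> a multiple of \<open>|\<phi>|\<close> and \<open>G\<close> the same multiple of
\<open>|\<phi>'|\<close>.\<close>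

locale h1_path =
  fixes u G :: "real \<Rightarrow> real"
  assumes u_cont: "continuous_on UNIV u" and u_nonneg: "\<And>x. u x \<ge> 0"
    and G_nonneg: "\<And>x. G x \<ge> 0" and G_meas: "G \<in> borel_measurable borel"
    and u_sq: "integrable lborel (\<lambda>x. (u x)\<^sup>2)" and G_sq: "integrable lborel (\<lambda>x. (G x)\<^sup>2)"
    and lip: "\<And>x y. x \<le> y \<Longrightarrow> \<bar>u y - u x\<bar> \<le> integral {x..y} G"
begin

lemma u_meas [measurable]: "u \<in> borel_measurable borel"
  by (intro borel_measurable_continuous_onI u_cont)

lemma G_meas' [measurable]: "G \<in> borel_measurable borel" by (rule G_meas)

lemma G_set_integrable: "set_integrable lborel {a..b} G"
  unfolding set_integrable_def
proof (rule Bochner_Integration.integrable_bound)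
  show "integrable lborel (\<lambda>x. indicator {a..b} x + (G x)\<^sup>2)"
    using G_sq by (auto intro!: Bochner_Integration.integrable_add integrable_real_indicator simp: emeasure_lborel_Icc_eq)
  have "n \<le> 1 + n\<^sup>2" for n :: real
    using sum_squares_bound[of n 1] zero_le_power2[of n] by (simp only: power_one mult_1_right)
  then show "AE x in lborel. norm (indicator {a..b} x *\<^sub>R G x) \<le> norm (indicator {a..b} x + (G x)\<^sup>2)"
    using G_nonneg by (auto simp: indicator_def)
qed measurable

lemma arclength:
  assumes "a \<le> b" "\<And>s. s \<ge> 0 \<Longrightarrow> (F has_real_derivative w s) (at s)"
    "continuous_on {0..} w" "\<And>s. s \<ge> 0 \<Longrightarrow> w s \<ge> 0"
  shows "\<bar>F (u b) - F (u a)\<bar> \<le> integral {a..b} (\<lambda>t. w (u t) * G t)"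
  by (rule arclength_bound)
     (use assms u_nonneg G_nonneg G_set_integrable lip continuous_on_subset[OF u_cont] in auto)

lemma small_values:
  assumes "e > 0"
  shows "\<exists>y\<ge>x. u y < e" "\<exists>y\<le>x. u y < e"
proof -
  have *: False if "\<And>y. y \<in> {x'..x'+real n} \<Longrightarrow> u y \<ge> e" "real n * e\<^sup>2 > (LINT t|lborel. (u t)\<^sup>2)" for x' n
  proof -
    have "(LINT t|lborel. e\<^sup>2 * indicator {x'..x'+real n} t) \<le> (LINT t|lborel. (u t)\<^sup>2)"
      using that(1) \<open>e > 0\<close> u_sq
      by (intro integral_mono integrable_mult_right integrable_real_indicator)
         (auto simp: emeasure_lborel_Icc_eq indicator_def intro!: power_mono)
    then show False using that(2) by (simp add: mult.commute)
  qed
  obtain n :: nat where n: "real n * e\<^sup>2 > (LINT t|lborel. (u t)\<^sup>2)"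
    using ex_less_of_nat_mult[of "e\<^sup>2"] assms by auto
  show "\<exists>y\<ge>x. u y < e" using *[OF _ n, of x] by force
  show "\<exists>y\<le>x. u y < e" using *[OF _ n, of "x - real n"] by force
qed

text \<open>The arclength bound for \<open>F s = s\<^sup>2\<close>, together with \<open>2 u G \<le> u\<^sup>2 + G\<^sup>2\<close>, controls \<open>\<bar>u(y)\<^sup>2 - u(x)\<^sup>2\<bar>\<close> by the tail
of the \<open>H1\<close> norm, and \<open>u y\<close> can be taken arbitrarily small.\<close>

lemma sq_bound_by_tail:
  assumes "\<bar>x\<bar> \<ge> R"
  shows "(u x)\<^sup>2 \<le> (LINT t|lborel. indicator {t. \<bar>t\<bar> \<ge> R} t * ((u t)\<^sup>2 + (G t)\<^sup>2))"
proof -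
  let ?T = "LINT t|lborel. indicator {t. \<bar>t\<bar> \<ge> R} t * ((u t)\<^sup>2 + (G t)\<^sup>2)"
  have iT: "integrable lborel (\<lambda>t. indicator {t. \<bar>t\<bar> \<ge> R} t * ((u t)\<^sup>2 + (G t)\<^sup>2))"
    using integrable_mult_indicator[of "{t. \<bar>t\<bar> \<ge> R}" lborel "\<lambda>t. (u t)\<^sup>2 + (G t)\<^sup>2"] u_sq G_sq
    by simp
  have bound: "\<bar>(u b)\<^sup>2 - (u a)\<^sup>2\<bar> \<le> ?T" if ab: "a \<le> b" "{a..b} \<subseteq> {t. \<bar>t\<bar> \<ge> R}" for a b
  proof -
    have "\<bar>(u b)\<^sup>2 - (u a)\<^sup>2\<bar> \<le> integral {a..b} (\<lambda>t. 2 * u t * G t)"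
      by (rule arclength[OF ab(1), of "\<lambda>s. s\<^sup>2" "\<lambda>s. 2 * s"])
         (auto intro!: derivative_eq_intros continuous_intros)
    also have si: "set_integrable lborel {a..b} (\<lambda>t. 2 * u t * G t)"
      by (intro set_integrable_mult_continuous G_set_integrable continuous_intros continuous_on_subset[OF u_cont]) auto
    then have "integral {a..b} (\<lambda>t. 2 * u t * G t) = (LINT t:{a..b}|lborel. 2 * u t * G t)"
      by (simp add: set_borel_integral_eq_integral)
    also have "\<dots> \<le> ?T"
      unfolding set_lebesgue_integral_def
    proof (rule integral_mono[OF _ iT])
      show "integrable lborel (\<lambda>t. indicator {a..b} t *\<^sub>R (2 * u t * G t))"
        using si unfolding set_integrable_def .
      fix t
      have "2 * u t * G t \<le> (u t)\<^sup>2 + (G t)\<^sup>2" by (rule sum_squares_bound)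
      then show "indicator {a..b} t *\<^sub>R (2 * u t * G t) \<le> indicator {t. \<bar>t\<bar> \<ge> R} t * ((u t)\<^sup>2 + (G t)\<^sup>2)"
        using ab(2) by (cases "t \<in> {a..b}") (auto simp: indicator_def)
    qed
    finally show ?thesis .
  qed
  have "(u x)\<^sup>2 \<le> ?T + e" if "e > 0" for e
  proof -
    have "sqrt e > 0" using that by simp
    show ?thesis
    proof (cases "x \<ge> 0")
      case True
      obtain y where y: "y \<ge> x" "u y < sqrt e" using small_values(1)[OF \<open>sqrt e > 0\<close>] by blast
      have "\<bar>(u y)\<^sup>2 - (u x)\<^sup>2\<bar> \<le> ?T" using True y assms by (intro bound) auto
      moreover have "(u y)\<^sup>2 \<le> (sqrt e)\<^sup>2" using y u_nonneg by (intro power_mono) auto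
      ultimately show ?thesis using that by simp
    next
      case False
      obtain y where y: "y \<le> x" "u y < sqrt e" using small_values(2)[OF \<open>sqrt e > 0\<close>] by blast
      have "\<bar>(u x)\<^sup>2 - (u y)\<^sup>2\<bar> \<le> ?T" using False y assms by (intro bound) auto
      moreover have "(u y)\<^sup>2 \<le> (sqrt e)\<^sup>2" using y u_nonneg by (intro power_mono) auto
      ultimately show ?thesis using that by simp
    qed
  qed
  then show ?thesis by (rule field_le_epsilon)
qed

lemma u_vanishes: "(u \<longlongrightarrow> 0) at_top" "(u \<longlongrightarrow> 0) at_bot"
proof -
  let ?h = "\<lambda>t. (u t)\<^sup>2 + (G t)\<^sup>2"
  let ?T = "\<lambda>R. LINT t|lborel. indicator {t. \<bar>t\<bar> \<ge> R} t * ?h t"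
  have "(?T \<longlongrightarrow> (LINT t::real|lborel. 0)) at_top"
  proof (rule integral_dominated_convergence_at_top[where w="?h"])
    show "AE x in lborel. ((\<lambda>R. indicator {t. \<bar>t\<bar> \<ge> R} x * ?h x) \<longlongrightarrow> 0) at_top"
    proof (rule AE_I2, rule tendsto_eventually)
      fix x :: real
      show "\<forall>\<^sub>F R in at_top. indicator {t. \<bar>t\<bar> \<ge> R} x * ?h x = 0"
        using eventually_gt_at_top[of "\<bar>x\<bar>"] by eventually_elim (auto simp: indicator_def)
    qed
    show "\<forall>\<^sub>F R in at_top. AE x in lborel. norm (indicator {t. \<bar>t\<bar> \<ge> R} x * ?h x) \<le> ?h x"
      by (intro always_eventually allI AE_I2) (auto simp: indicator_def)
  qed (use u_sq G_sq in auto)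
  then have T: "(?T \<longlongrightarrow> 0) at_top" by simp
  have sq: "((\<lambda>R. sqrt (?T R)) \<longlongrightarrow> 0) at_top"
    using tendsto_real_sqrt[OF T] by simp
  have le: "u x \<le> sqrt (?T \<bar>x\<bar>)" for x
    using sq_bound_by_tail[of "\<bar>x\<bar>" x] u_nonneg by (simp add: real_le_rsqrt)
  show "(u \<longlongrightarrow> 0) at_top"
  proof (rule tendsto_sandwich[OF _ _ tendsto_const])
    show "\<forall>\<^sub>F x in at_top. u x \<le> sqrt (?T \<bar>x\<bar>)" using le by simp
    show "((\<lambda>x. sqrt (?T \<bar>x\<bar>)) \<longlongrightarrow> 0) at_top"
      by (rule filterlim_compose[OF sq filterlim_abs_real])
  qed (use u_nonneg in simp)
  show "(u \<longlongrightarrow> 0) at_bot"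
  proof (rule tendsto_sandwich[OF _ _ tendsto_const])
    show "\<forall>\<^sub>F x in at_bot. u x \<le> sqrt (?T \<bar>x\<bar>)" using le by simp
    have "filterlim (\<lambda>x::real. \<bar>x\<bar>) at_top at_bot"
      using filterlim_compose[OF filterlim_abs_real filterlim_uminus_at_top_at_bot] by simp
    then show "((\<lambda>x. sqrt (?T \<bar>x\<bar>)) \<longlongrightarrow> 0) at_bot"
      by (rule filterlim_compose[OF sq])
  qed (use u_nonneg in simp)
qed

lemma attains_max:
  assumes "u x1 > 0"
  shows "\<exists>x0. u x0 > 0 \<and> (\<forall>x. u x \<le> u x0)"
proof -
  have "\<forall>\<^sub>F x in at_top. u x < u x1" "\<forall>\<^sub>F x in at_bot. u x < u x1"
    using order_tendstoD(2)[OF u_vanishes(1) assms] order_tendstoD(2)[OF u_vanishes(2) assms] by auto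
  then obtain B A where B: "\<And>x. x \<ge> B \<Longrightarrow> u x < u x1" and A: "\<And>x. x \<le> A \<Longrightarrow> u x < u x1"
    unfolding eventually_at_top_linorder eventually_at_bot_linorder by blast
  have in': "x1 \<in> {A..B}" using A[of x1] B[of x1] by (meson atLeastAtMost_iff less_irrefl linear)
  obtain x0 where x0: "x0 \<in> {A..B}" "\<And>x. x \<in> {A..B} \<Longrightarrow> u x \<le> u x0"
    using continuous_attains_sup[of "{A..B}" u] in' continuous_on_subset[OF u_cont] by auto
  have "u x \<le> u x0" for x
    using x0(2)[of x] x0(2)[OF in'] A[of x] B[of x] by (cases "x < A"; cases "x > B") auto
  moreover have "u x0 > 0" using assms x0(2)[OF in'] by simp
  ultimately show ?thesis by blast
qed

lemma bounded_above: "\<exists>B>0. \<forall>x. u x \<le> B"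
proof (cases "\<exists>x. u x > 0")
  case True
  then show ?thesis using attains_max by blast
next
  case False
  then show ?thesis by (intro exI[of _ 1]) (auto simp: not_less intro: order_trans)
qed

lemma u_powr_integrable:
  assumes "q \<ge> 2" shows "integrable lborel (\<lambda>x. u x powr q)"
proof -
  obtain B where B: "B > 0" "\<And>x. u x \<le> B" using bounded_above by blast
  show ?thesis
  proof (rule Bochner_Integration.integrable_bound)
    show "integrable lborel (\<lambda>x. B powr (q - 2) * (u x)\<^sup>2)" using u_sq by simp
    have "u x powr q \<le> B powr (q - 2) * (u x)\<^sup>2" for x
    proof -
      have "u x powr q = u x powr (q - 2) * u x powr 2" by (simp flip: powr_add)
      also have "u x powr 2 = (u x)\<^sup>2" using u_nonneg by simp
      also have "u x powr (q - 2) \<le> B powr (q - 2)"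
        using assms u_nonneg B(2) by (intro powr_mono2) auto
      finally show ?thesis by (simp add: mult_right_mono)
    qed
    then show "AE x in lborel. norm (u x powr q) \<le> norm (B powr (q - 2) * (u x)\<^sup>2)"
      by (intro AE_I2) (simp add: abs_mult)
  qed measurable
qed

end

section \<open>The phase plane of the stationary equation\<close>

locale nls =
  fixes p \<omega> :: real
  assumes p_gt_5: "p > 5" and \<omega>_pos: "\<omega> > 0"
begin

text \<open>Standing waves of the equation without delta satisfy the first integral \<open>Q'\<^sup>2 = W Q\<close>.\<close>

definition W :: "real \<Rightarrow> real" where
  "W s = 2 * \<omega> * s\<^sup>2 - 4 / (p + 1) * \<bar>s\<bar> powr (p + 1)"

text \<open>The truncation at \<open>0\<close> only affects heights above \<open>peak\<close>, which the rescaled paths never reach.\<close>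

definition speed :: "real \<Rightarrow> real" where
  "speed s = sqrt (max 0 (W s))"

text \<open>For \<open>s \<ge> 0\<close> this is the integral of \<open>speed\<close> over \<open>[0, s]\<close>; starting at \<open>-1\<close> gives a two-sided derivative
at \<open>s = 0\<close>.\<close>

definition cost :: "real \<Rightarrow> real" where
  "cost s = integral {-1..s} speed - integral {-1..0} speed"

text \<open>The positive zero of \<open>W\<close>, that is, the height of the soliton.\<close>

definition peak :: real where
  "peak = ((p + 1) * \<omega> / 2) powr (1 / (p - 1))"

lemma peak_pos: "peak > 0"
  using p_gt_5 \<omega>_pos by (simp add: peak_def)

lemma peak_powr: "peak powr (p - 1) = (p + 1) * \<omega> / 2"
  using p_gt_5 \<omega>_pos by (simp add: peak_def powr_powr)

lemma W_factor: "s \<ge> 0 \<Longrightarrow> W s = s\<^sup>2 * (2 * \<omega> - 4 / (p + 1) * s powr (p - 1))"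
proof (cases "s = 0")
  case False
  assume "s \<ge> 0"
  then have "\<bar>s\<bar> powr (p + 1) = s powr 2 * s powr (p - 1)"
    using powr_add[of s 2 "p - 1"] by (simp add: add.commute)
  also have "s powr 2 = s\<^sup>2" using \<open>s \<ge> 0\<close> by simp
  finally show ?thesis unfolding W_def by (simp add: algebra_simps)
qed (simp add: W_def)

lemma W_nonneg:
  assumes "0 \<le> s" "s \<le> peak" shows "W s \<ge> 0"
proof -
  have "s powr (p - 1) \<le> (p + 1) * \<omega> / 2"
    unfolding peak_powr[symmetric] using assms p_gt_5 by (intro powr_mono2) auto
  then have "4 / (p + 1) * s powr (p - 1) \<le> 4 / (p + 1) * ((p + 1) * \<omega> / 2)"
    using p_gt_5 by (intro mult_left_mono) auto
  also have "\<dots> = 2 * \<omega>" using p_gt_5 by (simp add: field_simps)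
  finally show ?thesis unfolding W_factor[OF assms(1)] by simp
qed

lemma W_peak: "W peak = 0"
  unfolding W_factor[OF less_imp_le[OF peak_pos]] peak_powr using p_gt_5 by (simp add: field_simps)

lemma continuous_W: "continuous_on A W"
  unfolding W_def using p_gt_5 by (intro continuous_intros continuous_on_powr') auto

lemma continuous_speed: "continuous_on A speed"
  unfolding speed_def by (intro continuous_intros continuous_W)

lemma speed_nonneg: "speed s \<ge> 0" by (simp add: speed_def)

lemma speed_sq: "0 \<le> s \<Longrightarrow> s \<le> peak \<Longrightarrow> (speed s)\<^sup>2 = W s"
  using W_nonneg by (simp add: speed_def)

lemma speed_less: assumes "s > 0" shows "speed s < sqrt (2 * \<omega>) * s"
proof -
  have "W s < 2 * \<omega> * s\<^sup>2" unfolding W_def using assms p_gt_5 by simp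
  then have "max 0 (W s) < 2 * \<omega> * s\<^sup>2" using assms \<omega>_pos by simp
  then have "speed s < sqrt (2 * \<omega> * s\<^sup>2)" unfolding speed_def by (rule real_sqrt_less_mono)
  then show ?thesis using assms by (simp add: real_sqrt_mult)
qed

lemma speed_0: "speed 0 = 0" by (simp add: speed_def W_def)

lemma speed_le: "s \<ge> 0 \<Longrightarrow> speed s \<le> sqrt (2 * \<omega>) * s"
  using speed_less[of s] speed_0 by (cases "s = 0") auto

lemma cost_deriv:
  assumes "s \<ge> 0" shows "(cost has_real_derivative speed s) (at s)"
proof -
  have "((\<lambda>s. integral {-1..s} speed) has_real_derivative speed s) (at s within {-1..s+1})"
    by (rule integral_has_real_derivative) (use assms in \<open>auto simp: continuous_speed\<close>)
  then have "((\<lambda>s. integral {-1..s} speed) has_real_derivative speed s) (at s)"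
    using at_within_interior[of s "{-1..s+1}"] assms by simp
  then show ?thesis unfolding cost_def by (auto intro!: derivative_eq_intros)
qed

lemma cost_0: "cost 0 = 0" by (simp add: cost_def)

lemma cost_mono: "0 \<le> s \<Longrightarrow> s \<le> t \<Longrightarrow> cost s \<le> cost t"
  by (rule DERIV_nonneg_imp_nondecreasing[of s t cost]) (meson cost_deriv speed_nonneg order_trans)+

lemma cost_nonneg: "s \<ge> 0 \<Longrightarrow> cost s \<ge> 0"
  using cost_mono[of 0 s] by (simp add: cost_0)

lemma speed_pos: assumes "0 < s" "s < peak" shows "speed s > 0"
proof -
  have "s powr (p - 1) < (p + 1) * \<omega> / 2"
    unfolding peak_powr[symmetric] using assms p_gt_5 by (intro powr_less_mono2) auto
  then have "4 / (p + 1) * s powr (p - 1) < 4 / (p + 1) * ((p + 1) * \<omega> / 2)"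
    using p_gt_5 by (intro mult_strict_left_mono) auto
  also have "\<dots> = 2 * \<omega>" using p_gt_5 by (simp add: field_simps)
  finally have "W s > 0" using assms(1) W_factor[of s] by simp
  then show ?thesis by (simp add: speed_def)
qed

lemma cost_peak_pos: "cost peak > 0"
proof -
  obtain z where "0 < z" "z < peak" "cost peak - cost 0 = (peak - 0) * speed z"
    using MVT2[OF peak_pos, of cost speed] cost_deriv by auto
  then show ?thesis using speed_pos peak_pos by (simp add: cost_0)
qed

lemma cost_tendsto_0: "(v \<longlongrightarrow> 0) F \<Longrightarrow> ((\<lambda>x. cost (v x)) \<longlongrightarrow> 0) F"
  using isCont_tendsto_compose[OF DERIV_isCont[OF cost_deriv[of 0]], of v F] by (simp add: cost_0)

end

text \<open>A path rescaled by \<open>v = \<mu>\<^sup>1\<^sup>/\<^sup>2 |\<phi>|\<close>, \<open>G = \<mu>\<^sup>1\<^sup>/\<^sup>2 |\<phi>'|\<close>. Only the values are multiplied: the change of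
variable \<open>x \<mapsto> \<mu> x\<close> in the dilation of \<open>\<phi>\<close> appears as the weights \<open>\<mu>\<close> and \<open>1 / \<mu>\<close> in the energy density below.\<close>

locale path_energy = nls p \<omega> + h1_path v G for p \<omega> :: real and v G :: "real \<Rightarrow> real" +
  fixes \<mu> :: real
  assumes \<mu>_pos: "\<mu> > 0" and v_le_peak: "\<And>x. v x \<le> peak"
begin

definition energy_density :: "real \<Rightarrow> real" where
  "energy_density t = 1/4 * (\<mu> * (G t)\<^sup>2 + W (v t) / \<mu>)"

lemma density_split: "energy_density t = 1/2 * (speed (v t) * G t) + 1/4 * (sqrt \<mu> * G t - speed (v t) / sqrt \<mu>)\<^sup>2"
proof -
  have s: "sqrt \<mu> > 0" "\<mu> = (sqrt \<mu>)\<^sup>2" using \<mu>_pos by auto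
  have "energy_density t = 1/4 * (\<mu> * (G t)\<^sup>2 + (speed (v t))\<^sup>2 / \<mu>)"
    using speed_sq[OF u_nonneg v_le_peak] by (simp add: energy_density_def)
  also have "\<dots> = 1/4 * ((sqrt \<mu>)\<^sup>2 * (G t)\<^sup>2 + (speed (v t))\<^sup>2 / (sqrt \<mu>)\<^sup>2)"
    using s(2) by simp
  also have "\<dots> = 1/2 * (speed (v t) * G t) + 1/4 * (sqrt \<mu> * G t - speed (v t) / sqrt \<mu>)\<^sup>2"
    using s(1) by (simp add: power2_diff power_mult_distrib power_divide field_simps power2_eq_square)
  finally show ?thesis .
qed

lemma density_nonneg: "energy_density t \<ge> 0"
  unfolding density_split using speed_nonneg G_nonneg by simp

lemma density_integrable: "integrable lborel energy_density"
proof -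
  have "integrable lborel (\<lambda>t. W (v t))"
    unfolding W_def using u_sq u_powr_integrable[of "p + 1"] p_gt_5 u_nonneg by simp
  then show ?thesis
    unfolding energy_density_def using G_sq by auto
qed

lemma density_set_integrable: "set_integrable lborel {a..b} energy_density"
  unfolding set_integrable_def using integrable_mult_indicator[OF _ density_integrable] by simp

lemma density_integrable_on: "energy_density integrable_on {a..b}"
  by (intro set_integrable_integrable_on density_set_integrable)

lemma speed_G_set_integrable: "set_integrable lborel {a..b} (\<lambda>t. speed (v t) * G t)"
  by (intro set_integrable_mult_continuous G_set_integrable
      continuous_on_compose2[OF continuous_speed[of UNIV] continuous_on_subset[OF u_cont]]) auto

lemma cost_le_speed_G:
  "a \<le> b \<Longrightarrow> \<bar>cost (v b) - cost (v a)\<bar> \<le> integral {a..b} (\<lambda>t. speed (v t) * G t)"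
  by (rule arclength) (auto simp: cost_deriv continuous_speed speed_nonneg)

lemma speed_G_le_e:
  assumes "a \<le> b" shows "1/2 * integral {a..b} (\<lambda>t. speed (v t) * G t) \<le> integral {a..b} energy_density"
proof -
  have "integral {a..b} (\<lambda>t. 1/2 * (speed (v t) * G t)) \<le> integral {a..b} energy_density"
    by (rule integral_le)
       (auto simp: density_split intro!: density_integrable_on integrable_on_cmult_left
             set_integrable_integrable_on speed_G_set_integrable)
  then show ?thesis by simp
qed

lemma energy_Icc:
  assumes "a \<le> b" shows "1/2 * \<bar>cost (v b) - cost (v a)\<bar> \<le> integral {a..b} energy_density"
  using mult_left_mono[OF cost_le_speed_G[OF assms], of "1/2"] speed_G_le_e[OF assms] by simp

text \<open>If equality held, the square in \<open>density_split\<close> would vanish almost everywhere on \<open>[a, b]\<close>, so that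
\<open>G \<le> C v\<close> there. The arclength bound for \<open>F s = ln (s + \<epsilon>)\<close> then limits the growth of \<open>ln (v + \<epsilon>)\<close>
by \<open>C (b - a)\<close> uniformly in \<open>\<epsilon>\<close>, which is impossible for small \<open>\<epsilon>\<close> when \<open>v\<close> vanishes at one end only.\<close>

lemma energy_Icc_strict:
  assumes "a \<le> b" and z: "v a = 0 \<and> v b > 0 \<or> v a > 0 \<and> v b = 0"
  shows "1/2 * \<bar>cost (v b) - cost (v a)\<bar> < integral {a..b} energy_density"
proof (rule ccontr)
  assume "\<not> ?thesis"
  then have le: "integral {a..b} energy_density \<le> 1/2 * integral {a..b} (\<lambda>t. speed (v t) * G t)"
    using mult_left_mono[OF cost_le_speed_G[OF assms(1)], of "1/2"] unfolding not_less by simp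
  define d where "d t = energy_density t - 1/2 * (speed (v t) * G t)" for t
  have d0: "d t \<ge> 0" for t unfolding d_def density_split by simp
  have dsi: "set_integrable lborel {a..b} d"
    unfolding d_def
    by (intro set_integral_diff density_set_integrable set_integrable_mult_right speed_G_set_integrable)
  have "(LINT t:{a..b}|lborel. d t) = integral {a..b} d"
    by (rule set_borel_integral_eq_integral[OF dsi])
  also have "\<dots> = integral {a..b} energy_density - 1/2 * integral {a..b} (\<lambda>t. speed (v t) * G t)"
    unfolding d_def
    by (subst Henstock_Kurzweil_Integration.integral_diff)
       (auto intro!: density_integrable_on integrable_on_cmult_left set_integrable_integrable_on speed_G_set_integrable)
  finally have "(LINT t:{a..b}|lborel. d t) \<le> 0" using le by simp
  moreover have "(LINT t:{a..b}|lborel. d t) \<ge> 0"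
    unfolding set_lebesgue_integral_def by (intro Bochner_Integration.integral_nonneg) (simp add: d0)
  ultimately have "(LINT t|lborel. indicator {a..b} t *\<^sub>R d t) = 0"
    by (simp add: set_lebesgue_integral_def)
  then have ae: "AE t in lborel. indicator {a..b} t *\<^sub>R d t = 0"
    using integral_nonneg_eq_0_iff_AE[of lborel "\<lambda>t. indicator {a..b} t *\<^sub>R d t"] dsi d0
    unfolding set_integrable_def by simp
  define C where "C = sqrt (2 * \<omega>) / \<mu>"
  have C: "C > 0" using \<omega>_pos \<mu>_pos by (simp add: C_def)
  have ae': "AE t in lborel. t \<in> {a..b} \<longrightarrow> G t \<le> C * v t"
    using ae
  proof eventually_elim
    case (elim t)
    show ?case
    proof
      assume "t \<in> {a..b}"
      then have "sqrt \<mu> * G t - speed (v t) / sqrt \<mu> = 0" using elim by (simp add: d_def density_split)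
      then have "sqrt \<mu> * sqrt \<mu> * G t = speed (v t)" using \<mu>_pos by (simp add: field_simps)
      then have "\<mu> * G t \<le> sqrt (2 * \<omega>) * v t" using \<mu>_pos speed_le[OF u_nonneg[of t]] by simp
      then show "G t \<le> C * v t" using \<mu>_pos by (simp add: C_def field_simps)
    qed
  qed
  have Csi: "set_integrable lborel {x..y} (\<lambda>t. C * v t)" for x y
    by (intro borel_integrable_atLeastAtMost' continuous_intros continuous_on_subset[OF u_cont]) auto
  have lip': "\<bar>v y - v x\<bar> \<le> integral {x..y} (\<lambda>t. C * v t)" if "a \<le> x" "x \<le> y" "y \<le> b" for x y
  proof -
    have "\<bar>v y - v x\<bar> \<le> integral {x..y} G" by (rule lip) fact
    also have "\<dots> = (LINT t:{x..y}|lborel. G t)"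
      using set_borel_integral_eq_integral(2)[OF G_set_integrable] by simp
    also have "\<dots> \<le> (LINT t:{x..y}|lborel. C * v t)"
      unfolding set_lebesgue_integral_def
      by (rule integral_mono_AE)
         (use G_set_integrable Csi ae' that in \<open>auto simp: set_integrable_def indicator_def elim!: eventually_mono\<close>)
    also have "\<dots> = integral {x..y} (\<lambda>t. C * v t)"
      by (rule set_borel_integral_eq_integral[OF Csi])
    finally show ?thesis .
  qed
  define m where "m = max (v a) (v b)"
  have m: "m > 0" using z by (auto simp: m_def)
  \<comment> \<open>Small enough that climbing from \<open>\<epsilon>\<close> to \<open>m + \<epsilon>\<close> needs more than the growth factor \<open>exp (C (b - a))\<close>.\<close>
  define \<epsilon> where "\<epsilon> = m * exp (- (C * (b - a)))"
  have \<epsilon>: "\<epsilon> > 0" using m by (simp add: \<epsilon>_def)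
  have "\<bar>ln (v b + \<epsilon>) - ln (v a + \<epsilon>)\<bar> \<le> integral {a..b} (\<lambda>t. 1 / (v t + \<epsilon>) * (C * v t))"
    by (rule arclength_bound[OF assms(1) continuous_on_subset[OF u_cont] u_nonneg Csi _ lip',
          where F="\<lambda>s. ln (s + \<epsilon>)" and w="\<lambda>s. 1 / (s + \<epsilon>)"])
       (use \<epsilon> C u_nonneg in \<open>auto intro!: derivative_eq_intros continuous_intros simp: add_nonneg_eq_0_iff\<close>)
  also have "\<dots> \<le> integral {a..b} (\<lambda>t. C)"
  proof (rule integral_le)
    show "(\<lambda>t. 1 / (v t + \<epsilon>) * (C * v t)) integrable_on {a..b}"
      by (intro integrable_continuous_real continuous_intros continuous_on_subset[OF u_cont])
         (use \<epsilon> u_nonneg in \<open>auto simp: add_nonneg_eq_0_iff\<close>)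
    show "1 / (v t + \<epsilon>) * (C * v t) \<le> C" for t
    proof -
      have "v t + \<epsilon> > 0" using u_nonneg[of t] \<epsilon> by linarith
      then show ?thesis using C \<epsilon> by (simp add: field_simps)
    qed
  qed auto
  also have "\<dots> = C * (b - a)" using assms(1) by simp
  finally have "\<bar>ln (v b + \<epsilon>) - ln (v a + \<epsilon>)\<bar> \<le> C * (b - a)" .
  moreover have "\<bar>ln (v b + \<epsilon>) - ln (v a + \<epsilon>)\<bar> = ln (m + \<epsilon>) - ln \<epsilon>"
    using z \<epsilon> by (auto simp: m_def)
  moreover have "ln \<epsilon> = ln m - C * (b - a)"
    unfolding \<epsilon>_def using m by (simp add: ln_mult)
  moreover have "ln (m + \<epsilon>) > ln m" using m \<epsilon> by simp
  ultimately show False by linarith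
qed

text \<open>Both tails are paths from or to the value \<open>0\<close> at infinity.\<close>

lemma energy_lower:
  assumes "a \<le> b"
  shows "1/2 * cost (v a) + integral {a..b} energy_density + 1/2 * cost (v b) \<le> (LINT t|lborel. energy_density t)"
proof (rule tendsto_upperbound)
  let ?f = "\<lambda>R. 1/2 * (cost (v a) - cost (v (- R))) + integral {a..b} energy_density + 1/2 * (cost (v b) - cost (v R))"
  have 1: "((\<lambda>R. cost (v R)) \<longlongrightarrow> 0) at_top"
    by (rule cost_tendsto_0[OF u_vanishes(1)])
  have 2: "((\<lambda>R. cost (v (- R))) \<longlongrightarrow> 0) at_top"
    by (rule cost_tendsto_0[OF filterlim_compose[OF u_vanishes(2) filterlim_uminus_at_bot_at_top]])
  have "(?f \<longlongrightarrow> 1/2 * (cost (v a) - 0) + integral {a..b} energy_density + 1/2 * (cost (v b) - 0)) at_top"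
    by (intro tendsto_intros 1 2)
  then show "(?f \<longlongrightarrow> 1/2 * cost (v a) + integral {a..b} energy_density + 1/2 * cost (v b)) at_top" by simp
  show "\<forall>\<^sub>F R in at_top. ?f R \<le> (LINT t|lborel. energy_density t)"
    using eventually_ge_at_top[of "\<bar>a\<bar> + \<bar>b\<bar>"]
  proof eventually_elim
    case (elim R)
    have R: "- R \<le> a" "b \<le> R" using elim by auto
    have "1/2 * \<bar>cost (v a) - cost (v (-R))\<bar> \<le> integral {-R..a} energy_density"
      "1/2 * \<bar>cost (v R) - cost (v b)\<bar> \<le> integral {b..R} energy_density"
      using energy_Icc R by blast+
    moreover have "integral {-R..a} energy_density + integral {a..b} energy_density = integral {-R..b} energy_density"
      "integral {-R..b} energy_density + integral {b..R} energy_density = integral {-R..R} energy_density"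
      by (rule Henstock_Kurzweil_Integration.integral_combine; use R assms density_integrable_on in auto)+
    moreover have "integral {-R..R} energy_density \<le> (LINT t|lborel. energy_density t)"
    proof -
      have "integral {-R..R} energy_density = (LINT t:{-R..R}|lborel. energy_density t)"
        using set_borel_integral_eq_integral(2)[OF density_set_integrable] by simp
      also have "\<dots> \<le> (LINT t|lborel. energy_density t)"
        unfolding set_lebesgue_integral_def
        by (rule integral_mono)
           (use density_set_integrable density_integrable density_nonneg in \<open>auto simp: set_integrable_def indicator_def\<close>)
      finally show ?thesis .
    qed
    ultimately show ?case by argo
  qed
qed simp

lemma energy_ge_cost: "cost (v x0) \<le> (LINT t|lborel. energy_density t)"
  using energy_lower[of x0 x0] by simp

text \<open>Going from the zero at the origin to \<open>x0\<close> takes strictly more than half of \<open>cost (v x0)\<close>, and the tail beyond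
\<open>x0\<close> takes the other half.\<close>

lemma energy_gt_cost:
  assumes "v 0 = 0" "v x0 > 0" shows "cost (v x0) < (LINT t|lborel. energy_density t)"
proof (cases "x0 \<ge> 0")
  case True
  then show ?thesis
    using energy_lower[of 0 x0] energy_Icc_strict[of 0 x0] assms cost_nonneg[OF u_nonneg[of x0]] by (simp add: cost_0)
next
  case False
  then show ?thesis
    using energy_lower[of x0 0] energy_Icc_strict[of x0 0] assms cost_nonneg[OF u_nonneg[of x0]] by (simp add: cost_0)
qed

text \<open>An even path reaches the height \<open>v x0\<close> at both \<open>x0\<close> and \<open>- x0\<close>, and passes the value \<open>v 0\<close> in between.\<close>

lemma even_energy:
  assumes even: "\<And>x. v (- x) = v x" and le: "v 0 \<le> v x0"
  shows "2 * cost (v x0) - cost (v 0) \<le> (LINT t|lborel. energy_density t)"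
    and "v 0 = 0 \<Longrightarrow> v x0 > 0 \<Longrightarrow> 2 * cost (v x0) - cost (v 0) < (LINT t|lborel. energy_density t)"
proof -
  define y where "y = \<bar>x0\<bar>"
  have y: "y \<ge> 0" "v y = v x0" "v (- y) = v x0" using even[of x0] even[of y] by (auto simp: y_def abs_if)
  have c: "cost (v x0) \<ge> cost (v 0)" using le u_nonneg by (intro cost_mono)
  have E: "1/2 * cost (v x0) + (integral {-y..0} energy_density + integral {0..y} energy_density) + 1/2 * cost (v x0) \<le> (LINT t|lborel. energy_density t)"
    using energy_lower[of "-y" y] y
    by (subst Henstock_Kurzweil_Integration.integral_combine) (auto intro: density_integrable_on)
  show "2 * cost (v x0) - cost (v 0) \<le> (LINT t|lborel. energy_density t)"
    using E energy_Icc[of "-y" 0] energy_Icc[of 0 y] y c by simp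
  show "2 * cost (v x0) - cost (v 0) < (LINT t|lborel. energy_density t)" if "v 0 = 0" "v x0 > 0"
    using E energy_Icc_strict[of "-y" 0] energy_Icc_strict[of 0 y] y c that by simp
qed

end

section \<open>Dilation orbits and lower bounds for the action\<close>

lemma powr_ge_tangent:
  fixes x r :: real
  assumes "x > 0" "r \<ge> 1"
  shows "x powr r \<ge> 1 + r * (x - 1)"
proof -
  have "x powr r - 1 powr r \<ge> (r * 1 powr (r - 1)) * (x - 1)"
    by (rule convex_on_imp_above_tangent[OF powr_convex[OF assms(2)]])
       (use assms in \<open>auto intro!: derivative_eq_intros connected_Ioi simp: interior_open\<close>)
  then show ?thesis by simp
qed

lemma H1_weak_deriv:
  assumes "\<phi> \<in> H1" shows "is_weak_deriv \<phi> (weak_deriv \<phi>)"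
proof -
  from assms obtain g where "is_weak_deriv \<phi> g" by (auto simp: H1_def)
  then show ?thesis
    using someI[of "is_weak_deriv \<phi>" g] by (simp add: weak_deriv_def)
qed

lemma H1_FTC:
  assumes "\<phi> \<in> H1" "x \<le> y"
  shows "\<phi> y - \<phi> x = (LINT t:{x..y}|lborel. weak_deriv \<phi> t)"
  by (rule weak_derivative_FTC)
     (use assms H1_weak_deriv[OF assms(1)] Lp_2_locally_integrable in \<open>auto simp: H1_def is_weak_deriv_def\<close>)

lemma h1_path_norm:
  assumes \<phi>: "\<phi> \<in> H1" and c: "c \<ge> 0"
  shows "h1_path (\<lambda>x. c * norm (\<phi> x)) (\<lambda>x. c * norm (weak_deriv \<phi> x))"
proof
  have g: "weak_deriv \<phi> \<in> Lp 2" using H1_weak_deriv[OF \<phi>] by (simp add: is_weak_deriv_def)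
  have cont: "continuous_on UNIV \<phi>" and L2: "\<phi> \<in> Lp 2" using \<phi> by (auto simp: H1_def)
  show "continuous_on UNIV (\<lambda>x. c * norm (\<phi> x))" by (intro continuous_intros cont)
  show "(\<lambda>x. c * norm (weak_deriv \<phi> x)) \<in> borel_measurable borel"
    using g unfolding Lp_2_iff by (auto intro!: borel_measurable_times borel_measurable_norm)
  show "integrable lborel (\<lambda>x. (c * norm (\<phi> x))\<^sup>2)" "integrable lborel (\<lambda>x. (c * norm (weak_deriv \<phi> x))\<^sup>2)"
    using L2 g by (simp_all add: Lp_2_iff power_mult_distrib)
  show "0 \<le> c * norm (\<phi> x)" "0 \<le> c * norm (weak_deriv \<phi> x)" for x using c by auto
  fix x y :: real assume "x \<le> y"
  have i: "set_integrable lborel {x..y} (weak_deriv \<phi>)"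
    using Lp_2_locally_integrable[OF g] by (simp add: locally_integrable_def)
  then have ni: "set_integrable lborel {x..y} (\<lambda>t. norm (weak_deriv \<phi> t))" by (rule set_integrable_norm)
  have "\<bar>norm (\<phi> y) - norm (\<phi> x)\<bar> \<le> norm (\<phi> y - \<phi> x)" by (rule norm_triangle_ineq3)
  also have "\<dots> = norm (LINT t|lborel. indicator {x..y} t *\<^sub>R weak_deriv \<phi> t)"
    using H1_FTC[OF \<phi> \<open>x \<le> y\<close>] by (simp add: set_lebesgue_integral_def)
  also have "\<dots> \<le> (LINT t|lborel. norm (indicator {x..y} t *\<^sub>R weak_deriv \<phi> t))"
    by (rule integral_norm_bound)
  also have "\<dots> = (LINT t:{x..y}|lborel. norm (weak_deriv \<phi> t))"
    by (simp add: set_lebesgue_integral_def)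
  also have "\<dots> = integral {x..y} (\<lambda>t. norm (weak_deriv \<phi> t))"
    by (rule set_borel_integral_eq_integral[OF ni])
  finally have "c * \<bar>norm (\<phi> y) - norm (\<phi> x)\<bar> \<le> c * integral {x..y} (\<lambda>t. norm (weak_deriv \<phi> t))"
    using c by (rule mult_left_mono)
  then show "\<bar>c * norm (\<phi> y) - c * norm (\<phi> x)\<bar> \<le> integral {x..y} (\<lambda>t. c * norm (weak_deriv \<phi> t))"
    using c by (simp add: abs_mult right_diff_distrib[symmetric])
qed

definition kinetic :: "(real \<Rightarrow> complex) \<Rightarrow> real" where
  "kinetic \<phi> = (LINT x|lborel. (norm (weak_deriv \<phi> x))\<^sup>2)"

definition mass :: "(real \<Rightarrow> complex) \<Rightarrow> real" where
  "mass \<phi> = (LINT x|lborel. (norm (\<phi> x))\<^sup>2)"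

definition power_integral :: "real \<Rightarrow> (real \<Rightarrow> complex) \<Rightarrow> real" where
  "power_integral q \<phi> = (LINT x|lborel. norm (\<phi> x) powr q)"

lemma Lp_norm_powr: assumes "q > 0" shows "Lp_norm q f powr q = (LINT x|lborel. norm (f x) powr q)"
proof -
  have "(LINT x|lborel. norm (f x) powr q) \<ge> 0" by simp
  then show ?thesis using assms by (simp add: Lp_norm_def powr_powr)
qed

context nls
begin

text \<open>The action of \<open>\<mu>\<^sup>1\<^sup>/\<^sup>2 \<phi> (\<mu> x)\<close>, written through the integrals of \<open>\<phi>\<close>. As a formula it makes sense
for every \<open>\<phi>\<close>, so the lower bounds do not need \<open>H1\<close> to be closed under dilations.\<close>

definition orbit_action :: "real \<Rightarrow> real \<Rightarrow> (real \<Rightarrow> complex) \<Rightarrow> real" where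
  "orbit_action \<gamma> \<mu> \<phi> = \<mu>\<^sup>2 / 4 * kinetic \<phi> - \<gamma> / 2 * \<mu> * (norm (\<phi> 0))\<^sup>2 + \<omega> / 2 * mass \<phi>
     - \<mu> powr ((p - 1) / 2) / (p + 1) * power_integral (p + 1) \<phi>"

lemma action_eq: "action p \<omega> \<gamma> \<phi> = orbit_action \<gamma> 1 \<phi>"
  unfolding action_def orbit_action_def Lp_norm_2_power2 using p_gt_5
  by (subst Lp_norm_powr) (auto simp: kinetic_def mass_def power_integral_def)

lemma virial_eq: "virial p \<gamma> \<phi> = 1/2 * kinetic \<phi> - \<gamma>/2 * (norm (\<phi> 0))\<^sup>2 - (p-1)/(2*(p+1)) * power_integral (p + 1) \<phi>"
  unfolding virial_def Lp_norm_2_power2 using p_gt_5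
  by (subst Lp_norm_powr) (auto simp: kinetic_def mass_def power_integral_def)

text \<open>Bernoulli's inequality for \<open>\<mu>\<^sup>2\<close> with the exponent \<open>(p - 1) / 4\<close>, which exceeds \<open>1\<close> because \<open>p > 5\<close>.\<close>

lemma powr_scale_ge:
  assumes "\<mu> > 0" shows "\<mu> powr ((p - 1) / 2) \<ge> 1 + (p - 1) / 4 * (\<mu>\<^sup>2 - 1)"
proof -
  have "(\<mu>\<^sup>2) powr ((p - 1) / 4) = (\<mu> powr 2) powr ((p - 1) / 4)" using assms by simp
  also have "\<dots> = \<mu> powr ((p - 1) / 2)" by (simp add: powr_powr diff_divide_distrib)
  finally show ?thesis using powr_ge_tangent[of "\<mu>\<^sup>2" "(p - 1) / 4"] assms p_gt_5 by simp
qed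

text \<open>After \<open>K\<close> is eliminated by the virial identity, the difference of the two sides is the Bernoulli
defect of \<open>powr_scale_ge\<close> times a multiple of \<open>N\<close>, plus \<open>- \<gamma> D (\<mu> - 1)\<^sup>2 / 4\<close>.\<close>

lemma orbit_action_le_action:
  assumes "virial p \<gamma> \<phi> = 0" "\<gamma> \<le> 0" "\<mu> > 0"
  shows "orbit_action \<gamma> \<mu> \<phi> \<le> action p \<omega> \<gamma> \<phi>"
proof -
  define N where "N = power_integral (p + 1) \<phi>"
  define D where "D = (norm (\<phi> 0))\<^sup>2"
  have N: "N \<ge> 0" unfolding N_def power_integral_def by simp
  have D: "D \<ge> 0" unfolding D_def by simp
  have K: "kinetic \<phi> = \<gamma> * D + (p-1)/(p+1) * N"
  proof -
    define X Y where "X = (p-1)/(p+1) * N" and "Y = \<gamma> * D"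
    have XY: "(p-1)/(2*(p+1)) * N = X / 2" "\<gamma> / 2 * D = Y / 2" by (simp_all add: X_def Y_def)
    have "1/2 * kinetic \<phi> - Y / 2 - X / 2 = 0"
      using assms(1) unfolding virial_eq N_def[symmetric] D_def[symmetric] XY .
    then show ?thesis unfolding X_def[symmetric] Y_def[symmetric] by simp
  qed
  note B = powr_scale_ge[OF assms(3)]
  have "action p \<omega> \<gamma> \<phi> - orbit_action \<gamma> \<mu> \<phi>
    = N / (p + 1) * (\<mu> powr ((p - 1) / 2) - (1 + (p - 1) / 4 * (\<mu>\<^sup>2 - 1))) - \<gamma> * D / 4 * (\<mu> - 1)\<^sup>2"
  proof -
    define n where "n = N / (p + 1)"
    have n: "N / (p + 1) = n" "c / (p + 1) * N = c * n" for c by (auto simp: n_def)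
    show ?thesis
      unfolding action_eq orbit_action_def N_def[symmetric] D_def[symmetric] K n
      by (simp add: algebra_simps power2_eq_square add_divide_distrib diff_divide_distrib)
  qed
  moreover have "N / (p + 1) * (\<mu> powr ((p - 1) / 2) - (1 + (p - 1) / 4 * (\<mu>\<^sup>2 - 1))) \<ge> 0"
    using B N p_gt_5 by (intro mult_nonneg_nonneg) auto
  moreover have "\<gamma> * D / 4 * (\<mu> - 1)\<^sup>2 \<le> 0"
    using assms(2) D by (intro mult_nonpos_nonneg) (auto intro: mult_nonpos_nonneg)
  ultimately show ?thesis by linarith
qed

lemma sqrt_powr_scale:
  assumes "\<mu> > 0" shows "sqrt \<mu> powr (p + 1) = \<mu> powr ((p - 1) / 2) * \<mu>"
proof -
  have "sqrt \<mu> powr (p + 1) = \<mu> powr ((p + 1) / 2)"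
    using assms by (simp add: powr_powr flip: powr_half_sqrt)
  also have "\<dots> = \<mu> powr ((p - 1) / 2 + 1)" by (simp add: field_simps)
  also have "\<dots> = \<mu> powr ((p - 1) / 2) * \<mu>" using assms by (simp only: powr_add powr_one)
  finally show ?thesis .
qed

abbreviation scaled_norm :: "real \<Rightarrow> (real \<Rightarrow> complex) \<Rightarrow> real \<Rightarrow> real" where
  "scaled_norm \<mu> \<phi> \<equiv> \<lambda>x. sqrt \<mu> * norm (\<phi> x)"

text \<open>The dilation that brings the maximum of \<open>|\<phi>|\<close> to the height \<open>peak\<close>. It exists because a nonzero element
of \<open>H1\<close> attains its maximum.\<close>

lemma optimal_scale:
  assumes \<phi>: "\<phi> \<in> H1" and nz: "\<phi> \<noteq> (\<lambda>x. 0)"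
  obtains \<mu> x0 where
    "path_energy p \<omega> (scaled_norm \<mu> \<phi>) (scaled_norm \<mu> (weak_deriv \<phi>)) \<mu>"
    "sqrt \<mu> * norm (\<phi> x0) = peak" "\<mu> > 0"
    "(LINT t|lborel. path_energy.energy_density p \<omega> (scaled_norm \<mu> \<phi>) (scaled_norm \<mu> (weak_deriv \<phi>)) \<mu> t)
      = orbit_action 0 \<mu> \<phi>"
proof -
  interpret P: h1_path "\<lambda>x. norm (\<phi> x)" "\<lambda>x. norm (weak_deriv \<phi> x)"
    using h1_path_norm[OF \<phi>, of 1] by simp
  obtain x1 where "\<phi> x1 \<noteq> 0" using nz by blast
  then obtain x0 where x0: "norm (\<phi> x0) > 0" "\<And>x. norm (\<phi> x) \<le> norm (\<phi> x0)"
    using P.attains_max[of x1] by auto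
  define \<mu> where "\<mu> = (peak / norm (\<phi> x0))\<^sup>2"
  have \<mu>: "\<mu> > 0" "sqrt \<mu> = peak / norm (\<phi> x0)" using peak_pos x0 by (auto simp: \<mu>_def)
  have pk: "sqrt \<mu> * norm (\<phi> x0) = peak" using \<mu> x0 by simp
  interpret Q: path_energy p \<omega> "scaled_norm \<mu> \<phi>" "scaled_norm \<mu> (weak_deriv \<phi>)" \<mu>
  proof (intro path_energy.intro path_energy_axioms.intro h1_path_norm \<phi> nls_axioms)
    show "sqrt \<mu> * norm (\<phi> x) \<le> peak" for x
      unfolding pk[symmetric] using x0 \<mu>(1) by (intro mult_left_mono) auto
  qed (use \<mu>(1) in auto)
  have pw: "\<bar>sqrt \<mu> * norm (\<phi> t)\<bar> powr (p + 1) = \<mu> powr ((p - 1) / 2) * \<mu> * norm (\<phi> t) powr (p + 1)" for t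
    using \<mu>(1) sqrt_powr_scale[OF \<mu>(1)] by (simp add: powr_mult)
  have e: "Q.energy_density t = \<mu>\<^sup>2 / 4 * (norm (weak_deriv \<phi> t))\<^sup>2 + \<omega> / 2 * (norm (\<phi> t))\<^sup>2
      - \<mu> powr ((p - 1) / 2) / (p + 1) * norm (\<phi> t) powr (p + 1)" for t
  proof -
    have 2: "(sqrt \<mu> * c)\<^sup>2 = \<mu> * c\<^sup>2" for c using \<mu>(1) by (simp add: power_mult_distrib)
    define A g f where "A = \<mu> powr ((p - 1) / 2) / (p + 1) * norm (\<phi> t) powr (p + 1)"
      and "g = (norm (weak_deriv \<phi> t))\<^sup>2" and "f = (norm (\<phi> t))\<^sup>2"
    have A: "4 / (p + 1) * (\<mu> powr ((p - 1) / 2) * \<mu> * norm (\<phi> t) powr (p + 1)) = 4 * \<mu> * A"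
      by (simp add: A_def)
    show ?thesis
      unfolding Q.energy_density_def W_def pw 2 A A_def[symmetric] g_def[symmetric] f_def[symmetric] using \<mu>(1)
      by (simp add: field_simps power2_eq_square)
  qed
  have "(LINT t|lborel. Q.energy_density t) = orbit_action 0 \<mu> \<phi>"
    unfolding e orbit_action_def kinetic_def mass_def power_integral_def
    using P.u_sq P.G_sq P.u_powr_integrable[of "p + 1"] p_gt_5 by simp
  then show thesis using that[OF Q.path_energy_axioms pk \<mu>(1)] by blast
qed

lemma orbit_action_delta: "orbit_action \<gamma> \<mu> \<phi> = orbit_action 0 \<mu> \<phi> - \<gamma> / 2 * \<mu> * (norm (\<phi> 0))\<^sup>2"
  by (simp add: orbit_action_def)

lemma action_ge_cost:
  assumes "\<phi> \<in> admissible H1 p \<gamma>" "\<gamma> \<le> 0"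
  shows "cost peak \<le> action p \<omega> \<gamma> \<phi>" and "\<gamma> < 0 \<Longrightarrow> cost peak < action p \<omega> \<gamma> \<phi>"
proof -
  have \<phi>: "\<phi> \<in> H1" "\<phi> \<noteq> (\<lambda>x. 0)" "virial p \<gamma> \<phi> = 0" using assms by (auto simp: admissible_def)
  obtain \<mu> x0 where E: "path_energy p \<omega> (scaled_norm \<mu> \<phi>) (scaled_norm \<mu> (weak_deriv \<phi>)) \<mu>"
    and pk: "sqrt \<mu> * norm (\<phi> x0) = peak" and \<mu>: "\<mu> > 0"
    and eq: "(LINT t|lborel. path_energy.energy_density p \<omega> (scaled_norm \<mu> \<phi>) (scaled_norm \<mu> (weak_deriv \<phi>)) \<mu> t)
      = orbit_action 0 \<mu> \<phi>"
    using optimal_scale[OF \<phi>(1,2)] .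
  interpret path_energy p \<omega> "scaled_norm \<mu> \<phi>" "scaled_norm \<mu> (weak_deriv \<phi>)" \<mu> by fact
  have le: "orbit_action 0 \<mu> \<phi> - \<gamma> / 2 * \<mu> * (norm (\<phi> 0))\<^sup>2 \<le> action p \<omega> \<gamma> \<phi>"
    using orbit_action_le_action[OF \<phi>(3) assms(2) \<mu>] orbit_action_delta[of \<gamma> \<mu> \<phi>] by simp
  have c: "cost peak \<le> orbit_action 0 \<mu> \<phi>" using energy_ge_cost[of x0] pk eq by simp
  have n: "\<gamma> / 2 * \<mu> * (norm (\<phi> 0))\<^sup>2 \<le> 0"
    using assms(2) \<mu> by (intro mult_nonpos_nonneg) (auto intro: mult_nonpos_nonneg)
  show "cost peak \<le> action p \<omega> \<gamma> \<phi>" using le c n by linarith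
  show "cost peak < action p \<omega> \<gamma> \<phi>" if "\<gamma> < 0"
  proof (cases "\<phi> 0 = 0")
    case True
    then have "cost peak < orbit_action 0 \<mu> \<phi>"
      using energy_gt_cost[of x0] pk eq peak_pos by simp
    then show ?thesis using le n by linarith
  next
    case False
    then have "\<gamma> / 2 * \<mu> * (norm (\<phi> 0))\<^sup>2 < 0"
      using that \<mu> by (intro mult_neg_pos) (auto intro: mult_neg_pos)
    then show ?thesis using le c by linarith
  qed
qed

text \<open>A lower bound for the action of the radial functions on the constraint whose optimal rescaling has the value \<open>a\<close> at the origin.\<close>

definition barrier :: "real \<Rightarrow> real \<Rightarrow> real" where
  "barrier \<gamma> a = 2 * cost peak - cost a - \<gamma> / 2 * a\<^sup>2"

lemma radial_action_ge_barrier: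
  assumes "\<phi> \<in> admissible H1_rad p \<gamma>" "\<gamma> \<le> 0"
  shows "\<exists>a. 0 \<le> a \<and> a \<le> peak \<and> barrier \<gamma> a \<le> action p \<omega> \<gamma> \<phi> \<and> (a = 0 \<longrightarrow> barrier \<gamma> a < action p \<omega> \<gamma> \<phi>)"
proof -
  have \<phi>: "\<phi> \<in> H1" "\<phi> \<noteq> (\<lambda>x. 0)" "virial p \<gamma> \<phi> = 0" and even: "\<And>x. \<phi> (- x) = \<phi> x"
    using assms by (auto simp: admissible_def H1_rad_def)
  obtain \<mu> x0 where E: "path_energy p \<omega> (scaled_norm \<mu> \<phi>) (scaled_norm \<mu> (weak_deriv \<phi>)) \<mu>"
    and pk: "sqrt \<mu> * norm (\<phi> x0) = peak" and \<mu>: "\<mu> > 0"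
    and eq: "(LINT t|lborel. path_energy.energy_density p \<omega> (scaled_norm \<mu> \<phi>) (scaled_norm \<mu> (weak_deriv \<phi>)) \<mu> t)
      = orbit_action 0 \<mu> \<phi>"
    using optimal_scale[OF \<phi>(1,2)] .
  interpret path_energy p \<omega> "scaled_norm \<mu> \<phi>" "scaled_norm \<mu> (weak_deriv \<phi>)" \<mu> by fact
  define a where "a = sqrt \<mu> * norm (\<phi> 0)"
  have a2: "\<gamma> / 2 * \<mu> * (norm (\<phi> 0))\<^sup>2 = \<gamma> / 2 * a\<^sup>2" using \<mu> by (simp add: a_def power_mult_distrib)
  have le: "orbit_action 0 \<mu> \<phi> - \<gamma> / 2 * a\<^sup>2 \<le> action p \<omega> \<gamma> \<phi>"
    using orbit_action_le_action[OF \<phi>(3) assms(2) \<mu>] orbit_action_delta[of \<gamma> \<mu> \<phi>] unfolding a2 by simp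
  have a: "0 \<le> a" "a \<le> peak" unfolding a_def using u_nonneg[of 0] v_le_peak[of 0] by auto
  have 1: "2 * cost peak - cost a \<le> orbit_action 0 \<mu> \<phi>"
    using even_energy(1)[of x0] a even pk eq by (simp add: a_def)
  have 2: "2 * cost peak - cost a < orbit_action 0 \<mu> \<phi>" if "a = 0"
    using even_energy(2)[of x0] that a even pk eq peak_pos \<mu> by (simp add: a_def)
  show ?thesis
    by (rule exI[of _ a]) (use a le 1 2 in \<open>auto simp: barrier_def\<close>)
qed

lemma barrier_0: "barrier \<gamma> 0 = 2 * cost peak" by (simp add: barrier_def cost_0)

lemma barrier_deriv: "s \<ge> 0 \<Longrightarrow> (barrier \<gamma> has_real_derivative - speed s - \<gamma> * s) (at s)"
  unfolding barrier_def by (auto intro!: derivative_eq_intros cost_deriv)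

text \<open>The slope \<open>- speed s - \<gamma> s\<close> of the barrier is positive, since \<open>speed s < (2 \<omega>)\<^sup>1\<^sup>/\<^sup>2 s \<le> - \<gamma> s\<close>.\<close>

lemma barrier_strict_min_0:
  assumes "\<gamma> < 0" "\<omega> \<le> \<gamma>\<^sup>2 / 2" "a > 0"
  shows "barrier \<gamma> 0 < barrier \<gamma> a"
proof -
  obtain z where z: "0 < z" "z < a" "barrier \<gamma> a - barrier \<gamma> 0 = (a - 0) * (- speed z - \<gamma> * z)"
    using MVT2[OF assms(3), of "barrier \<gamma>" "\<lambda>s. - speed s - \<gamma> * s"] barrier_deriv by auto
  have "sqrt (2 * \<omega>) \<le> sqrt (\<gamma>\<^sup>2)" using assms by (intro real_sqrt_le_mono) auto
  then have "sqrt (2 * \<omega>) * z \<le> - \<gamma> * z" using assms z(1) by (intro mult_right_mono) auto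
  then have "- speed z - \<gamma> * z > 0" using speed_less[OF z(1)] by simp
  then have "(a - 0) * (- speed z - \<gamma> * z) > 0" using assms(3) by simp
  then show ?thesis using z(3) by linarith
qed

text \<open>For \<open>\<omega> > \<gamma>\<^sup>2 / 2\<close>, the positive height at which \<open>speed s = - \<gamma> s\<close>, where the barrier has its critical point; it turns out to be the
value of the profile with delta interaction at the origin.\<close>

definition delta_height :: "real \<Rightarrow> real" where
  "delta_height \<gamma> = ((p + 1) * (2 * \<omega> - \<gamma>\<^sup>2) / 4) powr (1 / (p - 1))"

lemma delta_height_bounds:
  assumes "\<omega> > \<gamma>\<^sup>2 / 2"
  shows "0 < delta_height \<gamma>" "delta_height \<gamma> \<le> peak"
    "delta_height \<gamma> powr (p - 1) = (p + 1) * (2 * \<omega> - \<gamma>\<^sup>2) / 4"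
proof -
  have pos: "(p + 1) * (2 * \<omega> - \<gamma>\<^sup>2) / 4 > 0" using assms p_gt_5 by simp
  show "0 < delta_height \<gamma>" unfolding delta_height_def using pos by (intro powr_gt_zero[THEN iffD2]) auto
  have "(p + 1) * (2 * \<omega> - \<gamma>\<^sup>2) / 4 \<le> (p + 1) * (2 * \<omega>) / 4"
    using p_gt_5 by (intro divide_right_mono mult_left_mono) auto
  then show "delta_height \<gamma> \<le> peak"
    unfolding delta_height_def peak_def using pos p_gt_5 by (intro powr_mono2) auto
  show "delta_height \<gamma> powr (p - 1) = (p + 1) * (2 * \<omega> - \<gamma>\<^sup>2) / 4"
    unfolding delta_height_def using pos p_gt_5 by (simp add: powr_powr)
qed

lemma W_minus_parabola:
  assumes "\<omega> > \<gamma>\<^sup>2 / 2" "s \<ge> 0"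
  shows "W s - \<gamma>\<^sup>2 * s\<^sup>2 = 4 / (p + 1) * s\<^sup>2 * (delta_height \<gamma> powr (p - 1) - s powr (p - 1))"
proof -
  define q where "q = 4 / (p + 1)"
  have "q * delta_height \<gamma> powr (p - 1) = 2 * \<omega> - \<gamma>\<^sup>2"
    unfolding delta_height_bounds(3)[OF assms(1)] q_def using p_gt_5 by (simp add: field_simps)
  then have 2: "2 * \<omega> = q * delta_height \<gamma> powr (p - 1) + \<gamma>\<^sup>2" by simp
  show ?thesis unfolding W_factor[OF assms(2)] q_def[symmetric] 2 by (simp add: algebra_simps)
qed

lemma speed_vs_slope:
  assumes "\<gamma> < 0" "\<omega> > \<gamma>\<^sup>2 / 2" "s > 0"
  shows "s < delta_height \<gamma> \<Longrightarrow> - \<gamma> * s < speed s" "s > delta_height \<gamma> \<Longrightarrow> speed s < - \<gamma> * s"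
    "speed (delta_height \<gamma>) = - \<gamma> * delta_height \<gamma>"
proof -
  note h = delta_height_bounds[OF assms(2)]
  have line: "- \<gamma> * t = sqrt (\<gamma>\<^sup>2 * t\<^sup>2)" if "t > 0" for t
    using assms(1) that by (simp add: real_sqrt_mult)
  have c: "4 / (p + 1) * s\<^sup>2 > 0" using assms(3) p_gt_5 by simp
  show "- \<gamma> * s < speed s" if "s < delta_height \<gamma>"
  proof -
    have "0 < delta_height \<gamma> powr (p - 1) - s powr (p - 1)"
      using powr_less_mono2[of "p - 1" s "delta_height \<gamma>"] that assms(3) p_gt_5 by simp
    from mult_pos_pos[OF c this] have "\<gamma>\<^sup>2 * s\<^sup>2 < W s"
      using W_minus_parabola[OF assms(2) less_imp_le[OF assms(3)]] by linarith
    then show ?thesis unfolding line[OF assms(3)] speed_def by (intro real_sqrt_less_mono) simp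
  qed
  show "speed s < - \<gamma> * s" if "s > delta_height \<gamma>"
  proof -
    have "delta_height \<gamma> powr (p - 1) - s powr (p - 1) < 0"
      using powr_less_mono2[of "p - 1" "delta_height \<gamma>" s] that h(1) p_gt_5 by simp
    from mult_pos_neg[OF c this] have "W s < \<gamma>\<^sup>2 * s\<^sup>2"
      using W_minus_parabola[OF assms(2) less_imp_le[OF assms(3)]] by linarith
    then show ?thesis unfolding line[OF assms(3)] speed_def using assms(1,3) by (intro real_sqrt_less_mono) simp
  qed
  show "speed (delta_height \<gamma>) = - \<gamma> * delta_height \<gamma>"
    unfolding line[OF h(1)] speed_def using W_minus_parabola[OF assms(2), of "delta_height \<gamma>"] h(1) by simp
qed

lemma barrier_min_at_delta_height:
  assumes "\<gamma> < 0" "\<omega> > \<gamma>\<^sup>2 / 2" "0 \<le> a" "a \<noteq> delta_height \<gamma>"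
  shows "barrier \<gamma> (delta_height \<gamma>) < barrier \<gamma> a"
proof (cases "a < delta_height \<gamma>")
  case True
  obtain z where z: "a < z" "z < delta_height \<gamma>"
    "barrier \<gamma> (delta_height \<gamma>) - barrier \<gamma> a = (delta_height \<gamma> - a) * (- speed z - \<gamma> * z)"
    using MVT2[OF True, of "barrier \<gamma>" "\<lambda>s. - speed s - \<gamma> * s"] barrier_deriv assms(3) by force
  have "- speed z - \<gamma> * z < 0" using speed_vs_slope(1)[OF assms(1,2), of z] z assms(3) by simp
  then have "(delta_height \<gamma> - a) * (- speed z - \<gamma> * z) < 0" using True by (intro mult_pos_neg) auto
  then show ?thesis using z(3) by linarith
next
  case False
  then have less: "delta_height \<gamma> < a" using assms by simp
  have pos: "0 < delta_height \<gamma>" by (rule delta_height_bounds[OF assms(2)])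
  then obtain z where z: "delta_height \<gamma> < z" "z < a"
    "barrier \<gamma> a - barrier \<gamma> (delta_height \<gamma>) = (a - delta_height \<gamma>) * (- speed z - \<gamma> * z)"
    using MVT2[OF less, of "barrier \<gamma>" "\<lambda>s. - speed s - \<gamma> * s"] barrier_deriv by force
  have "- speed z - \<gamma> * z > 0" using speed_vs_slope(2)[OF assms(1,2), of z] z pos by simp
  then have "(a - delta_height \<gamma>) * (- speed z - \<gamma> * z) > 0" using less by (intro mult_pos_pos) auto
  then show ?thesis using z(3) by linarith
qed

end

section \<open>Trial functions and the virial constraint\<close>

lemma test_fun_support:
  assumes "test_fun \<psi>"
  obtains R where "R > 0" "\<And>x. \<bar>x\<bar> \<ge> R \<Longrightarrow> \<psi> x = 0" "\<And>x. \<bar>x\<bar> \<ge> R \<Longrightarrow> vderiv \<psi> x = 0"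
proof -
  obtain R1 where R1: "R1 > 0" "\<And>x. \<psi> x \<noteq> 0 \<Longrightarrow> \<bar>x\<bar> \<le> R1"
    using assms unfolding test_fun_iff by blast
  obtain R2 where R2: "R2 > 0" "\<And>x. vderiv \<psi> x \<noteq> 0 \<Longrightarrow> \<bar>x\<bar> \<le> R2"
    using test_fun_vderiv[OF assms] unfolding test_fun_iff by blast
  show thesis
  proof (rule that[of "R1 + R2"])
    fix x assume "\<bar>x\<bar> \<ge> R1 + R2"
    then show "\<psi> x = 0" "vderiv \<psi> x = 0" using R1(1) R2(1) R1(2)[of x] R2(2)[of x] by linarith+
  qed (use R1 R2 in simp)
qed

lemma test_fun_deriv: "test_fun \<psi> \<Longrightarrow> (\<psi> has_vector_derivative vderiv \<psi> x) (at x)"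
  using has_vderiv smooth_differentiable test_fun_iff by blast

lemma LINT_eq_if_supported:
  fixes h :: "real \<Rightarrow> complex"
  assumes "integrable lborel h" "(h has_integral I) {a..b}" "\<And>x. x \<notin> {a..b} \<Longrightarrow> h x = 0"
  shows "(LINT x|lborel. h x) = I"
proof -
  have "(h has_integral I) UNIV"
    by (rule has_integral_on_superset[OF assms(2)]) (use assms(3) in auto)
  then show ?thesis using has_integral_integral_lborel[OF assms(1)] has_integral_unique by blast
qed

lemma piecewise_C1_weak_deriv:
  fixes f f' :: "real \<Rightarrow> real"
  assumes cont: "continuous_on UNIV f"
    and deriv: "\<And>x. x \<noteq> 0 \<Longrightarrow> (f has_real_derivative f' x) (at x)"
    and f': "f' \<in> borel_measurable borel" "integrable lborel (\<lambda>x. (f' x)\<^sup>2)"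
  shows "is_weak_deriv (\<lambda>x. complex_of_real (f x)) (\<lambda>x. complex_of_real (f' x))"
  unfolding is_weak_deriv_def
proof (intro conjI allI impI)
  show L: "(\<lambda>x. complex_of_real (f' x)) \<in> Lp 2" using f' by (simp add: Lp_2_iff)
  fix \<psi> assume \<psi>: "test_fun \<psi>"
  obtain R where R: "R > 0" "\<And>x. \<bar>x\<bar> \<ge> R \<Longrightarrow> \<psi> x = 0" "\<And>x. \<bar>x\<bar> \<ge> R \<Longrightarrow> vderiv \<psi> x = 0"
    by (rule test_fun_support[OF \<psi>]) auto
  have i1: "integrable lborel (\<lambda>x. complex_of_real (f x) * vderiv \<psi> x)"
    by (intro locally_integrable_mult_test continuous_locally_integrable test_fun_vderiv \<psi> continuous_intros cont)
  have i2: "integrable lborel (\<lambda>x. complex_of_real (f' x) * \<psi> x)"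
    by (intro locally_integrable_mult_test Lp_2_locally_integrable L \<psi>)
  have "((\<lambda>x. complex_of_real (f x) * vderiv \<psi> x + complex_of_real (f' x) * \<psi> x) has_integral
      complex_of_real (f R) * \<psi> R - complex_of_real (f (-R)) * \<psi> (-R)) {-R..R}"
  proof (rule fundamental_theorem_of_calculus_interior_strong[of "{0}"])
    show "continuous_on {-R..R} (\<lambda>x. complex_of_real (f x) * \<psi> x)"
      using \<psi> by (intro continuous_intros continuous_on_subset[OF cont] smooth_continuous) (auto simp: test_fun_iff)
  qed (use R(1) in \<open>auto intro!: has_vector_derivative_mult has_vector_derivative_of_real deriv test_fun_deriv \<psi>\<close>)
  then have "(LINT x|lborel. complex_of_real (f x) * vderiv \<psi> x + complex_of_real (f' x) * \<psi> x)
     = complex_of_real (f R) * \<psi> R - complex_of_real (f (-R)) * \<psi> (-R)"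
  proof (rule LINT_eq_if_supported[OF Bochner_Integration.integrable_add[OF i1 i2]])
    fix x assume "x \<notin> {-R..R}"
    then have "\<bar>x\<bar> \<ge> R" by auto
    then show "complex_of_real (f x) * vderiv \<psi> x + complex_of_real (f' x) * \<psi> x = 0" using R by simp
  qed
  also have "\<dots> = 0" using R by simp
  finally show "(LINT x|lborel. complex_of_real (f x) * vderiv \<psi> x) = - (LINT x|lborel. complex_of_real (f' x) * \<psi> x)"
    using Bochner_Integration.integral_add[OF i1 i2] by (simp add: eq_neg_iff_add_eq_0)
qed

text \<open>A kink is allowed at the origin only; this is where the delta interaction sits.\<close>

definition piecewise_C1 :: "(real \<Rightarrow> real) \<Rightarrow> (real \<Rightarrow> real) \<Rightarrow> bool" where
  "piecewise_C1 f f' \<longleftrightarrow> continuous_on UNIV f \<and> (\<forall>x. x \<noteq> 0 \<longrightarrow> (f has_real_derivative f' x) (at x))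
     \<and> f' \<in> borel_measurable borel \<and> integrable lborel (\<lambda>x. (f x)\<^sup>2) \<and> integrable lborel (\<lambda>x. (f' x)\<^sup>2)"

lemma piecewise_C1_H1:
  assumes "piecewise_C1 f f'"
  shows "(\<lambda>x. complex_of_real (f x)) \<in> H1"
    and "kinetic (\<lambda>x. complex_of_real (f x)) = (LINT x|lborel. (f' x)\<^sup>2)"
proof -
  have c: "continuous_on UNIV (\<lambda>x. complex_of_real (f x))"
    using assms unfolding piecewise_C1_def by (intro continuous_intros) auto
  have w: "is_weak_deriv (\<lambda>x. complex_of_real (f x)) (\<lambda>x. complex_of_real (f' x))"
    using assms unfolding piecewise_C1_def by (intro piecewise_C1_weak_deriv) auto
  have "(\<lambda>x. complex_of_real (f x)) \<in> Lp 2"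
    using assms borel_measurable_continuous_onI[OF c] by (simp add: Lp_2_iff piecewise_C1_def)
  then show "(\<lambda>x. complex_of_real (f x)) \<in> H1" using c w unfolding H1_def by blast
  show "kinetic (\<lambda>x. complex_of_real (f x)) = (LINT x|lborel. (f' x)\<^sup>2)"
    using kinetic_eq[OF c w] unfolding kinetic_def Lp_norm_2_power2 by simp
qed

abbreviation dilation :: "real \<Rightarrow> (real \<Rightarrow> real) \<Rightarrow> real \<Rightarrow> complex" where
  "dilation \<mu> f \<equiv> \<lambda>x. complex_of_real (sqrt \<mu> * f (\<mu> * x))"

lemma piecewise_C1_scale:
  assumes "piecewise_C1 f f'" "\<mu> > 0"
  shows "piecewise_C1 (\<lambda>x. sqrt \<mu> * f (\<mu> * x)) (\<lambda>x. sqrt \<mu> * (\<mu> * f' (\<mu> * x)))"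
  unfolding piecewise_C1_def
proof (intro conjI allI impI)
  have f: "continuous_on UNIV f" "\<And>x. x \<noteq> 0 \<Longrightarrow> (f has_real_derivative f' x) (at x)"
    "f' \<in> borel_measurable borel" "integrable lborel (\<lambda>x. (f x)\<^sup>2)" "integrable lborel (\<lambda>x. (f' x)\<^sup>2)"
    using assms unfolding piecewise_C1_def by auto
  show "continuous_on UNIV (\<lambda>x. sqrt \<mu> * f (\<mu> * x))"
    by (intro continuous_intros continuous_on_compose2[OF f(1)]) auto
  have [measurable]: "f' \<in> borel_measurable borel" by fact
  show "(\<lambda>x. sqrt \<mu> * (\<mu> * f' (\<mu> * x))) \<in> borel_measurable borel" by measurable
  show "integrable lborel (\<lambda>x. (sqrt \<mu> * f (\<mu> * x))\<^sup>2)"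
    using lborel_integrable_real_affine[OF f(4), of \<mu> 0] assms(2) by (simp add: power_mult_distrib)
  show "integrable lborel (\<lambda>x. (sqrt \<mu> * (\<mu> * f' (\<mu> * x)))\<^sup>2)"
    using lborel_integrable_real_affine[OF f(5), of \<mu> 0] assms(2) by (simp add: power_mult_distrib)
  fix x :: real assume "x \<noteq> 0"
  then show "((\<lambda>x. sqrt \<mu> * f (\<mu> * x)) has_real_derivative sqrt \<mu> * (\<mu> * f' (\<mu> * x))) (at x)"
    using assms(2) by (auto intro!: derivative_eq_intros DERIV_chain2[OF f(2)])
qed

context nls
begin

definition orbit_virial :: "real \<Rightarrow> real \<Rightarrow> (real \<Rightarrow> complex) \<Rightarrow> real" where
  "orbit_virial \<gamma> \<mu> \<phi> = \<mu>\<^sup>2 / 2 * kinetic \<phi> - \<gamma> / 2 * \<mu> * (norm (\<phi> 0))\<^sup>2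
     - (p - 1) / (2 * (p + 1)) * (\<mu> powr ((p - 1) / 2) * power_integral (p + 1) \<phi>)"

lemma orbit_virial_1: "orbit_virial \<gamma> 1 \<phi> = virial p \<gamma> \<phi>"
  by (simp add: orbit_virial_def virial_eq)

lemma scaled_functionals:
  assumes f: "piecewise_C1 f f'" and \<mu>: "\<mu> > 0"
  defines "\<phi> \<equiv> \<lambda>x. complex_of_real (f x)" and "\<psi> \<equiv> dilation \<mu> f"
  shows "action p \<omega> \<gamma> \<psi> = orbit_action \<gamma> \<mu> \<phi>" "virial p \<gamma> \<psi> = orbit_virial \<gamma> \<mu> \<phi>"
proof -
  have aff: "\<mu> * (LINT x|lborel. h (\<mu> * x)) = (LINT x|lborel. h x)" for h :: "real \<Rightarrow> real"
    using lborel_integral_real_affine[of \<mu> h 0] \<mu> by simp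
  have K: "kinetic \<psi> = \<mu>\<^sup>2 * kinetic \<phi>"
  proof -
    have "kinetic \<psi> = (LINT x|lborel. (sqrt \<mu> * (\<mu> * f' (\<mu> * x)))\<^sup>2)"
      unfolding \<psi>_def by (rule piecewise_C1_H1(2)[OF piecewise_C1_scale[OF f \<mu>]])
    also have "\<dots> = \<mu>\<^sup>2 * (\<mu> * (LINT x|lborel. (f' (\<mu> * x))\<^sup>2))"
      using \<mu> by (simp add: power_mult_distrib)
    also have "\<dots> = \<mu>\<^sup>2 * kinetic \<phi>" unfolding aff[of "\<lambda>x. (f' x)\<^sup>2"] \<phi>_def piecewise_C1_H1(2)[OF f] ..
    finally show ?thesis .
  qed
  have M: "mass \<psi> = mass \<phi>"
    using aff[of "\<lambda>x. (f x)\<^sup>2"] \<mu> by (simp add: mass_def \<psi>_def \<phi>_def norm_mult power_mult_distrib)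
  have N: "power_integral (p + 1) \<psi> = \<mu> powr ((p - 1) / 2) * power_integral (p + 1) \<phi>"
  proof -
    have "power_integral (p + 1) \<psi> = (LINT x|lborel. \<mu> powr ((p - 1) / 2) * (\<mu> * \<bar>f (\<mu> * x)\<bar> powr (p + 1)))"
      unfolding power_integral_def \<psi>_def using \<mu> by (simp add: norm_mult powr_mult sqrt_powr_scale mult.assoc)
    also have "\<dots> = \<mu> powr ((p - 1) / 2) * (\<mu> * (LINT x|lborel. \<bar>f (\<mu> * x)\<bar> powr (p + 1)))"
      by simp
    also have "\<dots> = \<mu> powr ((p - 1) / 2) * power_integral (p + 1) \<phi>"
      unfolding aff[of "\<lambda>x. \<bar>f x\<bar> powr (p + 1)"] power_integral_def \<phi>_def by simp
    finally show ?thesis .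
  qed
  have D: "(norm (\<psi> 0))\<^sup>2 = \<mu> * (norm (\<phi> 0))\<^sup>2"
    using \<mu> by (simp add: \<psi>_def \<phi>_def norm_mult power_mult_distrib)
  show "action p \<omega> \<gamma> \<psi> = orbit_action \<gamma> \<mu> \<phi>"
    unfolding action_eq orbit_action_def K M N D by simp
  show "virial p \<gamma> \<psi> = orbit_virial \<gamma> \<mu> \<phi>"
    unfolding virial_eq orbit_virial_def K N D by simp
qed

lemma powr_2_gt_4: "2 powr ((p - 1) / 2) > (4::real)"
proof -
  have "2 powr 2 < (2::real) powr ((p - 1) / 2)" using p_gt_5 by (intro powr_less_mono) auto
  then show ?thesis by simp
qed

text \<open>Since \<open>P\<^sub>\<gamma> \<ge> 0\<close> at \<open>\<mu> = 1\<close> and, by the smallness of the delta term, \<open>P\<^sub>\<gamma> \<le> 0\<close> at \<open>\<mu> = 2\<close>, some dilation in between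
satisfies the constraint. The action without delta does not increase for \<open>\<mu> \<ge> 1\<close> because \<open>P\<^sub>0 \<le> 0\<close>, and the
delta term is multiplied by at most \<open>2\<close>.\<close>

lemma scale_to_virial_0:
  assumes f: "piecewise_C1 f f'" and "f x1 \<noteq> 0"
  defines "\<phi> \<equiv> \<lambda>x. complex_of_real (f x)"
  assumes P0: "virial p 0 \<phi> \<le> 0" and P: "virial p \<gamma> \<phi> \<ge> 0" and "\<gamma> \<le> 0"
    and small: "- \<gamma> * (f 0)\<^sup>2 < (p - 1) / (2 * (p + 1)) * ((2 powr ((p - 1) / 2) - 4) * power_integral (p + 1) \<phi>)"
  shows "\<exists>\<mu>>0. (dilation \<mu> f) \<in> admissible H1 p \<gamma> \<and>
     action p \<omega> \<gamma> (dilation \<mu> f) \<le> action p \<omega> 0 \<phi> - \<gamma> * (f 0)\<^sup>2"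
proof -
  define N where "N = power_integral (p + 1) \<phi>"
  define c where "c = (p - 1) / (2 * (p + 1))"
  have N: "N \<ge> 0" unfolding N_def power_integral_def by simp
  have D: "(norm (\<phi> 0))\<^sup>2 = (f 0)\<^sup>2" by (simp add: \<phi>_def)
  have K: "kinetic \<phi> \<le> 2 * (c * N)"
    using P0 unfolding virial_eq N_def[symmetric] c_def[symmetric] by simp
  have v: "orbit_virial \<gamma> \<mu> \<phi> = \<mu>\<^sup>2 / 2 * kinetic \<phi> - \<gamma> / 2 * \<mu> * (f 0)\<^sup>2 - c * (\<mu> powr ((p - 1) / 2) * N)" for \<mu>
    unfolding orbit_virial_def N_def c_def D ..
  have "orbit_virial \<gamma> 2 \<phi> = 2 * kinetic \<phi> - \<gamma> * (f 0)\<^sup>2 - c * (2 powr ((p - 1) / 2) * N)"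
    unfolding v by simp
  also have "\<dots> \<le> - \<gamma> * (f 0)\<^sup>2 - c * ((2 powr ((p - 1) / 2) - 4) * N)"
    using K by (simp add: algebra_simps)
  also have "\<dots> \<le> 0" using small unfolding N_def[symmetric] c_def[symmetric] by simp
  finally have "orbit_virial \<gamma> 2 \<phi> \<le> 0" .
  moreover have "orbit_virial \<gamma> 1 \<phi> \<ge> 0" using P unfolding orbit_virial_1 .
  moreover have "continuous_on {1..2} (\<lambda>\<mu>. orbit_virial \<gamma> \<mu> \<phi>)"
    unfolding v by (intro continuous_intros) auto
  ultimately obtain \<mu> where \<mu>: "1 \<le> \<mu>" "\<mu> \<le> 2" "orbit_virial \<gamma> \<mu> \<phi> = 0"
    using IVT2'[of "\<lambda>\<mu>. orbit_virial \<gamma> \<mu> \<phi>" 2 0 1] by auto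
  have \<mu>0: "\<mu> > 0" using \<mu> by simp
  let ?\<psi> = "dilation \<mu> f"
  note s = scaled_functionals[OF f \<mu>0, folded \<phi>_def]
  have "?\<psi> (x1 / \<mu>) \<noteq> 0" using assms(2) \<mu>0 by simp
  then have "?\<psi> \<noteq> (\<lambda>x. 0)" by metis
  then have adm: "?\<psi> \<in> admissible H1 p \<gamma>"
    unfolding admissible_def using piecewise_C1_H1(1)[OF piecewise_C1_scale[OF f \<mu>0]] s(2)[of \<gamma>] \<mu>(3) by simp
  have "action p \<omega> \<gamma> ?\<psi> = orbit_action 0 \<mu> \<phi> - \<gamma> / 2 * \<mu> * (f 0)\<^sup>2"
    using s(1)[of \<gamma>] orbit_action_delta[of \<gamma> \<mu> \<phi>] D by simp
  also have "- \<gamma> / 2 * \<mu> * (f 0)\<^sup>2 \<le> - \<gamma> / 2 * 2 * (f 0)\<^sup>2"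
    using \<mu> \<open>\<gamma> \<le> 0\<close> by (intro mult_right_mono mult_left_mono) auto
  then have "orbit_action 0 \<mu> \<phi> - \<gamma> / 2 * \<mu> * (f 0)\<^sup>2 \<le> orbit_action 0 \<mu> \<phi> - \<gamma> * (f 0)\<^sup>2" by simp
  also have "orbit_action 0 \<mu> \<phi> \<le> orbit_action 0 1 \<phi>"
  proof -
    define n where "n = N / (p + 1)"
    have n: "n \<ge> 0" using N p_gt_5 by (simp add: n_def)
    have c2: "2 * c = (p - 1) / (p + 1)" using p_gt_5 by (simp add: c_def divide_simps algebra_simps)
    have 2: "2 * (c * N) = (p - 1) * n" unfolding mult.assoc[symmetric] c2 n_def by simp
    have "orbit_action 0 \<mu> \<phi> - orbit_action 0 1 \<phi> = (\<mu>\<^sup>2 - 1) / 4 * kinetic \<phi> - (\<mu> powr ((p - 1) / 2) - 1) * n"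
      unfolding orbit_action_def N_def[symmetric] n_def by (simp add: algebra_simps diff_divide_distrib)
    also have "\<dots> \<le> (\<mu>\<^sup>2 - 1) / 4 * ((p - 1) * n) - (\<mu> powr ((p - 1) / 2) - 1) * n"
      using K[unfolded 2] \<mu>(1) by (intro diff_right_mono mult_left_mono) auto
    also have "\<dots> = n * ((1 + (p - 1) / 4 * (\<mu>\<^sup>2 - 1)) - \<mu> powr ((p - 1) / 2))"
      by (simp add: algebra_simps add_divide_distrib diff_divide_distrib)
    also have "\<dots> \<le> 0" using n powr_scale_ge[OF \<mu>0] by (intro mult_nonneg_nonpos) auto
    finally show ?thesis by simp
  qed
  also have "orbit_action 0 1 \<phi> = action p \<omega> 0 \<phi>" by (simp add: action_eq)
  finally show ?thesis using adm \<mu>0 by (intro exI[of _ \<mu>]) auto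
qed

end

lemma LINT_halfline_FTC:
  fixes F f :: "real \<Rightarrow> real"
  assumes "finite S" "\<And>x. x \<ge> 0 \<Longrightarrow> x \<notin> S \<Longrightarrow> (F has_real_derivative f x) (at x)"
    and "continuous_on {0..} F" and f: "set_integrable lborel {0..} f" and "(F \<longlongrightarrow> L) at_top"
  shows "(LINT x:{0..}|lborel. f x) = L - F 0"
proof -
  have "((\<lambda>R. LINT x:{0..R}|lborel. f x) \<longlongrightarrow> (LINT x:{0..}|lborel. f x)) at_top"
    by (rule tendsto_set_lebesgue_integral_at_top[OF _ f]) auto
  moreover have "((\<lambda>R. LINT x:{0..R}|lborel. f x) \<longlongrightarrow> L - F 0) at_top"
  proof (rule Lim_transform_eventually)
    show "((\<lambda>R. F R - F 0) \<longlongrightarrow> L - F 0) at_top" by (intro tendsto_intros assms)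
    show "\<forall>\<^sub>F R in at_top. F R - F 0 = (LINT x:{0..R}|lborel. f x)"
      using eventually_ge_at_top[of 0]
    proof eventually_elim
      case (elim R)
      have si: "set_integrable lborel {0..R} f" by (rule set_integrable_subset[OF f]) auto
      have "(f has_integral (F R - F 0)) {0..R}"
        by (rule fundamental_theorem_of_calculus_interior_strong[OF assms(1) elim])
           (use assms in \<open>auto intro: continuous_on_subset simp: has_real_derivative_iff_has_vector_derivative[symmetric]\<close>)
      then show ?case using set_borel_integral_eq_integral(2)[OF si] by (simp add: integral_unique)
    qed
  qed
  ultimately show ?thesis by (rule tendsto_unique[rotated]) simp
qed

text \<open>Integrals of symmetric pairs of solitons reduce to half-line integrals of smooth functions.\<close>

lemma even_integral:
  fixes h :: "real \<Rightarrow> real"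
  assumes h: "set_integrable lborel {0..} h"
  shows "integrable lborel (\<lambda>x. h \<bar>x\<bar>)" "(LINT x|lborel. h \<bar>x\<bar>) = 2 * (LINT x:{0..}|lborel. h x)"
proof -
  let ?g = "\<lambda>x. indicator {0..} x *\<^sub>R h x"
  have g: "integrable lborel ?g" using h unfolding set_integrable_def .
  have g': "integrable lborel (\<lambda>x. ?g (- x))"
    using lborel_integrable_real_affine[OF g, of "-1" 0] by simp
  have m: "(\<lambda>x. h \<bar>x\<bar>) = (\<lambda>x. if x \<ge> 0 then ?g x else ?g (- x))" by (auto simp: indicator_def)
  have meas: "(\<lambda>x. h \<bar>x\<bar>) \<in> borel_measurable lborel"
    unfolding m using borel_measurable_integrable[OF g] borel_measurable_integrable[OF g']
    by (intro measurable_If) auto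
  have ae: "AE x in lborel. ?g x + ?g (- x) = h \<bar>x\<bar>"
    using AE_lborel_singleton[of 0] by eventually_elim (auto simp: indicator_def abs_if)
  have s: "integrable lborel (\<lambda>x. ?g x + ?g (- x))" using g g' by (rule Bochner_Integration.integrable_add)
  show "integrable lborel (\<lambda>x. h \<bar>x\<bar>)"
    using integrable_cong_AE[OF borel_measurable_integrable[OF s] meas ae] s by simp
  have "(LINT x|lborel. h \<bar>x\<bar>) = (LINT x|lborel. ?g x + ?g (- x))"
    using integral_cong_AE[OF borel_measurable_integrable[OF s] meas ae] by simp
  also have "\<dots> = (LINT x|lborel. ?g x) + (LINT x|lborel. ?g (- x))"
    by (rule Bochner_Integration.integral_add[OF g g'])
  also have "(LINT x|lborel. ?g (- x)) = (LINT x|lborel. ?g x)"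
    using lborel_integral_real_affine[of "-1" ?g 0] by simp
  finally show "(LINT x|lborel. h \<bar>x\<bar>) = 2 * (LINT x:{0..}|lborel. h x)"
    by (simp add: set_lebesgue_integral_def)
qed

lemma integrable_exp_minus_abs:
  assumes "a > 0" shows "integrable lborel (\<lambda>x::real. exp (- a * \<bar>x\<bar>))"
proof -
  have "(\<integral>\<^sup>+x. ennreal (exp (- a * x)) * indicator {0..} x \<partial>lborel) = ennreal (0 - (- exp (- a * 0) / a))"
  proof (rule nn_integral_FTC_atLeast)
    have "((\<lambda>x. exp (- (a * x))) \<longlongrightarrow> 0) at_top"
      using assms by (intro filterlim_compose[OF exp_at_bot] filterlim_compose[OF filterlim_uminus_at_bot_at_top]
         filterlim_tendsto_pos_mult_at_top[OF tendsto_const]) (auto simp: filterlim_ident)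
    then have "((\<lambda>x. - exp (- (a * x)) / a) \<longlongrightarrow> - 0 / a) at_top"
      using assms by (intro tendsto_divide tendsto_minus tendsto_const) auto
    then show "((\<lambda>x. - exp (- a * x) / a) \<longlongrightarrow> 0) at_top" by simp
    show "((\<lambda>x. - exp (- a * x) / a) has_real_derivative exp (- a * x)) (at x)" for x
      using assms by (auto intro!: derivative_eq_intros)
  qed auto
  then have "set_integrable lborel {0..} (\<lambda>x. exp (- a * x))"
    unfolding set_integrable_def
    by (intro integrableI_nonneg) (auto simp: indicator_mult_ennreal mult.commute)
  from even_integral(1)[OF this] show ?thesis by simp
qed

section \<open>Solitons, one alone or a symmetric pair\<close>

context nls
begin

definition \<beta> :: real where "\<beta> = (p - 1) * sqrt \<omega> / sqrt 2"

text \<open>The soliton of the equation without delta; shifted copies of it are the only profiles that occur.\<close>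

definition sol :: "real \<Rightarrow> real" where
  "sol x = ((p + 1) * \<omega> / 2 * (1 / (cosh (\<beta> * x))\<^sup>2)) powr (1 / (p - 1))"

definition sol' :: "real \<Rightarrow> real" where
  "sol' x = - sqrt (2 * \<omega>) * tanh (\<beta> * x) * sol x"

lemma \<beta>_pos: "\<beta> > 0" using p_gt_5 \<omega>_pos by (simp add: \<beta>_def)

lemma sol_pos: "sol x > 0"
proof -
  have "cosh (\<beta> * x) \<noteq> 0" using cosh_real_pos[of "\<beta> * x"] by linarith
  then show ?thesis using p_gt_5 \<omega>_pos by (simp add: sol_def)
qed

lemma sol_even: "sol (- x) = sol x" and sol'_odd: "sol' (- x) = - sol' x"
  by (simp_all add: sol_def sol'_def)

lemma sol_0: "sol 0 = peak" by (simp add: sol_def peak_def)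

lemma sol_powr: "sol x powr (p - 1) = (p + 1) * \<omega> / 2 * (1 - (tanh (\<beta> * x))\<^sup>2)"
proof -
  have c: "cosh (\<beta> * x) > 0" by (rule cosh_real_pos)
  have "sol x powr (p - 1) = (p + 1) * \<omega> / 2 * (1 / (cosh (\<beta> * x))\<^sup>2)"
    unfolding sol_def using p_gt_5 \<omega>_pos c by (simp add: powr_powr)
  also have "1 / (cosh (\<beta> * x))\<^sup>2 = 1 - (tanh (\<beta> * x))\<^sup>2"
  proof -
    have "1 - (tanh (\<beta> * x))\<^sup>2 = ((cosh (\<beta> * x))\<^sup>2 - (sinh (\<beta> * x))\<^sup>2) / (cosh (\<beta> * x))\<^sup>2"
      using c by (simp add: tanh_def power_divide diff_divide_distrib)
    also have "(cosh (\<beta> * x))\<^sup>2 - (sinh (\<beta> * x))\<^sup>2 = 1" by (simp add: cosh_square_eq)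
    finally show ?thesis by simp
  qed
  finally show ?thesis .
qed

lemma sol_eq_cosh_powr: "sol x = peak * cosh (\<beta> * x) powr (- 2 / (p - 1))"
proof -
  have c: "cosh (\<beta> * x) > 0" by (rule cosh_real_pos)
  have "(1 / (cosh (\<beta> * x))\<^sup>2) = cosh (\<beta> * x) powr (- 2)"
    using c by (simp add: powr_minus divide_inverse)
  then have "sol x = ((p + 1) * \<omega> / 2) powr (1 / (p - 1)) * (cosh (\<beta> * x) powr (- 2)) powr (1 / (p - 1))"
    unfolding sol_def by (simp only: powr_mult)
  then show ?thesis unfolding peak_def powr_powr by simp
qed

lemma rate_eq: "2 / (p - 1) * \<beta> = sqrt (2 * \<omega>)"
  using p_gt_5 by (simp add: \<beta>_def real_sqrt_mult real_div_sqrt field_simps)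

lemma sol_deriv: "(sol has_real_derivative sol' x) (at x)"
proof -
  have c: "cosh (\<beta> * x) > 0" by (rule cosh_real_pos)
  have "((\<lambda>x. peak * cosh (\<beta> * x) powr (- 2 / (p - 1))) has_real_derivative
     peak * ((- 2 / (p - 1)) * cosh (\<beta> * x) powr (- 2 / (p - 1) - 1) * (sinh (\<beta> * x) * \<beta>))) (at x)"
    using c by (auto intro!: derivative_eq_intros DERIV_fun_powr[THEN DERIV_cong])
  also have "peak * ((- 2 / (p - 1)) * cosh (\<beta> * x) powr (- 2 / (p - 1) - 1) * (sinh (\<beta> * x) * \<beta>))
    = - (2 / (p - 1) * \<beta>) * tanh (\<beta> * x) * (peak * cosh (\<beta> * x) powr (- 2 / (p - 1)))"
    using c by (simp add: powr_diff tanh_def)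
  also have "\<dots> = sol' x" unfolding rate_eq sol'_def sol_eq_cosh_powr ..
  finally show ?thesis unfolding sol_eq_cosh_powr[abs_def] .
qed

text \<open>The first integral: the soliton runs along the phase curve on which the square in \<open>density_split\<close> is zero.\<close>

lemma sol'_sq: "(sol' x)\<^sup>2 = W (sol x)"
proof -
  have "W (sol x) = (sol x)\<^sup>2 * (2 * \<omega> - 4 / (p + 1) * ((p + 1) * \<omega> / 2 * (1 - (tanh (\<beta> * x))\<^sup>2)))"
    unfolding W_factor[OF less_imp_le[OF sol_pos]] sol_powr ..
  also have "4 / (p + 1) * ((p + 1) * \<omega> / 2 * (1 - (tanh (\<beta> * x))\<^sup>2)) = 2 * \<omega> * (1 - (tanh (\<beta> * x))\<^sup>2)"
    using p_gt_5 by (simp add: field_simps)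
  finally show ?thesis
    using \<omega>_pos by (simp add: sol'_def power_mult_distrib algebra_simps)
qed

lemma sol_le_peak: "sol x \<le> peak"
proof -
  have "(tanh (\<beta> * x))\<^sup>2 \<ge> 0" by simp
  then have "sol x powr (p - 1) \<le> peak powr (p - 1)"
    unfolding sol_powr peak_powr using p_gt_5 \<omega>_pos by (intro mult_left_le) auto
  then show ?thesis using powr_less_mono2[of "p - 1" peak "sol x"] p_gt_5 peak_pos by linarith
qed

lemma speed_sol: "speed (sol x) = \<bar>sol' x\<bar>"
proof -
  have "speed (sol x) = sqrt (W (sol x))"
    unfolding speed_def using W_nonneg[of "sol x"] sol_pos[of x] sol_le_peak[of x] by simp
  then show ?thesis unfolding sol'_sq[symmetric] by simp
qed

lemma sol'_neg: "x \<ge> 0 \<Longrightarrow> sol' x \<le> 0" and sol'_pos: "x \<le> 0 \<Longrightarrow> sol' x \<ge> 0"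
proof -
  show *: "sol' x \<le> 0" if "x \<ge> 0" for x
    using that \<beta>_pos sol_pos[of x] \<omega>_pos unfolding sol'_def
    by (simp add: zero_le_mult_iff)
  show "sol' x \<ge> 0" if "x \<le> 0" using *[of "- x"] that sol'_odd[of "- x"] by simp
qed

lemma abs_sol'_le: "\<bar>sol' x\<bar> \<le> sqrt (2 * \<omega>) * sol x"
  using speed_le[OF less_imp_le[OF sol_pos]] by (simp add: speed_sol)

lemma sol'_deriv: "(sol' has_real_derivative 2 * \<omega> * sol x - 2 * sol x powr p) (at x)"
proof -
  have c: "cosh (\<beta> * x) \<noteq> 0" using cosh_real_pos[of "\<beta> * x"] by linarith
  let ?t = "tanh (\<beta> * x)"
  have eq: "sol' = (\<lambda>x. - sqrt (2 * \<omega>) * tanh (\<beta> * x) * sol x)" by (simp add: fun_eq_iff sol'_def)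
  have "((\<lambda>x. - sqrt (2 * \<omega>) * tanh (\<beta> * x) * sol x) has_real_derivative
     - sqrt (2 * \<omega>) * ((1 - ?t\<^sup>2) * \<beta>) * sol x + - sqrt (2 * \<omega>) * ?t * sol' x) (at x)"
    using c by (auto intro!: derivative_eq_intros sol_deriv simp: algebra_simps)
  also have "- sqrt (2 * \<omega>) * ((1 - ?t\<^sup>2) * \<beta>) * sol x + - sqrt (2 * \<omega>) * ?t * sol' x
     = 2 * \<omega> * sol x - 2 * sol x powr p"
  proof -
    have "sol x powr p = sol x powr (p - 1) * sol x powr 1"
      unfolding powr_add[symmetric] by simp
    then have 1: "sol x powr p = (p + 1) * \<omega> / 2 * (1 - ?t\<^sup>2) * sol x"
      unfolding sol_powr using sol_pos[of x] by simp
    have 2: "sqrt (2 * \<omega>) * \<beta> = (p - 1) * \<omega>"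
      using \<omega>_pos by (simp add: \<beta>_def real_sqrt_mult)
    have 3: "sqrt (2 * \<omega>) * sqrt (2 * \<omega>) = 2 * \<omega>" using \<omega>_pos by simp
    have "- sqrt (2 * \<omega>) * ((1 - ?t\<^sup>2) * \<beta>) * sol x + - sqrt (2 * \<omega>) * ?t * sol' x
      = - (sqrt (2 * \<omega>) * \<beta>) * (1 - ?t\<^sup>2) * sol x + (sqrt (2 * \<omega>) * sqrt (2 * \<omega>)) * ?t\<^sup>2 * sol x"
      by (simp add: sol'_def power2_eq_square)
    also have "\<dots> = 2 * \<omega> * sol x - 2 * sol x powr p"
      unfolding 1 2 3 by (simp add: algebra_simps add_divide_distrib diff_divide_distrib)
    finally show ?thesis .
  qed
  finally show ?thesis unfolding eq[symmetric] .
qed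

lemma sol_shift_deriv: "((\<lambda>x. sol (x - y)) has_real_derivative sol' (x - y)) (at x)"
  and sol'_shift_deriv: "((\<lambda>x. sol' (x - y)) has_real_derivative 2 * \<omega> * sol (x - y) - 2 * sol (x - y) powr p) (at x)"
proof -
  have "((\<lambda>x. x - y) has_real_derivative 1) (at x)" by (auto intro!: derivative_eq_intros)
  from DERIV_chain2[OF sol_deriv this] DERIV_chain2[OF sol'_deriv this]
  show "((\<lambda>x. sol (x - y)) has_real_derivative sol' (x - y)) (at x)"
    "((\<lambda>x. sol' (x - y)) has_real_derivative 2 * \<omega> * sol (x - y) - 2 * sol (x - y) powr p) (at x)" by simp_all
qed

lemma sol_continuous: "continuous_on A sol" and sol'_continuous: "continuous_on A sol'"
  by (meson DERIV_continuous continuous_at_imp_continuous_on sol_deriv sol'_deriv)+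

lemma sol_measurable [measurable]: "sol \<in> borel_measurable borel"
  and sol'_measurable [measurable]: "sol' \<in> borel_measurable borel"
  by (intro borel_measurable_continuous_onI sol_continuous sol'_continuous)+

lemma sol_decay: "\<exists>C. \<forall>x. sol x \<le> C * exp (- sqrt (2 * \<omega>) * \<bar>x\<bar>)"
proof (intro exI allI)
  fix x
  have "exp \<bar>\<beta> * x\<bar> / 2 \<le> cosh \<bar>\<beta> * x\<bar>" by (simp add: cosh_def)
  then have "exp \<bar>\<beta> * x\<bar> / 2 \<le> cosh (\<beta> * x)" by simp
  then have "cosh (\<beta> * x) powr (- 2 / (p - 1)) \<le> (exp \<bar>\<beta> * x\<bar> / 2) powr (- 2 / (p - 1))"
    using p_gt_5 by (intro powr_mono2') auto
  also have "\<dots> = exp (- 2 / (p - 1) * \<bar>\<beta> * x\<bar>) * (1 / 2) powr (- 2 / (p - 1))"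
    using powr_mult[of "exp \<bar>\<beta> * x\<bar>" "1/2" "- 2 / (p - 1)"] by (simp add: powr_def mult.commute)
  also have "- 2 / (p - 1) * \<bar>\<beta> * x\<bar> = - (2 / (p - 1) * \<beta>) * \<bar>x\<bar>"
    using \<beta>_pos by (simp add: abs_mult)
  finally show "sol x \<le> (peak * (1 / 2) powr (- 2 / (p - 1))) * exp (- sqrt (2 * \<omega>) * \<bar>x\<bar>)"
    unfolding sol_eq_cosh_powr rate_eq using peak_pos by (simp add: mult_ac mult_left_mono)
qed

lemma sol_sq_integrable: "integrable lborel (\<lambda>x. (sol x)\<^sup>2)"
proof -
  obtain C where C: "\<And>x. sol x \<le> C * exp (- sqrt (2 * \<omega>) * \<bar>x\<bar>)" using sol_decay by blast
  show ?thesis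
  proof (rule Bochner_Integration.integrable_bound)
    show "integrable lborel (\<lambda>x. C\<^sup>2 * exp (- (2 * sqrt (2 * \<omega>)) * \<bar>x\<bar>))"
      using \<omega>_pos by (intro integrable_mult_right integrable_exp_minus_abs) auto
    have "(sol x)\<^sup>2 \<le> (C * exp (- sqrt (2 * \<omega>) * \<bar>x\<bar>))\<^sup>2" for x
      using C[of x] sol_pos[of x] by (intro power_mono) auto
    also have "(C * exp (- sqrt (2 * \<omega>) * \<bar>x\<bar>))\<^sup>2 = C\<^sup>2 * exp (- (2 * sqrt (2 * \<omega>)) * \<bar>x\<bar>)" for x
      by (simp add: power_mult_distrib exp_double[symmetric] mult.assoc)
    finally show "AE x in lborel. norm ((sol x)\<^sup>2) \<le> norm (C\<^sup>2 * exp (- (2 * sqrt (2 * \<omega>)) * \<bar>x\<bar>))"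
      by (intro AE_I2) simp
  qed measurable
qed

lemma sol_powr_integrable: "integrable lborel (\<lambda>x. sol x powr (p + 1))"
proof (rule Bochner_Integration.integrable_bound)
  show "integrable lborel (\<lambda>x. (p + 1) * \<omega> / 2 * (sol x)\<^sup>2)" using sol_sq_integrable by simp
  have "sol x powr (p + 1) \<le> (p + 1) * \<omega> / 2 * (sol x)\<^sup>2" for x
  proof -
    have "W (sol x) \<ge> 0" by (simp flip: sol'_sq)
    then have "4 / (p + 1) * sol x powr (p + 1) \<le> 2 * \<omega> * (sol x)\<^sup>2"
      using sol_pos[of x] by (simp add: W_def)
    then show ?thesis using p_gt_5 by (simp add: field_simps)
  qed
  then show "AE x in lborel. norm (sol x powr (p + 1)) \<le> norm ((p + 1) * \<omega> / 2 * (sol x)\<^sup>2)"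
    using p_gt_5 \<omega>_pos by (intro AE_I2) simp
qed measurable

lemma sol'_sq_eq: "(sol' x)\<^sup>2 = 2 * \<omega> * (sol x)\<^sup>2 - 4 / (p + 1) * sol x powr (p + 1)"
  unfolding sol'_sq W_def using sol_pos[of x] by simp

lemma sol'_sq_integrable: "integrable lborel (\<lambda>x. (sol' x)\<^sup>2)"
  unfolding sol'_sq_eq using sol_sq_integrable sol_powr_integrable by simp

lemma shift_integrable:
  fixes h :: "real \<Rightarrow> real"
  assumes "integrable lborel h"
  shows "integrable lborel (\<lambda>x. h (x - y))" "set_integrable lborel {0..} (\<lambda>x. h (x - y))"
    "integrable lborel (\<lambda>x. h (\<bar>x\<bar> - y))"
    "(LINT x|lborel. h (\<bar>x\<bar> - y)) = 2 * (LINT x:{0..}|lborel. h (x - y))"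
    "(LINT x|lborel. h (x - y)) = (LINT x|lborel. h x)"
proof -
  show i: "integrable lborel (\<lambda>x. h (x - y))"
    using lborel_integrable_real_affine[OF assms, of 1 "- y"] by simp
  then show s: "set_integrable lborel {0..} (\<lambda>x. h (x - y))"
    unfolding set_integrable_def using integrable_mult_indicator[OF _ i, of "{0..}"] by simp
  show "integrable lborel (\<lambda>x. h (\<bar>x\<bar> - y))" "(LINT x|lborel. h (\<bar>x\<bar> - y)) = 2 * (LINT x:{0..}|lborel. h (x - y))"
    by (rule even_integral[OF s])+
  show "(LINT x|lborel. h (x - y)) = (LINT x|lborel. h x)"
    using lborel_integral_real_affine[of 1 h "- y"] by simp
qed

lemma translated_sol_C1: "piecewise_C1 (\<lambda>x. sol (x - y)) (\<lambda>x. sol' (x - y))"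
  unfolding piecewise_C1_def
proof (intro conjI allI impI)
  show "continuous_on UNIV (\<lambda>x. sol (x - y))"
    by (intro continuous_on_compose2[OF sol_continuous] continuous_intros) auto
  show "((\<lambda>x. sol (x - y)) has_real_derivative sol' (x - y)) (at x)" for x
    by (rule sol_shift_deriv)
qed (use shift_integrable(1)[OF sol_sq_integrable] shift_integrable(1)[OF sol'_sq_integrable] in measurable)

definition right_sgn :: "real \<Rightarrow> real" where "right_sgn x = (if x < 0 then -1 else 1)"

lemma right_sgn_sq: "(right_sgn x * c)\<^sup>2 = c\<^sup>2" by (simp add: right_sgn_def)

lemma radial_sol_C1: "piecewise_C1 (\<lambda>x. sol (\<bar>x\<bar> - y)) (\<lambda>x. right_sgn x * sol' (\<bar>x\<bar> - y))"
  unfolding piecewise_C1_def right_sgn_sq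
proof (intro conjI allI impI)
  show "continuous_on UNIV (\<lambda>x. sol (\<bar>x\<bar> - y))"
    by (intro continuous_on_compose2[OF sol_continuous] continuous_intros) auto
  fix x :: real assume "x \<noteq> 0"
  have "((\<lambda>x. \<bar>x\<bar> - y) has_real_derivative right_sgn x) (at x)"
  proof (cases "x > 0")
    case True
    have "((\<lambda>x. x - y) has_real_derivative 1) (at x)" by (auto intro!: derivative_eq_intros)
    then have "((\<lambda>x. \<bar>x\<bar> - y) has_real_derivative 1) (at x)"
      by (rule has_field_derivative_transform_within_open[where S="{0<..}"]) (use True in auto)
    then show ?thesis using True by (simp add: right_sgn_def)
  next
    case False
    then have neg: "x < 0" using \<open>x \<noteq> 0\<close> by simp
    have "((\<lambda>x. - x - y) has_real_derivative - 1) (at x)" by (auto intro!: derivative_eq_intros)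
    then have "((\<lambda>x. \<bar>x\<bar> - y) has_real_derivative - 1) (at x)"
      by (rule has_field_derivative_transform_within_open[where S="{..<0}"]) (use neg in auto)
    then show ?thesis using neg by (simp add: right_sgn_def)
  qed
  from DERIV_chain2[OF sol_deriv this]
  show "((\<lambda>x. sol (\<bar>x\<bar> - y)) has_real_derivative right_sgn x * sol' (\<bar>x\<bar> - y)) (at x)"
    by (simp add: mult.commute)
next
  show "(\<lambda>x. right_sgn x * sol' (\<bar>x\<bar> - y)) \<in> borel_measurable borel" unfolding right_sgn_def by measurable
qed (use shift_integrable(3)[OF sol_sq_integrable] shift_integrable(3)[OF sol'_sq_integrable] in simp_all)

lemma sol_vanishes: "(sol \<longlongrightarrow> 0) at_top"
proof -
  interpret h1_path "\<lambda>x. 1 * norm (complex_of_real (sol (x - 0)))" "\<lambda>x. 1 * norm (weak_deriv (\<lambda>x. complex_of_real (sol (x - 0))) x)"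
    by (intro h1_path_norm piecewise_C1_H1(1)[OF translated_sol_C1]) simp
  have "(\<lambda>x. 1 * norm (complex_of_real (sol (x - 0)))) = sol" using sol_pos by (auto simp: less_imp_le)
  then show ?thesis using u_vanishes(1) by simp
qed

lemma sol_shift_vanishes: "((\<lambda>x. sol (x - y)) \<longlongrightarrow> 0) at_top"
proof (rule filterlim_compose[OF sol_vanishes])
  show "filterlim (\<lambda>x. x - y) at_top at_top"
    using filterlim_tendsto_add_at_top[OF tendsto_const[of "- y"] filterlim_ident] by simp
qed

text \<open>By the first integral, \<open>sol'\<^sup>2 = speed sol * \<bar>sol'\<bar>\<close> is the derivative of \<open>cost \<circ> sol\<close> on the rising part
and of its negative on the falling part. The soliton starts at the height \<open>sol y\<close>, climbs to \<open>peak\<close> at \<open>x = y\<close>, and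
falls to \<open>0\<close>.\<close>

lemma half_kinetic:
  assumes "y \<ge> 0"
  shows "(LINT x:{0..}|lborel. (sol' (x - y))\<^sup>2) = 2 * cost peak - cost (sol y)"
proof -
  define A where "A x = (if x \<le> y then cost (sol (x - y)) else 2 * cost peak - cost (sol (x - y)))" for x
  have cs: "((\<lambda>x. cost (sol (x - y))) has_real_derivative speed (sol (x - y)) * sol' (x - y)) (at x)" for x
    by (rule DERIV_chain2[OF cost_deriv sol_shift_deriv]) (simp add: sol_pos less_imp_le)
  have cc: "continuous_on B (\<lambda>x. cost (sol (x - y)))" for B
    by (intro continuous_at_imp_continuous_on ballI DERIV_isCont[OF cs])
  have "(LINT x:{0..}|lborel. (sol' (x - y))\<^sup>2) = 2 * cost peak - A 0"
  proof (rule LINT_halfline_FTC[of "{y}"])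
    show "set_integrable lborel {0..} (\<lambda>x. (sol' (x - y))\<^sup>2)"
      by (rule shift_integrable(2)[OF sol'_sq_integrable])
    have "continuous_on ({0..y} \<union> {y..}) A"
      unfolding A_def
    proof (rule continuous_on_If)
      show "continuous_on {y..} (\<lambda>x. 2 * cost peak - cost (sol (x - y)))" by (intro continuous_intros cc)
      fix x assume "x \<in> {y..}" "x \<le> y"
      then show "cost (sol (x - y)) = 2 * cost peak - cost (sol (x - y))" by (simp add: sol_0)
    next
      fix x assume "x \<in> {0..y}" "\<not> x \<le> y"
      then show "cost (sol (x - y)) = 2 * cost peak - cost (sol (x - y))" by simp
    qed (auto intro: cc)
    then show "continuous_on {0..} A" by (rule continuous_on_subset) auto
    have "((\<lambda>x. 2 * cost peak - cost (sol (x - y))) \<longlongrightarrow> 2 * cost peak - 0) at_top"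
      by (intro tendsto_intros cost_tendsto_0 sol_shift_vanishes)
    then have "((\<lambda>x. 2 * cost peak - cost (sol (x - y))) \<longlongrightarrow> 2 * cost peak) at_top" by simp
    then show "(A \<longlongrightarrow> 2 * cost peak) at_top"
    proof (rule Lim_transform_eventually)
      show "\<forall>\<^sub>F x in at_top. 2 * cost peak - cost (sol (x - y)) = A x"
        using eventually_gt_at_top[of y] by eventually_elim (simp add: A_def)
    qed
    fix x :: real assume "0 \<le> x" "x \<notin> {y}"
    show "(A has_real_derivative (sol' (x - y))\<^sup>2) (at x)"
    proof (cases "x < y")
      case True
      have "((\<lambda>x. cost (sol (x - y))) has_real_derivative (sol' (x - y))\<^sup>2) (at x)"
        using cs[of x] sol'_pos[of "x - y"] True by (simp add: speed_sol power2_eq_square)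
      then show ?thesis
        by (rule has_field_derivative_transform_within_open[where S="{..<y}"]) (use True in \<open>auto simp: A_def\<close>)
    next
      case False
      then have "x > y" using \<open>x \<notin> {y}\<close> by simp
      have "((\<lambda>x. 2 * cost peak - cost (sol (x - y))) has_real_derivative 0 - speed (sol (x - y)) * sol' (x - y)) (at x)"
        by (intro derivative_intros cs)
      then have "((\<lambda>x. 2 * cost peak - cost (sol (x - y))) has_real_derivative (sol' (x - y))\<^sup>2) (at x)"
        using sol'_neg[of "x - y"] \<open>x > y\<close> by (simp add: speed_sol power2_eq_square)
      then show ?thesis
        by (rule has_field_derivative_transform_within_open[where S="{y<..}"]) (use \<open>x > y\<close> in \<open>auto simp: A_def\<close>)
    qed
  qed simp
  also have "A 0 = cost (sol y)" using assms sol_even[of y] by (simp add: A_def)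
  finally show ?thesis .
qed

text \<open>Up to a constant factor the virial density is a derivative: the equation and the first integral give
\<open>(sol sol')' = 2 (sol'\<^sup>2 - (p - 1) / (p + 1) sol\<^sup>p\<^sup>+\<^sup>1)\<close>.\<close>

lemma half_virial:
  assumes "y \<ge> 0"
  shows "(LINT x:{0..}|lborel. (sol' (x - y))\<^sup>2) - (p - 1) / (p + 1) * (LINT x:{0..}|lborel. sol (x - y) powr (p + 1))
    = - (sol y * speed (sol y)) / 2"
proof -
  note i1 = shift_integrable(2)[OF sol'_sq_integrable, of y] and i2 = shift_integrable(2)[OF sol_powr_integrable, of y]
  let ?g = "\<lambda>x. 2 * (sol' (x - y))\<^sup>2 - 2 * ((p - 1) / (p + 1)) * sol (x - y) powr (p + 1)"
  have gi: "set_integrable lborel {0..} ?g"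
    by (intro set_integral_diff set_integrable_mult_right i1 i2)
  have "(LINT x:{0..}|lborel. ?g x) = 0 - sol (0 - y) * sol' (0 - y)"
  proof (rule LINT_halfline_FTC[of "{}"])
    fix x :: real
    have "((\<lambda>x. sol (x - y) * sol' (x - y)) has_real_derivative
        sol' (x - y) * sol' (x - y) + (2 * \<omega> * sol (x - y) - 2 * sol (x - y) powr p) * sol (x - y)) (at x)"
      by (rule DERIV_mult[OF sol_shift_deriv sol'_shift_deriv])
    also have "sol' (x - y) * sol' (x - y) + (2 * \<omega> * sol (x - y) - 2 * sol (x - y) powr p) * sol (x - y) = ?g x"
    proof -
      have "sol (x - y) powr (p + 1) = sol (x - y) powr p * sol (x - y)"
        using sol_pos[of "x - y"] by (simp add: powr_add)
      then have 1: "(2 * \<omega> * sol (x - y) - 2 * sol (x - y) powr p) * sol (x - y)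
        = 2 * \<omega> * (sol (x - y))\<^sup>2 - 2 * sol (x - y) powr (p + 1)"
        by (simp add: algebra_simps power2_eq_square)
      have 2: "2 - 4 / (p + 1) = 2 * ((p - 1) / (p + 1))" using p_gt_5 by (simp add: field_simps)
      have "sol' (x - y) * sol' (x - y) + (2 * \<omega> * (sol (x - y))\<^sup>2 - 2 * sol (x - y) powr (p + 1))
        = 2 * (sol' (x - y))\<^sup>2 - (2 - 4 / (p + 1)) * sol (x - y) powr (p + 1)"
        using sol'_sq_eq[of "x - y"] by (simp add: power2_eq_square algebra_simps)
      then show ?thesis unfolding 1 2 .
    qed
    finally show "((\<lambda>x. sol (x - y) * sol' (x - y)) has_real_derivative ?g x) (at x)" .
  next
    show "continuous_on {0..} (\<lambda>x. sol (x - y) * sol' (x - y))"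
      by (intro continuous_intros continuous_on_compose2[OF sol_continuous[of UNIV]] continuous_on_compose2[OF sol'_continuous[of UNIV]]) auto
    have "((\<lambda>x. sqrt (2 * \<omega>) * (sol (x - y) * sol (x - y))) \<longlongrightarrow> sqrt (2 * \<omega>) * (0 * 0)) at_top"
      by (intro tendsto_intros sol_shift_vanishes)
    then have z: "((\<lambda>x. sqrt (2 * \<omega>) * (sol (x - y) * sol (x - y))) \<longlongrightarrow> 0) at_top" by simp
    show "((\<lambda>x. sol (x - y) * sol' (x - y)) \<longlongrightarrow> 0) at_top"
    proof (rule Lim_null_comparison[OF _ z], rule always_eventually, rule allI)
      fix x
      have "\<bar>sol (x - y) * sol' (x - y)\<bar> = sol (x - y) * \<bar>sol' (x - y)\<bar>"
        using sol_pos[of "x - y"] by (simp add: abs_mult)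
      also have "\<dots> \<le> sol (x - y) * (sqrt (2 * \<omega>) * sol (x - y))"
        using sol_pos[of "x - y"] abs_sol'_le by (intro mult_left_mono) auto
      finally show "norm (sol (x - y) * sol' (x - y)) \<le> sqrt (2 * \<omega>) * (sol (x - y) * sol (x - y))"
        by (simp add: mult_ac)
    qed
  qed (use gi in auto)
  also have "(LINT x:{0..}|lborel. ?g x) = 2 * (LINT x:{0..}|lborel. (sol' (x - y))\<^sup>2)
     - 2 * ((p - 1) / (p + 1)) * (LINT x:{0..}|lborel. sol (x - y) powr (p + 1))"
    using i1 i2 by (subst set_integral_diff(2)) auto
  also have "sol (0 - y) * sol' (0 - y) = sol y * speed (sol y)"
    using sol_even[of y] sol'_odd[of y] speed_sol[of y] sol'_neg[OF assms] by simp
  finally have eq: "2 * (LINT x:{0..}|lborel. (sol' (x - y))\<^sup>2)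
     - 2 * ((p - 1) / (p + 1)) * (LINT x:{0..}|lborel. sol (x - y) powr (p + 1)) = 0 - sol y * speed (sol y)" .
  have "a - c * b = - s / 2" if "2 * a - 2 * c * b = 0 - s" for a b c s :: real
    using that by (simp add: field_simps)
  from this[OF eq] show ?thesis .
qed

text \<open>Two half-solitons with the peaks at \<open>\<plusminus> y\<close>, glued at the origin.\<close>

definition radial_sol :: "real \<Rightarrow> real \<Rightarrow> complex" where "radial_sol y x = complex_of_real (sol (\<bar>x\<bar> - y))"

definition translated_sol :: "real \<Rightarrow> real \<Rightarrow> complex" where "translated_sol y x = complex_of_real (sol (x - y))"

lemma radial_sol_integrals:
  "kinetic (radial_sol y) = 2 * (LINT x:{0..}|lborel. (sol' (x - y))\<^sup>2)"
  "mass (radial_sol y) = 2 * (LINT x:{0..}|lborel. (sol (x - y))\<^sup>2)"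
  "power_integral (p + 1) (radial_sol y) = 2 * (LINT x:{0..}|lborel. sol (x - y) powr (p + 1))"
proof -
  show "kinetic (radial_sol y) = 2 * (LINT x:{0..}|lborel. (sol' (x - y))\<^sup>2)"
    unfolding radial_sol_def piecewise_C1_H1(2)[OF radial_sol_C1] right_sgn_sq
    by (rule shift_integrable(4)[OF sol'_sq_integrable])
  show "mass (radial_sol y) = 2 * (LINT x:{0..}|lborel. (sol (x - y))\<^sup>2)"
    unfolding radial_sol_def mass_def using shift_integrable(4)[OF sol_sq_integrable] by simp
  show "power_integral (p + 1) (radial_sol y) = 2 * (LINT x:{0..}|lborel. sol (x - y) powr (p + 1))"
    unfolding radial_sol_def power_integral_def using shift_integrable(4)[OF sol_powr_integrable] sol_pos by (simp add: less_imp_le)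
qed

lemma translated_sol_integrals:
  "kinetic (translated_sol y) = kinetic (radial_sol 0)" "mass (translated_sol y) = mass (radial_sol 0)" "power_integral (p + 1) (translated_sol y) = power_integral (p + 1) (radial_sol 0)"
proof -
  have e: "(sol' \<bar>x\<bar>)\<^sup>2 = (sol' x)\<^sup>2" "sol \<bar>x\<bar> = sol x" for x
    using sol'_odd[of x] sol_even[of x] by (auto simp: abs_if)
  show "kinetic (translated_sol y) = kinetic (radial_sol 0)"
    unfolding translated_sol_def radial_sol_def piecewise_C1_H1(2)[OF radial_sol_C1] piecewise_C1_H1(2)[OF translated_sol_C1] right_sgn_sq
    using shift_integrable(5)[OF sol'_sq_integrable, of y] by (simp add: e)
  show "mass (translated_sol y) = mass (radial_sol 0)"
    unfolding translated_sol_def radial_sol_def mass_def using shift_integrable(5)[OF sol_sq_integrable, of y] by (simp add: e)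
  show "power_integral (p + 1) (translated_sol y) = power_integral (p + 1) (radial_sol 0)"
    unfolding translated_sol_def radial_sol_def power_integral_def using shift_integrable(5)[OF sol_powr_integrable, of y] sol_pos
    by (simp add: e less_imp_le)
qed

text \<open>The pair saturates the lower bound for radial functions of height \<open>sol y\<close> at the origin, and
satisfies the virial constraint exactly when \<open>sol y\<close> is a critical point of the barrier.\<close>

lemma radial_sol_functionals:
  assumes "y \<ge> 0"
  shows "action p \<omega> \<gamma> (radial_sol y) = barrier \<gamma> (sol y)"
    "virial p \<gamma> (radial_sol y) = sol y / 2 * (- \<gamma> * sol y - speed (sol y))"
proof -
  define k m n where "k = (LINT x:{0..}|lborel. (sol' (x - y))\<^sup>2)"
    and "m = (LINT x:{0..}|lborel. (sol (x - y))\<^sup>2)"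
    and "n = (LINT x:{0..}|lborel. sol (x - y) powr (p + 1))"
  note R = radial_sol_integrals[of y, folded k_def m_def n_def]
  have D: "(norm (radial_sol y 0))\<^sup>2 = (sol y)\<^sup>2" using sol_even[of y] by (simp add: radial_sol_def)
  have "k = 2 * \<omega> * m - 4 / (p + 1) * n"
    unfolding k_def m_def n_def sol'_sq_eq
    using shift_integrable(2)[OF sol_sq_integrable, of y] shift_integrable(2)[OF sol_powr_integrable, of y]
    by (subst set_integral_diff(2)) auto
  moreover have "4 / (p + 1) * n = 2 * (1 / (p + 1) * (2 * n))" by simp
  ultimately have k: "k = 2 * \<omega> * m - 2 * (1 / (p + 1) * (2 * n))" by (simp only:)
  have "\<omega> / 2 * (2 * m) = a / 2 + b" if "a = 2 * \<omega> * m - 2 * b" for a b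
    using that by (simp add: diff_divide_distrib)
  from this[OF k] have m: "\<omega> / 2 * (2 * m) = k / 2 + 1 / (p + 1) * (2 * n)" .
  have "action p \<omega> \<gamma> (radial_sol y) = k - \<gamma> / 2 * (sol y)\<^sup>2"
    unfolding action_eq orbit_action_def R D m by simp
  then show "action p \<omega> \<gamma> (radial_sol y) = barrier \<gamma> (sol y)"
    using half_kinetic[OF assms] by (simp add: k_def barrier_def)
  have "virial p \<gamma> (radial_sol y) = (k - (p - 1) / (p + 1) * n) - \<gamma> / 2 * (sol y)\<^sup>2"
  proof -
    have "(p - 1) / (2 * (p + 1)) * (2 * n) = (p - 1) / (p + 1) * n"
      using p_gt_5 by (simp add: divide_simps algebra_simps)
    then show ?thesis unfolding virial_eq R D by simp
  qed
  also have "k - (p - 1) / (p + 1) * n = - (sol y * speed (sol y)) / 2"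
    using half_virial[OF assms] by (simp add: k_def n_def)
  finally show "virial p \<gamma> (radial_sol y) = sol y / 2 * (- \<gamma> * sol y - speed (sol y))"
    by (simp add: algebra_simps power2_eq_square)
qed

lemma translated_sol_functionals:
  "action p \<omega> 0 (translated_sol y) = cost peak" "virial p 0 (translated_sol y) = 0"
proof -
  have "action p \<omega> 0 (translated_sol y) = action p \<omega> 0 (radial_sol 0)" "virial p 0 (translated_sol y) = virial p 0 (radial_sol 0)"
    by (simp_all add: action_eq virial_eq orbit_action_def translated_sol_integrals)
  moreover have "speed peak = 0" by (simp add: speed_def W_peak)
  ultimately show "action p \<omega> 0 (translated_sol y) = cost peak" "virial p 0 (translated_sol y) = 0"
    using radial_sol_functionals[of 0 0] by (simp_all add: sol_0 barrier_def)
qed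

lemma power_integral_ge:
  assumes c: "continuous_on UNIV f" and i: "integrable lborel (\<lambda>x. f x powr (p + 1))"
    and "f = (\<lambda>x. sol (x - y)) \<or> f = (\<lambda>x. sol (\<bar>x\<bar> - y))" "y \<ge> 0"
  shows "sol 1 powr (p + 1) \<le> (LINT x|lborel. f x powr (p + 1))"
proof -
  have sol1: "sol 1 \<le> sol t" if "0 \<le> t" "t \<le> 1" for t
    by (rule DERIV_nonpos_imp_nonincreasing[OF that(2)]) (meson that order_trans sol_deriv sol'_neg)
  have "(LINT x|lborel. sol 1 powr (p + 1) * indicator {y..y+1} x) \<le> (LINT x|lborel. f x powr (p + 1))"
  proof (rule integral_mono[OF _ i])
    show "integrable lborel (\<lambda>x. sol 1 powr (p + 1) * indicator {y..y+1} x)"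
      by (intro integrable_mult_right integrable_real_indicator) (auto simp: emeasure_lborel_Icc_eq)
    fix x
    show "sol 1 powr (p + 1) * indicator {y..y+1} x \<le> f x powr (p + 1)"
    proof (cases "x \<in> {y..y+1}")
      case True
      then have "f x = sol (x - y)" using assms(3,4) by auto
      then show ?thesis
        using True sol1[of "x - y"] sol_pos[of 1] p_gt_5 by (auto intro!: powr_mono2)
    qed simp
  qed
  then show ?thesis by simp
qed

lemma small_height:
  assumes "e > 0" shows "\<exists>y\<ge>0. - \<gamma> * (sol y)\<^sup>2 < e"
proof -
  have "((\<lambda>y. - \<gamma> * (sol y)\<^sup>2) \<longlongrightarrow> - \<gamma> * 0\<^sup>2) at_top"
    by (intro tendsto_intros sol_vanishes)
  then have "((\<lambda>y. - \<gamma> * (sol y)\<^sup>2) \<longlongrightarrow> 0) at_top" by simp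
  from order_tendstoD(2)[OF this assms] eventually_ge_at_top[of 0]
  have "\<forall>\<^sub>F y in at_top. - \<gamma> * (sol y)\<^sup>2 < e \<and> y \<ge> 0" by (rule eventually_conj)
  then show ?thesis using eventually_happens'[OF trivial_limit_at_top_linorder] by blast
qed

text \<open>As \<open>y \<rightarrow> \<infinity>\<close> the value at the origin tends to \<open>0\<close>, whereas the potential term stays above a fixed
positive number, namely its share on the unit interval to the right of the peak. This is the smallness that
\<open>scale_to_virial_0\<close> asks for.\<close>

lemma near_optimal:
  assumes f: "f = (\<lambda>y x. sol (x - y)) \<or> f = (\<lambda>y x. sol (\<bar>x\<bar> - y))" and "\<gamma> \<le> 0" "e > 0"
    and P0: "\<And>y. y \<ge> 0 \<Longrightarrow> virial p 0 (\<lambda>x. complex_of_real (f y x)) \<le> 0"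
    and P: "\<And>y. y \<ge> 0 \<Longrightarrow> virial p \<gamma> (\<lambda>x. complex_of_real (f y x)) \<ge> 0"
    and S: "\<And>y. y \<ge> 0 \<Longrightarrow> action p \<omega> 0 (\<lambda>x. complex_of_real (f y x)) \<le> s"
  shows "\<exists>y \<mu>. y \<ge> 0 \<and> \<mu> > 0 \<and> (dilation \<mu> (f y)) \<in> admissible H1 p \<gamma> \<and>
     action p \<omega> \<gamma> (dilation \<mu> (f y)) < s + e"
proof -
  define d where "d = (p - 1) / (2 * (p + 1)) * ((2 powr ((p - 1) / 2) - 4) * sol 1 powr (p + 1))"
  have "d > 0" unfolding d_def using p_gt_5 powr_2_gt_4 sol_pos[of 1] by simp
  then obtain y where y: "y \<ge> 0" "- \<gamma> * (sol y)\<^sup>2 < min d e" using small_height[of "min d e" \<gamma>] \<open>e > 0\<close> by auto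
  obtain f' where C1: "piecewise_C1 (f y) f'" using f translated_sol_C1[of y] radial_sol_C1[of y] by auto
  have f0: "f y 0 = sol y" using f sol_even[of y] by auto
  have pos: "f y x > 0" for x using f sol_pos by auto
  have i: "integrable lborel (\<lambda>x. f y x powr (p + 1))"
    using f shift_integrable(1,3)[OF sol_powr_integrable, of y] by auto
  have "sol 1 powr (p + 1) \<le> (LINT x|lborel. f y x powr (p + 1))"
    using f y(1) by (intro power_integral_ge[of "f y" y] i) (use C1 in \<open>auto simp: piecewise_C1_def\<close>)
  then have "sol 1 powr (p + 1) \<le> power_integral (p + 1) (\<lambda>x. complex_of_real (f y x))"
    unfolding power_integral_def using pos by (simp add: less_imp_le)
  then have "d \<le> (p - 1) / (2 * (p + 1)) * ((2 powr ((p - 1) / 2) - 4) * power_integral (p + 1) (\<lambda>x. complex_of_real (f y x)))"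
    unfolding d_def using p_gt_5 powr_2_gt_4 by (intro mult_left_mono) auto
  then have "\<exists>\<mu>>0. (dilation \<mu> (f y)) \<in> admissible H1 p \<gamma> \<and>
     action p \<omega> \<gamma> (dilation \<mu> (f y)) \<le> action p \<omega> 0 (\<lambda>x. complex_of_real (f y x)) - \<gamma> * (f y 0)\<^sup>2"
    using y f0 P0[OF y(1)] P[OF y(1)] pos[of 0]
    by (intro scale_to_virial_0[OF C1, of 0] \<open>\<gamma> \<le> 0\<close>) auto
  then obtain \<mu> where "\<mu> > 0" "(dilation \<mu> (f y)) \<in> admissible H1 p \<gamma>"
    "action p \<omega> \<gamma> (dilation \<mu> (f y)) \<le> action p \<omega> 0 (\<lambda>x. complex_of_real (f y x)) - \<gamma> * (f y 0)\<^sup>2"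
    by blast
  then show ?thesis using S[OF y(1)] y f0 by (intro exI[of _ y] exI[of _ \<mu>]) auto
qed

lemma near_optimal_n:
  assumes "\<gamma> \<le> 0" "e > 0"
  shows "\<exists>\<phi>\<in>admissible H1 p \<gamma>. action p \<omega> \<gamma> \<phi> < cost peak + e"
proof -
  have 0: "virial p 0 (\<lambda>x. complex_of_real (sol (x - y))) = 0" "action p \<omega> 0 (\<lambda>x. complex_of_real (sol (x - y))) = cost peak" for y
    using translated_sol_functionals[of y] unfolding translated_sol_def[abs_def] by auto
  have "virial p \<gamma> \<phi> = virial p 0 \<phi> - \<gamma> / 2 * (norm (\<phi> 0))\<^sup>2" for \<phi> by (simp add: virial_eq)
  then have "virial p \<gamma> (\<lambda>x. complex_of_real (sol (x - y))) \<ge> 0" for y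
    using 0(1)[of y] assms(1) by (simp add: mult_nonpos_nonneg)
  then show ?thesis
    using near_optimal[of "\<lambda>y x. sol (x - y)" \<gamma> e "cost peak"] assms 0 by fastforce
qed

lemma near_optimal_r:
  assumes "\<gamma> < 0" "\<omega> \<le> \<gamma>\<^sup>2 / 2" "e > 0"
  shows "\<exists>\<phi>\<in>admissible H1_rad p \<gamma>. action p \<omega> \<gamma> \<phi> < 2 * cost peak + e"
proof -
  have sq: "sqrt (2 * \<omega>) \<le> - \<gamma>"
  proof -
    have "sqrt (2 * \<omega>) \<le> sqrt (\<gamma>\<^sup>2)" using assms by (intro real_sqrt_le_mono) auto
    then show ?thesis using assms(1) by simp
  qed
  have sp: "speed (sol y) \<le> - \<gamma> * sol y" for y
  proof -
    have "speed (sol y) \<le> sqrt (2 * \<omega>) * sol y" using sol_pos[of y] by (intro speed_le) simp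
    also have "\<dots> \<le> - \<gamma> * sol y" using sq sol_pos[of y] by (intro mult_right_mono) auto
    finally show ?thesis .
  qed
  have "virial p 0 (radial_sol y) \<le> 0" "virial p \<gamma> (radial_sol y) \<ge> 0" "action p \<omega> 0 (radial_sol y) \<le> 2 * cost peak" if "y \<ge> 0" for y
  proof -
    show "virial p 0 (radial_sol y) \<le> 0"
      unfolding radial_sol_functionals(2)[OF that] using sol_pos[of y] speed_nonneg[of "sol y"] by (simp add: mult_nonneg_nonneg)
    show "virial p \<gamma> (radial_sol y) \<ge> 0"
      unfolding radial_sol_functionals(2)[OF that] using sol_pos[of y] sp[of y] by (intro mult_nonneg_nonneg) auto
    show "action p \<omega> 0 (radial_sol y) \<le> 2 * cost peak"
      unfolding radial_sol_functionals(1)[OF that] barrier_def using cost_nonneg[of "sol y"] sol_pos[of y] by simp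
  qed
  then obtain y \<mu> where y: "(\<lambda>x. complex_of_real (sqrt \<mu> * sol (\<bar>\<mu> * x\<bar> - y))) \<in> admissible H1 p \<gamma>"
     "action p \<omega> \<gamma> (\<lambda>x. complex_of_real (sqrt \<mu> * sol (\<bar>\<mu> * x\<bar> - y))) < 2 * cost peak + e"
    using near_optimal[of "\<lambda>y x. sol (\<bar>x\<bar> - y)" \<gamma> e "2 * cost peak"] assms unfolding radial_sol_def[abs_def] by fastforce
  moreover from y(1) have "(\<lambda>x. complex_of_real (sqrt \<mu> * sol (\<bar>\<mu> * x\<bar> - y))) \<in> admissible H1_rad p \<gamma>"
    by (simp add: admissible_def H1_rad_def)
  ultimately show ?thesis by blast
qed

end

section \<open>The equation on a half-line and across the origin\<close>

text \<open>Two \<open>C\<^sup>2\<close> functions glued continuously at the origin have the glued second derivative plus a Dirac mass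
weighted by the jump of the first derivative. The functions are given on all of \<open>\<real>\<close> so that they have
two-sided derivatives at the origin.\<close>

lemma glued_second_derivative:
  fixes f h f1 f1' h1 f2 f2' h2 :: "real \<Rightarrow> real"
  assumes f: "continuous_on UNIV f" and h: "continuous_on UNIV h"
    and f1: "\<And>x. x \<ge> 0 \<Longrightarrow> f x = f1 x" "\<And>x. x \<ge> 0 \<Longrightarrow> h x = h1 x"
    and f2: "\<And>x. x \<le> 0 \<Longrightarrow> f x = f2 x" "\<And>x. x \<le> 0 \<Longrightarrow> h x = h2 x"
    and d1: "\<And>x. (f1 has_real_derivative f1' x) (at x)" "\<And>x. (f1' has_real_derivative h1 x) (at x)"
    and d2: "\<And>x. (f2 has_real_derivative f2' x) (at x)" "\<And>x. (f2' has_real_derivative h2 x) (at x)"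
    and \<psi>: "test_fun \<psi>"
  shows "(LINT x|lborel. complex_of_real (f x) * vderiv (vderiv \<psi>) x)
    = (LINT x|lborel. complex_of_real (h x) * \<psi> x) + complex_of_real (f1' 0 - f2' 0) * \<psi> 0"
proof -
  obtain R1 where R1: "R1 > 0" "\<And>x. \<bar>x\<bar> \<ge> R1 \<Longrightarrow> \<psi> x = 0" "\<And>x. \<bar>x\<bar> \<ge> R1 \<Longrightarrow> vderiv \<psi> x = 0"
    by (rule test_fun_support[OF \<psi>]) auto
  obtain R2 where R2: "R2 > 0" "\<And>x. \<bar>x\<bar> \<ge> R2 \<Longrightarrow> vderiv (vderiv \<psi>) x = 0"
    by (rule test_fun_support[OF test_fun_vderiv[OF \<psi>]]) auto
  define R where "R = R1 + R2"
  have R: "R > 0" "\<And>x. \<bar>x\<bar> \<ge> R \<Longrightarrow> \<psi> x = 0" "\<And>x. \<bar>x\<bar> \<ge> R \<Longrightarrow> vderiv \<psi> x = 0"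
    "\<And>x. \<bar>x\<bar> \<ge> R \<Longrightarrow> vderiv (vderiv \<psi>) x = 0"
    using R1 R2 by (auto simp: R_def)
  let ?I = "\<lambda>x. complex_of_real (f x) * vderiv (vderiv \<psi>) x - complex_of_real (h x) * \<psi> x"
  have FTC: "((\<lambda>x. complex_of_real (g x) * vderiv (vderiv \<psi>) x - complex_of_real (k x) * \<psi> x) has_integral
      (complex_of_real (g b) * vderiv \<psi> b - complex_of_real (g' b) * \<psi> b)
      - (complex_of_real (g a) * vderiv \<psi> a - complex_of_real (g' a) * \<psi> a)) {a..b}"
    if "a \<le> b" and g: "\<And>x. (g has_real_derivative g' x) (at x)" "\<And>x. (g' has_real_derivative k x) (at x)"
    for a b g g' k
  proof (rule fundamental_theorem_of_calculus[OF that(1)])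
    fix x assume "x \<in> {a..b}"
    have "((\<lambda>x. complex_of_real (g x) * vderiv \<psi> x - complex_of_real (g' x) * \<psi> x) has_vector_derivative
       (complex_of_real (g x) * vderiv (vderiv \<psi>) x + complex_of_real (g' x) * vderiv \<psi> x)
       - (complex_of_real (g' x) * vderiv \<psi> x + complex_of_real (k x) * \<psi> x)) (at x)"
      by (intro has_vector_derivative_diff has_vector_derivative_mult has_vector_derivative_of_real g
            test_fun_deriv \<psi> test_fun_vderiv)
    then show "((\<lambda>x. complex_of_real (g x) * vderiv \<psi> x - complex_of_real (g' x) * \<psi> x) has_vector_derivative
       complex_of_real (g x) * vderiv (vderiv \<psi>) x - complex_of_real (k x) * \<psi> x) (at x within {a..b})"
      by (simp add: has_vector_derivative_at_within)
  qed
  have "((\<lambda>x. complex_of_real (f1 x) * vderiv (vderiv \<psi>) x - complex_of_real (h1 x) * \<psi> x) has_integral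
     (0 - (complex_of_real (f1 0) * vderiv \<psi> 0 - complex_of_real (f1' 0) * \<psi> 0))) {0..R}"
    using FTC[of 0 R f1 f1' h1] d1 R by simp
  then have r: "(?I has_integral (0 - (complex_of_real (f1 0) * vderiv \<psi> 0 - complex_of_real (f1' 0) * \<psi> 0))) {0..R}"
    by (rule has_integral_eq[rotated]) (simp add: f1)
  have "((\<lambda>x. complex_of_real (f2 x) * vderiv (vderiv \<psi>) x - complex_of_real (h2 x) * \<psi> x) has_integral
     ((complex_of_real (f2 0) * vderiv \<psi> 0 - complex_of_real (f2' 0) * \<psi> 0) - 0)) {-R..0}"
    using FTC[of "-R" 0 f2 f2' h2] d2 R by simp
  then have l: "(?I has_integral ((complex_of_real (f2 0) * vderiv \<psi> 0 - complex_of_real (f2' 0) * \<psi> 0) - 0)) {-R..0}"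
    by (rule has_integral_eq[rotated]) (simp add: f2)
  have "(?I has_integral (((complex_of_real (f2 0) * vderiv \<psi> 0 - complex_of_real (f2' 0) * \<psi> 0) - 0)
      + (0 - (complex_of_real (f1 0) * vderiv \<psi> 0 - complex_of_real (f1' 0) * \<psi> 0)))) {-R..R}"
    by (rule has_integral_combine[OF _ _ l r]) (use R in auto)
  moreover have "f1 0 = f2 0" using f1(1)[of 0] f2(1)[of 0] by simp
  ultimately have I: "(?I has_integral complex_of_real (f1' 0 - f2' 0) * \<psi> 0) {-R..R}"
    by (simp add: algebra_simps)
  have i1: "integrable lborel (\<lambda>x. complex_of_real (f x) * vderiv (vderiv \<psi>) x)"
    by (intro locally_integrable_mult_test continuous_locally_integrable test_fun_vderiv \<psi> continuous_intros f)
  have i2: "integrable lborel (\<lambda>x. complex_of_real (h x) * \<psi> x)"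
    by (intro locally_integrable_mult_test continuous_locally_integrable \<psi> continuous_intros h)
  have "(LINT x|lborel. ?I x) = complex_of_real (f1' 0 - f2' 0) * \<psi> 0"
  proof (rule LINT_eq_if_supported[OF Bochner_Integration.integrable_diff[OF i1 i2] I])
    fix x assume "x \<notin> {-R..R}"
    then have "\<bar>x\<bar> \<ge> R" by auto
    then show "?I x = 0" using R by simp
  qed
  from trans[OF Bochner_Integration.integral_diff[OF i1 i2, symmetric] this]
  show ?thesis by (simp only: diff_eq_eq add.commute)
qed

lemma global_antiderivative:
  fixes f :: "real \<Rightarrow> 'a :: euclidean_space"
  assumes "continuous_on UNIV f"
  obtains F where "\<And>x. (F has_vector_derivative f x) (at x)" "F a = 0"
proof -
  have "isCont f x" for x using assms by (simp add: continuous_on_eq_continuous_at)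
  then obtain F where F: "\<And>x. (F has_vector_derivative f x) (at x)"
    using einterval_antiderivative[of "-\<infinity>" "\<infinity>" f] by auto
  have "((\<lambda>x. F x - F a) has_vector_derivative f x) (at x)" for x
  proof -
    have "((\<lambda>x. F x - F a) has_vector_derivative f x - 0) (at x)"
      by (intro has_vector_derivative_diff F has_vector_derivative_const)
    then show ?thesis by simp
  qed
  then show thesis using that[of "\<lambda>x. F x - F a"] by simp
qed

lemma test_fun_bump: "test_fun (\<lambda>x. complex_of_real (bump x))"
  unfolding test_fun_iff
proof (intro conjI exI[of _ 1] allI impI)
  show "smooth (\<lambda>x. complex_of_real (bump x))" by (rule smooth_bump)
  show "\<bar>x\<bar> \<le> 1" if "complex_of_real (bump x) \<noteq> 0" for x
    using that bump_eq_0[of x] by force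
qed simp

lemma test_fun_mean_0_antiderivative:
  assumes \<theta>: "test_fun \<theta>" and mean: "(LINT x|lborel. \<theta> x) = 0"
  obtains \<zeta> where "test_fun \<zeta>" "\<And>x. (\<zeta> has_vector_derivative \<theta> x) (at x)"
proof -
  obtain R where R: "R > 0" "\<And>x. \<bar>x\<bar> \<ge> R \<Longrightarrow> \<theta> x = 0"
    by (rule test_fun_support[OF \<theta>]) auto
  have s: "smooth \<theta>" using \<theta> by (simp add: test_fun_iff)
  \<comment> \<open>The primitive starting at the left end of the support; the zero mean makes it vanish on the right as well.\<close>
  obtain \<zeta> where \<zeta>: "\<And>x. (\<zeta> has_vector_derivative \<theta> x) (at x)" "\<zeta> (- R) = 0"
    using global_antiderivative[OF smooth_continuous[OF s]] by metis
  have int: "(\<theta> has_integral \<zeta> b - \<zeta> a) {a..b}" if "a \<le> b" for a b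
    by (rule fundamental_theorem_of_calculus[OF that]) (simp add: \<zeta> has_vector_derivative_at_within)
  have i: "integrable lborel \<theta>"
    using locally_integrable_mult_test[OF continuous_locally_integrable \<theta>, of "\<lambda>_. 1"] by simp
  have "\<zeta> x = 0" if "\<bar>x\<bar> > R" for x
  proof (cases "x > R")
    case True
    have "(LINT x|lborel. \<theta> x) = \<zeta> x - \<zeta> (- R)"
    proof (rule LINT_eq_if_supported[OF i int])
      fix t assume "t \<notin> {-R..x}"
      then show "\<theta> t = 0" using True R(1) by (intro R(2)) auto
    qed (use True R(1) in auto)
    then show ?thesis using mean \<zeta>(2) by simp
  next
    case False
    then have "x \<le> - R" using that by auto
    have "(\<theta> has_integral 0) {x..-R}"
      using R(1) by (intro has_integral_is_0 R(2)) auto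
    from has_integral_unique[OF this int[OF \<open>x \<le> - R\<close>]] show ?thesis using \<zeta>(2) by simp
  qed
  then have "test_fun \<zeta>"
    unfolding test_fun_iff using smooth_antiderivative[OF \<zeta>(1) s] R(1) by (meson not_le)
  then show thesis using that \<zeta>(1) by blast
qed

text \<open>Subtracting a multiple of \<open>bump\<close> turns a test function into one of mean \<open>0\<close>, hence into the derivative of a
test function. Consequently \<open>F\<close> has a constant weak derivative.\<close>

lemma affine_if_second_derivative_0:
  assumes F: "continuous_on UNIV F"
    and 0: "\<And>\<psi>. test_fun \<psi> \<Longrightarrow> (LINT x|lborel. F x * vderiv (vderiv \<psi>) x) = 0"
  shows "\<exists>c. \<forall>x. F x = F 0 + c * complex_of_real x"
proof -
  let ?\<chi> = "\<lambda>x. complex_of_real (bump x)"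
  define c where "c = - (LINT x|lborel. F x * vderiv ?\<chi> x)"
  have weak: "(LINT x|lborel. F x * vderiv \<psi> x) = - (LINT x|lborel. c * \<psi> x)" if \<psi>: "test_fun \<psi>" for \<psi>
  proof -
    define I where "I = (LINT x|lborel. \<psi> x)"
    define \<theta> where "\<theta> x = \<psi> x + (- I) * ?\<chi> x" for x
    have i\<psi>: "integrable lborel \<psi>"
      using locally_integrable_mult_test[OF continuous_locally_integrable \<psi>, of "\<lambda>_. 1"] by simp
    have i\<chi>: "integrable lborel (\<lambda>x. (- I) * ?\<chi> x)" using integrable_bump by simp
    have \<theta>: "test_fun \<theta>"
    proof -
      obtain R1 where R1: "R1 > 0" "\<And>x. \<bar>x\<bar> \<ge> R1 \<Longrightarrow> \<psi> x = 0"
        by (rule test_fun_support[OF \<psi>]) auto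
      have "smooth \<theta>" unfolding \<theta>_def[abs_def] using \<psi>
        by (intro smooth_add smooth_mult smooth_const smooth_bump) (simp add: test_fun_iff)
      moreover have "\<theta> x \<noteq> 0 \<longrightarrow> \<bar>x\<bar> \<le> R1 + 1" for x
        using R1(2)[of x] bump_eq_0[of x] R1(1) unfolding \<theta>_def by fastforce
      ultimately show ?thesis unfolding test_fun_iff using R1(1) by (intro conjI exI[of _ "R1 + 1"]) auto
    qed
    have "(LINT x|lborel. \<theta> x) = I + (- I) * (LINT x|lborel. ?\<chi> x)"
      unfolding \<theta>_def using Bochner_Integration.integral_add[OF i\<psi> i\<chi>] by (simp add: I_def)
    also have "(LINT x|lborel. ?\<chi> x) = 1" using LINT_bump by simp
    finally have "(LINT x|lborel. \<theta> x) = 0" by simp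
    then obtain \<zeta> where \<zeta>: "test_fun \<zeta>" "\<And>x. (\<zeta> has_vector_derivative \<theta> x) (at x)"
      using test_fun_mean_0_antiderivative[OF \<theta>] by blast
    have d1: "vderiv \<zeta> = \<theta>" by (rule vderiv_eqI[OF \<zeta>(2)])
    have d2: "vderiv \<theta> x = vderiv \<psi> x + (- I) * vderiv ?\<chi> x" for x
    proof (rule vector_derivative_at)
      show "(\<theta> has_vector_derivative vderiv \<psi> x + (- I) * vderiv ?\<chi> x) (at x)"
        unfolding \<theta>_def[abs_def]
        by (intro has_vector_derivative_add has_vector_derivative_mult_right test_fun_deriv \<psi> test_fun_bump)
    qed
    have eq: "F x * vderiv (vderiv \<zeta>) x = F x * vderiv \<psi> x + (- I) * (F x * vderiv ?\<chi> x)" for x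
      unfolding d1 d2 by (simp add: algebra_simps)
    have j1: "integrable lborel (\<lambda>x. F x * vderiv \<psi> x)"
      by (intro locally_integrable_mult_test continuous_locally_integrable test_fun_vderiv \<psi> F)
    have j2: "integrable lborel (\<lambda>x. F x * vderiv ?\<chi> x)"
      by (intro locally_integrable_mult_test continuous_locally_integrable test_fun_vderiv test_fun_bump F)
    have "0 = (LINT x|lborel. F x * vderiv \<psi> x + (- I) * (F x * vderiv ?\<chi> x))"
      using 0[OF \<zeta>(1)] unfolding eq by simp
    also have "\<dots> = (LINT x|lborel. F x * vderiv \<psi> x) + (LINT x|lborel. (- I) * (F x * vderiv ?\<chi> x))"
      using j2 by (intro Bochner_Integration.integral_add j1 integrable_mult_right) auto
    also have "(LINT x|lborel. (- I) * (F x * vderiv ?\<chi> x)) = I * c"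
      unfolding integral_mult_right_zero c_def by simp
    finally show ?thesis by (simp add: I_def eq_neg_iff_add_eq_0 mult.commute)
  qed
  have FTC: "F y - F x = c * complex_of_real (y - x)" if "x \<le> y" for x y
  proof -
    have "F y - F x = (LINT t:{x..y}|lborel. c)"
      by (rule weak_derivative_FTC[OF F _ weak that]) (auto intro: continuous_locally_integrable)
    also have "\<dots> = c * complex_of_real (y - x)"
      using that by (simp add: set_lebesgue_integral_def scaleR_conv_of_real mult.commute)
    finally show ?thesis .
  qed
  have "F x = F 0 + c * complex_of_real x" for x
    using FTC[of 0 x] FTC[of x 0] by (cases "x \<ge> 0") (auto simp: algebra_simps)
  then show ?thesis by blast
qed

lemma const_on_halfline:
  fixes f :: "real \<Rightarrow> real"
  assumes "\<And>x. x \<ge> 0 \<Longrightarrow> (f has_real_derivative 0) (at x)" "x \<ge> 0"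
  shows "f x = f 0"
proof (cases "x = 0")
  case False
  then have "0 < x" using assms(2) by simp
  then show ?thesis
    by (intro DERIV_isconst_end) (auto intro!: continuous_at_imp_continuous_on DERIV_isCont[OF assms(1)] assms(1))
qed simp

context nls
begin

definition halfline_solution :: "(real \<Rightarrow> real) \<Rightarrow> (real \<Rightarrow> real) \<Rightarrow> bool" where
  "halfline_solution u u' \<longleftrightarrow> (\<forall>x\<ge>0. u x > 0 \<and> (u has_real_derivative u' x) (at x) \<and>
     (u' has_real_derivative 2 * \<omega> * u x - 2 * u x powr p) (at x)) \<and> (u \<longlongrightarrow> 0) at_top"

lemma W_deriv:
  assumes "s > 0" shows "(W has_real_derivative 2 * (2 * \<omega> * s - 2 * s powr p)) (at s)"
proof -
  have "((\<lambda>s. 2 * \<omega> * s\<^sup>2 - 4 / (p + 1) * s powr (p + 1)) has_real_derivative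
     2 * \<omega> * (2 * s) - 4 / (p + 1) * ((p + 1) * s powr p)) (at s)"
    using assms by (auto intro!: derivative_eq_intros)
  also have "2 * \<omega> * (2 * s) - 4 / (p + 1) * ((p + 1) * s powr p) = 2 * (2 * \<omega> * s - 2 * s powr p)"
  proof -
    have "4 / (p + 1) * ((p + 1) * s powr p) = 4 * s powr p" using p_gt_5 by simp
    then show ?thesis by (simp add: algebra_simps)
  qed
  finally show ?thesis
    by (rule has_field_derivative_transform_within_open[where S="{0<..}"]) (use assms in \<open>auto simp: W_def\<close>)
qed

text \<open>The quantity \<open>u'\<^sup>2 - W u\<close> is conserved. It vanishes since \<open>u \<rightarrow> 0\<close> and, by the mean value theorem on
\<open>[n, n + 1]\<close>, \<open>u'\<close> tends to \<open>0\<close> along a sequence.\<close>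

lemma halfline_first_integral:
  assumes u: "halfline_solution u u'" and "x \<ge> 0"
  shows "(u' x)\<^sup>2 = W (u x)"
proof -
  have pos: "u x > 0" and d: "(u has_real_derivative u' x) (at x)"
    "(u' has_real_derivative 2 * \<omega> * u x - 2 * u x powr p) (at x)" if "x \<ge> 0" for x
    using u that unfolding halfline_solution_def by auto
  have lim: "(u \<longlongrightarrow> 0) at_top" using u unfolding halfline_solution_def by auto
  define E where "E x = (u' x)\<^sup>2 - W (u x)" for x
  have "(E has_real_derivative 0) (at x)" if "x \<ge> 0" for x
  proof -
    have "((\<lambda>x. W (u x)) has_real_derivative 2 * (2 * \<omega> * u x - 2 * u x powr p) * u' x) (at x)"
      by (rule DERIV_chain2[where f=W and g=u, OF W_deriv[OF pos[OF that]] d(1)[OF that]])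
    from DERIV_diff[OF DERIV_power[OF d(2)[OF that], of 2] this]
    show ?thesis unfolding E_def[abs_def] by (simp add: algebra_simps)
  qed
  then have const: "E x = E 0" if "x \<ge> 0" for x using const_on_halfline that by blast
  have "\<exists>z. real n < z \<and> z < real n + 1 \<and> u (real n + 1) - u (real n) = u' z" for n
    using MVT2[of "real n" "real n + 1" u u'] d(1) by force
  then obtain z where z: "\<And>n. real n < z n" "\<And>n. u (real n + 1) - u (real n) = u' (z n)"
    by metis
  have zt: "filterlim z at_top sequentially"
    by (rule filterlim_at_top_mono[OF filterlim_real_sequentially]) (auto intro!: always_eventually less_imp_le z)
  have "filterlim (\<lambda>n. real n + 1) at_top sequentially"
    by (rule filterlim_at_top_mono[OF filterlim_real_sequentially]) auto
  then have "(\<lambda>n. u (real n + 1) - u (real n)) \<longlonglongrightarrow> 0 - 0"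
    by (intro tendsto_diff filterlim_compose[OF lim] filterlim_real_sequentially)
  then have 1: "(\<lambda>n. u' (z n)) \<longlonglongrightarrow> 0" by (simp add: z(2))
  have 2: "(\<lambda>n. W (u (z n))) \<longlonglongrightarrow> W 0"
    by (rule isCont_tendsto_compose[OF _ filterlim_compose[OF lim zt]])
       (use continuous_W[of UNIV] in \<open>simp add: continuous_on_eq_continuous_at\<close>)
  have "(\<lambda>n. E (z n)) \<longlonglongrightarrow> 0\<^sup>2 - W 0"
    unfolding E_def by (intro tendsto_intros 1 2)
  moreover have "E (z n) = E 0" for n
    using z(1)[of n] by (intro const) (meson le_less_trans less_imp_le of_nat_0_le_iff)
  ultimately have "(\<lambda>n. E 0) \<longlonglongrightarrow> 0" by (simp add: W_def)
  then have "E 0 = 0" by (simp add: LIMSEQ_const_iff)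
  then show ?thesis using const[OF assms(2)] by (simp add: E_def)
qed

text \<open>With \<open>k = (p - 1) / 2\<close>, the terms \<open>u\<^sup>k\<close> produced by the nonlinearity cancel against those of the first
integral, and \<open>(u\<^sup>-\<^sup>k)'' = \<beta>\<^sup>2 u\<^sup>-\<^sup>k\<close> remains.\<close>

lemma halfline_linearised:
  assumes u: "halfline_solution u u'" and "x \<ge> 0"
  shows "((\<lambda>x. u x powr (- (p - 1) / 2)) has_real_derivative
      - (p - 1) / 2 * u x powr (- (p - 1) / 2 - 1) * u' x) (at x)"
    and "((\<lambda>x. - (p - 1) / 2 * u x powr (- (p - 1) / 2 - 1) * u' x) has_real_derivative
      \<beta>\<^sup>2 * u x powr (- (p - 1) / 2)) (at x)"
proof -
  define k where "k = (p - 1) / 2"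
  have p: "p = 2 * k + 1" and k: "k > 2" using p_gt_5 by (auto simp: k_def field_simps)
  have pos: "u x > 0" and d: "(u has_real_derivative u' x) (at x)"
    "(u' has_real_derivative 2 * \<omega> * u x - 2 * u x powr p) (at x)"
    using u assms(2) unfolding halfline_solution_def by auto
  have km: "- (p - 1) / 2 = - k" unfolding k_def by (simp only: minus_divide_left)
  have *: "((\<lambda>x. u x powr r) has_real_derivative r * u x powr (r - 1) * u' x) (at x)" for r
    using DERIV_fun_powr[OF d(1) pos, of r] by simp
  show "((\<lambda>x. u x powr (- (p - 1) / 2)) has_real_derivative
      - (p - 1) / 2 * u x powr (- (p - 1) / 2 - 1) * u' x) (at x)"
    by (rule *)
  have "((\<lambda>x. - k * u x powr (- k - 1) * u' x) has_real_derivative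
      - k * ((- k - 1) * u x powr (- k - 1 - 1) * u' x) * u' x + (2 * \<omega> * u x - 2 * u x powr p) * (- k * u x powr (- k - 1))) (at x)"
    by (rule DERIV_mult[OF DERIV_cmult[OF *] d(2)])
  also have "- k * ((- k - 1) * u x powr (- k - 1 - 1) * u' x) * u' x + (2 * \<omega> * u x - 2 * u x powr p) * (- k * u x powr (- k - 1))
     = k * (k + 1) * u x powr (- k - 2) * (u' x)\<^sup>2 - 2 * \<omega> * k * (u x * u x powr (- k - 1)) + 2 * k * (u x powr p * u x powr (- k - 1))"
    by (simp add: algebra_simps power2_eq_square)
  also have "u x * u x powr (- k - 1) = u x powr (- k)"
    using pos by (simp add: powr_diff)
  also have "u x powr p * u x powr (- k - 1) = u x powr k"
    unfolding powr_add[symmetric] p by simp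
  also have "(u' x)\<^sup>2 = 2 * \<omega> * u x powr 2 - 4 / (p + 1) * u x powr (2 * k + 2)"
  proof -
    have p1: "p + 1 = 2 * k + 2" by (simp add: p)
    show ?thesis unfolding halfline_first_integral[OF assms] W_def p1 using pos by simp
  qed
  also have "k * (k + 1) * u x powr (- k - 2) * (2 * \<omega> * u x powr 2 - 4 / (p + 1) * u x powr (2 * k + 2))
     = k * (k + 1) * (2 * \<omega>) * (u x powr (- k - 2) * u x powr 2) - k * (k + 1) * (4 / (p + 1)) * (u x powr (- k - 2) * u x powr (2 * k + 2))"
    by (simp only: right_diff_distrib mult_ac)
  also have "u x powr (- k - 2) * u x powr 2 = u x powr (- k)" unfolding powr_add[symmetric] by simp
  also have "u x powr (- k - 2) * u x powr (2 * k + 2) = u x powr k" unfolding powr_add[symmetric] by simp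
  also have "k * (k + 1) * (4 / (p + 1)) = 2 * k" using k by (simp add: p field_simps)
  also have "k * (k + 1) * (2 * \<omega>) * u x powr - k - 2 * k * u x powr k - 2 * \<omega> * k * u x powr - k + 2 * k * u x powr k
     = \<beta>\<^sup>2 * u x powr (- k)"
  proof -
    have "\<beta>\<^sup>2 = 2 * \<omega> * k\<^sup>2"
      using \<omega>_pos by (simp add: \<beta>_def k_def power_mult_distrib power_divide)
    then show ?thesis by (simp add: algebra_simps power2_eq_square)
  qed
  finally show "((\<lambda>x. - (p - 1) / 2 * u x powr (- (p - 1) / 2 - 1) * u' x) has_real_derivative
      \<beta>\<^sup>2 * u x powr (- (p - 1) / 2)) (at x)"
    unfolding km minus_divide_left[symmetric] k_def[symmetric] .
qed

text \<open>Factorise \<open>d'' - b\<^sup>2 d = (D - b) (D + b) d\<close> and integrate the two first-order equations in turn.\<close>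

lemma linear_ode_unique:
  fixes d d' :: "real \<Rightarrow> real"
  assumes d: "\<And>x. x \<ge> 0 \<Longrightarrow> (d has_real_derivative d' x) (at x)"
    "\<And>x. x \<ge> 0 \<Longrightarrow> (d' has_real_derivative b\<^sup>2 * d x) (at x)"
    and "d 0 = 0" "d' 0 = 0" "x \<ge> 0"
  shows "d x = 0"
proof -
  have z: "d' x = - b * d x" if "x \<ge> 0" for x
  proof -
    have "((\<lambda>x. (d' x + b * d x) * exp (- b * x)) has_real_derivative 0) (at x)" if "x \<ge> 0" for x
      by (rule derivative_eq_intros d that refl)+ (simp add: algebra_simps power2_eq_square)
    from const_on_halfline[OF this \<open>x \<ge> 0\<close>] show ?thesis using assms by simp
  qed
  have "((\<lambda>x. d x * exp (b * x)) has_real_derivative 0) (at x)" if "x \<ge> 0" for x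
    by (rule derivative_eq_intros d that refl)+ (simp add: z[OF that] algebra_simps)
  from const_on_halfline[OF this \<open>x \<ge> 0\<close>] show ?thesis using assms by simp
qed

lemma halfline_unique:
  assumes u: "halfline_solution u u'" and s: "halfline_solution s s'"
    and "u 0 = s 0" "u' 0 = s' 0" "x \<ge> 0"
  shows "u x = s x"
proof -
  have "u x powr (- (p - 1) / 2) - s x powr (- (p - 1) / 2) = 0"
  proof (rule linear_ode_unique[OF _ _ _ _ \<open>x \<ge> 0\<close>])
    fix x :: real assume "x \<ge> 0"
    show "((\<lambda>x. u x powr (- (p - 1) / 2) - s x powr (- (p - 1) / 2)) has_real_derivative
       - (p - 1) / 2 * u x powr (- (p - 1) / 2 - 1) * u' x - - (p - 1) / 2 * s x powr (- (p - 1) / 2 - 1) * s' x) (at x)"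
      by (intro DERIV_diff halfline_linearised u s \<open>x \<ge> 0\<close>)
    show "((\<lambda>x. - (p - 1) / 2 * u x powr (- (p - 1) / 2 - 1) * u' x - - (p - 1) / 2 * s x powr (- (p - 1) / 2 - 1) * s' x)
       has_real_derivative \<beta>\<^sup>2 * (u x powr (- (p - 1) / 2) - s x powr (- (p - 1) / 2))) (at x)"
      unfolding right_diff_distrib by (intro DERIV_diff halfline_linearised u s \<open>x \<ge> 0\<close>)
  qed (use assms in auto)
  then have "(u x powr (- (p - 1) / 2)) powr (- 2 / (p - 1)) = (s x powr (- (p - 1) / 2)) powr (- 2 / (p - 1))" by simp
  moreover have "(u x) > 0" "s x > 0" using u s \<open>x \<ge> 0\<close> unfolding halfline_solution_def by auto
  moreover have "- (p - 1) / 2 * (- 2 / (p - 1)) = 1" using p_gt_5 by (simp add: divide_simps)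
  ultimately show ?thesis unfolding powr_powr by simp
qed

lemma halfline_sol: "halfline_solution (\<lambda>x. sol (x - y)) (\<lambda>x. sol' (x - y))"
  unfolding halfline_solution_def using sol_pos sol_shift_deriv sol'_shift_deriv sol_shift_vanishes by auto

end

section \<open>The infima and the profile with a delta interaction\<close>

lemma tanh_artanh_real:
  fixes x :: real
  assumes "\<bar>x\<bar> < 1" shows "tanh (artanh x) = x"
proof -
  have x: "1 + x > 0" "1 - x > 0" using assms by auto
  then have e: "exp (- 2 * artanh x) = (1 - x) / (1 + x)"
    by (simp add: artanh_def exp_minus)
  show ?thesis unfolding tanh_real_altdef e using x by (simp add: field_simps)
qed

lemma Inf_eq_if_near_optimal:
  fixes f :: "'a \<Rightarrow> real"
  assumes "\<And>x. x \<in> A \<Longrightarrow> L \<le> f x" "\<And>e. e > 0 \<Longrightarrow> \<exists>x\<in>A. f x < L + e"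
  shows "Inf (f ` A) = L"
proof (rule cInf_eq)
  fix y assume y: "\<And>x. x \<in> f ` A \<Longrightarrow> y \<le> x"
  show "y \<le> L"
  proof (rule field_le_epsilon)
    fix e :: real assume "e > 0"
    then obtain x where "x \<in> A" "f x < L + e" using assms(2) by blast
    then show "y \<le> L + e" using y[of "f x"] by auto
  qed
qed (use assms(1) in auto)

context nls
begin

text \<open>With this offset \<open>\<beta> (\<bar>x\<bar> - delta_shift \<gamma>)\<close> is the argument of \<open>cosh\<close> in the profile; for \<open>\<gamma> < 0\<close> and \<open>\<omega> > \<gamma>\<^sup>2 / 2\<close> it is positive, and the
profile has two humps.\<close>

definition delta_shift :: "real \<Rightarrow> real" where
  "delta_shift \<gamma> = - artanh (\<gamma> / sqrt (2 * \<omega>)) / \<beta>"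

lemma Q_prof_eq: "Q_prof p \<omega> \<gamma> = radial_sol (delta_shift \<gamma>)"
proof
  fix x
  have "(p - 1) * sqrt \<omega> / sqrt 2 * \<bar>x\<bar> + artanh (\<gamma> / sqrt (2 * \<omega>)) = \<beta> * (\<bar>x\<bar> - delta_shift \<gamma>)"
    unfolding \<beta>_def[symmetric] delta_shift_def using \<beta>_pos by (simp add: field_simps)
  then show "Q_prof p \<omega> \<gamma> x = radial_sol (delta_shift \<gamma>) x" unfolding Q_prof_def radial_sol_def sol_def by simp
qed

lemma delta_shift_properties:
  assumes "\<gamma> < 0" "\<omega> > \<gamma>\<^sup>2 / 2"
  shows "delta_shift \<gamma> \<ge> 0" "sol (delta_shift \<gamma>) = delta_height \<gamma>" "speed (sol (delta_shift \<gamma>)) = - \<gamma> * sol (delta_shift \<gamma>)"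
proof -
  have s: "sqrt (2 * \<omega>) > 0" using \<omega>_pos by simp
  have "\<bar>\<gamma>\<bar> < sqrt (2 * \<omega>)"
    using assms(2) by (intro real_less_rsqrt) simp
  then have 1: "\<bar>\<gamma> / sqrt (2 * \<omega>)\<bar> < 1" using s by (simp add: abs_divide)
  have "\<beta> * delta_shift \<gamma> = - artanh (\<gamma> / sqrt (2 * \<omega>))" using \<beta>_pos by (simp add: delta_shift_def)
  then have t: "tanh (\<beta> * delta_shift \<gamma>) = - (\<gamma> / sqrt (2 * \<omega>))" using tanh_artanh_real[OF 1] by simp
  have "tanh (\<beta> * delta_shift \<gamma>) > 0" unfolding t using assms(1) s by (simp add: divide_neg_pos)
  then show "delta_shift \<gamma> \<ge> 0" using \<beta>_pos by (simp add: zero_less_mult_iff)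
  have "sol (delta_shift \<gamma>) powr (p - 1) = (p + 1) * \<omega> / 2 * (1 - \<gamma>\<^sup>2 / (2 * \<omega>))"
    unfolding sol_powr t using \<omega>_pos by (simp add: power_divide)
  also have "\<dots> = (p + 1) * (2 * \<omega> - \<gamma>\<^sup>2) / 4" using \<omega>_pos by (simp add: field_simps)
  finally have "sol (delta_shift \<gamma>) powr (p - 1) = (p + 1) * (2 * \<omega> - \<gamma>\<^sup>2) / 4" .
  then have "(sol (delta_shift \<gamma>) powr (p - 1)) powr (1 / (p - 1)) = delta_height \<gamma>"
    unfolding delta_height_def by (rule arg_cong)
  then show h: "sol (delta_shift \<gamma>) = delta_height \<gamma>"
    using p_gt_5 sol_pos[of "delta_shift \<gamma>"] by (simp add: powr_powr)
  show "speed (sol (delta_shift \<gamma>)) = - \<gamma> * sol (delta_shift \<gamma>)"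
    unfolding h by (rule speed_vs_slope(3)[OF assms zero_less_one])
qed

lemma radial_sol_admissible: "virial p \<gamma> (radial_sol y) = 0 \<Longrightarrow> radial_sol y \<in> admissible H1_rad p \<gamma>"
proof -
  assume "virial p \<gamma> (radial_sol y) = 0"
  moreover have "radial_sol y \<in> H1"
    using piecewise_C1_H1(1)[OF radial_sol_C1[of y]] unfolding radial_sol_def[abs_def] .
  moreover have "radial_sol y 0 \<noteq> 0" using sol_pos[of "- y"] by (simp add: radial_sol_def)
  then have "radial_sol y \<noteq> (\<lambda>x. 0)" by metis
  moreover have "radial_sol y x = radial_sol y (- x)" for x by (simp add: radial_sol_def)
  ultimately show ?thesis by (simp add: admissible_def H1_rad_def)
qed

lemma Q_prof_optimal:
  assumes "\<gamma> < 0" "\<omega> > \<gamma>\<^sup>2 / 2"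
  shows "Q_prof p \<omega> \<gamma> \<in> admissible H1_rad p \<gamma>"
    "action p \<omega> \<gamma> (Q_prof p \<omega> \<gamma>) = barrier \<gamma> (delta_height \<gamma>)"
  unfolding Q_prof_eq using radial_sol_functionals[OF delta_shift_properties(1)[OF assms], of \<gamma>] delta_shift_properties[OF assms]
  by (auto intro: radial_sol_admissible)

lemma l_inf_eq: "l_inf p \<omega> = cost peak"
  unfolding l_inf_def
  by (rule Inf_eq_if_near_optimal) (use action_ge_cost(1) near_optimal_n in auto)

lemma n_inf_eq: "\<gamma> < 0 \<Longrightarrow> n_inf p \<omega> \<gamma> = cost peak"
  unfolding n_inf_def
  by (rule Inf_eq_if_near_optimal) (use action_ge_cost(1) near_optimal_n in auto)

lemma barrier_le_radial_action:
  assumes "\<gamma> < 0" "\<omega> > \<gamma>\<^sup>2 / 2" "\<phi> \<in> admissible H1_rad p \<gamma>"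
  shows "barrier \<gamma> (delta_height \<gamma>) \<le> action p \<omega> \<gamma> \<phi>"
proof -
  obtain a where "0 \<le> a" "barrier \<gamma> a \<le> action p \<omega> \<gamma> \<phi>"
    using radial_action_ge_barrier[OF assms(3)] assms(1) by auto
  then show ?thesis
    using barrier_min_at_delta_height[OF assms(1,2), of a] by (cases "a = delta_height \<gamma>") auto
qed

lemma r_inf_eq_high:
  assumes "\<gamma> < 0" "\<omega> > \<gamma>\<^sup>2 / 2"
  shows "r_inf p \<omega> \<gamma> = barrier \<gamma> (delta_height \<gamma>)"
  unfolding r_inf_def
proof (rule cInf_eq_minimum)
  show "barrier \<gamma> (delta_height \<gamma>) \<in> action p \<omega> \<gamma> ` admissible H1_rad p \<gamma>"
    using Q_prof_optimal[OF assms] by (metis imageI)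
qed (use barrier_le_radial_action[OF assms] in auto)

lemma radial_action_gt_low:
  assumes "\<gamma> < 0" "\<omega> \<le> \<gamma>\<^sup>2 / 2" "\<phi> \<in> admissible H1_rad p \<gamma>"
  shows "2 * cost peak < action p \<omega> \<gamma> \<phi>"
proof -
  obtain a where a: "0 \<le> a" "barrier \<gamma> a \<le> action p \<omega> \<gamma> \<phi>" "a = 0 \<longrightarrow> barrier \<gamma> a < action p \<omega> \<gamma> \<phi>"
    using radial_action_ge_barrier[OF assms(3)] assms(1) by auto
  then show ?thesis
    using barrier_strict_min_0[OF assms(1,2), of a] barrier_0[of \<gamma>] by (cases "a = 0") auto
qed

lemma r_inf_eq_low:
  assumes "\<gamma> < 0" "\<omega> \<le> \<gamma>\<^sup>2 / 2"
  shows "r_inf p \<omega> \<gamma> = 2 * cost peak"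
  unfolding r_inf_def
  by (rule Inf_eq_if_near_optimal)
     (use radial_action_gt_low[OF assms] near_optimal_r[OF assms] in \<open>auto intro: less_imp_le\<close>)

lemma delta_barrier_bounds:
  assumes "\<gamma> < 0" "\<omega> > \<gamma>\<^sup>2 / 2"
  shows "cost peak < barrier \<gamma> (delta_height \<gamma>)" "barrier \<gamma> (delta_height \<gamma>) < 2 * cost peak"
proof -
  note h = delta_height_bounds[OF assms(2)]
  have "cost (delta_height \<gamma>) \<le> cost peak" using h by (intro cost_mono) auto
  moreover have "\<gamma> / 2 * (delta_height \<gamma>)\<^sup>2 < 0" using assms(1) h(1) by (intro mult_neg_pos) auto
  ultimately show "cost peak < barrier \<gamma> (delta_height \<gamma>)" by (simp add: barrier_def)
  show "barrier \<gamma> (delta_height \<gamma>) < 2 * cost peak"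
    using barrier_min_at_delta_height[OF assms, of 0] h(1) barrier_0[of \<gamma>] by simp
qed

lemma real_solves_delta_NLS_iff:
  fixes r :: "real \<Rightarrow> real"
  assumes H1: "(\<lambda>x. complex_of_real (r x)) \<in> H1" and pos: "\<And>x. r x > 0"
  shows "solves_delta_NLS p \<omega> \<gamma> (\<lambda>x. complex_of_real (r x)) \<longleftrightarrow>
    (\<forall>\<psi>. test_fun \<psi> \<longrightarrow> (LINT x|lborel. complex_of_real (r x) * vderiv (vderiv \<psi>) x)
       = (LINT x|lborel. complex_of_real (2 * \<omega> * r x - 2 * r x powr p) * \<psi> x)
         + complex_of_real (- 2 * \<gamma> * r 0) * \<psi> 0)"
proof -
  have c: "continuous_on UNIV (\<lambda>x. complex_of_real (r x))" using H1 by (simp add: H1_def)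
  then have rc: "continuous_on UNIV r"
    using continuous_on_Re by fastforce
  have pw: "complex_of_real (norm (complex_of_real (r x)) powr (p - 1)) * complex_of_real (r x) = complex_of_real (r x powr p)" for x
  proof -
    have "r x powr p = r x powr (p - 1) * r x powr 1" unfolding powr_add[symmetric] by simp
    then show ?thesis using pos[of x] by simp
  qed
  have "- (1/2) * A + of_real \<omega> * B - of_real \<gamma> * (complex_of_real (r 0) * z) = C
     \<longleftrightarrow> A = (2 * complex_of_real \<omega> * B - 2 * C) + complex_of_real (- 2 * \<gamma> * r 0) * z" for A B C z :: complex
  proof
    have A: "A = 2 * of_real \<omega> * B - 2 * (- (1/2) * A + of_real \<omega> * B - of_real \<gamma> * (complex_of_real (r 0) * z))
        + complex_of_real (- 2 * \<gamma> * r 0) * z"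
      by (simp add: algebra_simps)
    assume "- (1/2) * A + of_real \<omega> * B - of_real \<gamma> * (complex_of_real (r 0) * z) = C"
    from A[unfolded this] show "A = (2 * complex_of_real \<omega> * B - 2 * C) + complex_of_real (- 2 * \<gamma> * r 0) * z" .
  next
    assume A: "A = (2 * complex_of_real \<omega> * B - 2 * C) + complex_of_real (- 2 * \<gamma> * r 0) * z"
    show "- (1/2) * A + of_real \<omega> * B - of_real \<gamma> * (complex_of_real (r 0) * z) = C"
      unfolding A by (simp add: algebra_simps)
  qed
  moreover have "(LINT x|lborel. complex_of_real (2 * \<omega> * r x - 2 * r x powr p) * \<psi> x)
     = 2 * complex_of_real \<omega> * (LINT x|lborel. complex_of_real (r x) * \<psi> x)
       - 2 * (LINT x|lborel. complex_of_real (r x powr p) * \<psi> x)" if \<psi>: "test_fun \<psi>" for \<psi>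
  proof -
    have i1: "integrable lborel (\<lambda>x. complex_of_real (r x) * \<psi> x)"
      by (intro locally_integrable_mult_test continuous_locally_integrable c \<psi>)
    have i2: "integrable lborel (\<lambda>x. complex_of_real (r x powr p) * \<psi> x)"
      by (intro locally_integrable_mult_test continuous_locally_integrable \<psi> continuous_intros rc)
         (use pos in \<open>auto simp: less_imp_neq[symmetric]\<close>)
    have "complex_of_real (2 * \<omega> * r x - 2 * r x powr p) * \<psi> x
      = 2 * complex_of_real \<omega> * (complex_of_real (r x) * \<psi> x) - 2 * (complex_of_real (r x powr p) * \<psi> x)" for x
      by (simp add: algebra_simps)
    then show ?thesis
      using i1 i2 by (simp only:) (subst Bochner_Integration.integral_diff, auto)
  qed
  ultimately show ?thesis unfolding solves_delta_NLS_def using H1 by (simp only: pw) auto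
qed

lemma radial_sol_pos: "positive_fun (radial_sol y)"
  unfolding positive_fun_def radial_sol_def using sol_pos by simp

lemma Q_prof_solves:
  assumes "\<gamma> < 0" "\<omega> > \<gamma>\<^sup>2 / 2"
  shows "solves_delta_NLS p \<omega> \<gamma> (Q_prof p \<omega> \<gamma>)"
proof -
  define y where "y = delta_shift \<gamma>"
  note y = delta_shift_properties[OF assms, folded y_def]
  define h where "h x = 2 * \<omega> * sol (\<bar>x\<bar> - y) - 2 * sol (\<bar>x\<bar> - y) powr p" for x
  have fc: "continuous_on UNIV (\<lambda>x. sol (\<bar>x\<bar> - y))"
    using radial_sol_C1[of y] by (simp add: piecewise_C1_def)
  have hc: "continuous_on UNIV h"
    unfolding h_def by (intro continuous_intros fc) (use sol_pos in \<open>auto simp: less_imp_neq[symmetric]\<close>)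
  have r1: "((\<lambda>x. sol (- x - y)) has_real_derivative - sol' (- x - y)) (at x)" for x
    by (rule DERIV_mirror[THEN iffD1, OF sol_shift_deriv])
  have r2: "((\<lambda>x. - sol' (- x - y)) has_real_derivative 2 * \<omega> * sol (- x - y) - 2 * sol (- x - y) powr p) (at x)" for x
    using DERIV_minus[OF DERIV_mirror[THEN iffD1, OF sol'_shift_deriv[where x="- x" and y=y]]] by simp
  have "(LINT x|lborel. complex_of_real (sol (\<bar>x\<bar> - y)) * vderiv (vderiv \<psi>) x)
     = (LINT x|lborel. complex_of_real (h x) * \<psi> x) + complex_of_real (- 2 * \<gamma> * sol (\<bar>0\<bar> - y)) * \<psi> 0"
    if \<psi>: "test_fun \<psi>" for \<psi>
  proof -
    have "(LINT x|lborel. complex_of_real (sol (\<bar>x\<bar> - y)) * vderiv (vderiv \<psi>) x)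
      = (LINT x|lborel. complex_of_real (h x) * \<psi> x) + complex_of_real (sol' (0 - y) - - sol' (- 0 - y)) * \<psi> 0"
      by (rule glued_second_derivative[OF fc hc _ _ _ _ sol_shift_deriv sol'_shift_deriv r1 r2 \<psi>]) (auto simp: h_def)
    also have "sol' (0 - y) - - sol' (- 0 - y) = - 2 * \<gamma> * sol (\<bar>0\<bar> - y)"
      using y(3) speed_sol[of y] sol'_neg[OF y(1)] sol'_odd[of y] sol_even[of y] by simp
    finally show ?thesis .
  qed
  then show ?thesis
    unfolding Q_prof_eq y_def[symmetric] radial_sol_def[abs_def]
    using real_solves_delta_NLS_iff[of "\<lambda>x. sol (\<bar>x\<bar> - y)" \<gamma>] piecewise_C1_H1(1)[OF radial_sol_C1[of y]] sol_pos
    by (simp add: h_def)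
qed

text \<open>On each half-line the solution agrees with a \<open>C\<^sup>2\<close> function \<open>u\<close> (right) or the reflection of one, \<open>v\<close>
(left). The equation fixes the jump of the derivative at the origin but not the mean \<open>c\<close> of the
one-sided derivatives. The first integrals on both sides have the same value of \<open>W\<close>, which forces \<open>c = 0\<close> and then
determines the height at the origin.\<close>

lemma positive_solution_unique:
  assumes "\<gamma> < 0" "\<omega> > \<gamma>\<^sup>2 / 2" and pos: "positive_fun \<phi>" and sol: "solves_delta_NLS p \<omega> \<gamma> \<phi>"
  shows "\<phi> = Q_prof p \<omega> \<gamma>"
proof -
  define r where "r x = Re (\<phi> x)" for x
  have \<phi>: "\<phi> = (\<lambda>x. complex_of_real (r x))"
    using pos unfolding positive_fun_def r_def by (auto simp: complex_is_Real_iff complex_eq_iff)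
  have r0: "r x > 0" for x using pos unfolding positive_fun_def r_def by auto
  have H1: "(\<lambda>x. complex_of_real (r x)) \<in> H1" using sol unfolding solves_delta_NLS_def \<phi> by blast
  interpret h1_path "\<lambda>x. 1 * norm (\<phi> x)" "\<lambda>x. 1 * norm (weak_deriv \<phi> x)"
    using H1 unfolding \<phi> by (intro h1_path_norm) auto
  have nr: "(\<lambda>x. 1 * norm (\<phi> x)) = r" using r0 by (auto simp: \<phi> less_imp_le)
  have rc: "continuous_on UNIV r" using u_cont unfolding nr .
  have rlim: "(r \<longlongrightarrow> 0) at_top" "(r \<longlongrightarrow> 0) at_bot" using u_vanishes unfolding nr by auto
  define h where "h x = 2 * \<omega> * r x - 2 * r x powr p" for x
  have hc: "continuous_on UNIV h"
    unfolding h_def by (intro continuous_intros rc) (use r0 in \<open>auto simp: less_imp_neq[symmetric]\<close>)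
  obtain A where A: "\<And>x. (A has_real_derivative h x) (at x)" "A 0 = 0"
    using global_antiderivative[OF hc, of 0] unfolding has_real_derivative_iff_has_vector_derivative[symmetric] by metis
  have Ac: "continuous_on UNIV A" by (intro continuous_at_imp_continuous_on ballI DERIV_isCont[OF A(1)])
  obtain B where B: "\<And>x. (B has_real_derivative A x) (at x)" "B 0 = 0"
    using global_antiderivative[OF Ac, of 0] unfolding has_real_derivative_iff_has_vector_derivative[symmetric] by metis
  \<comment> \<open>A particular solution of the linear problem: \<open>f'' = h - 2 \<gamma> r 0 \<delta>\<^sub>0\<close>, the distribution that the equation assigns to \<open>r''\<close>.\<close>
  define f where "f x = B x - \<gamma> * r 0 * \<bar>x\<bar>" for x
  have fc: "continuous_on UNIV f"
    unfolding f_def by (intro continuous_intros continuous_at_imp_continuous_on ballI DERIV_isCont[OF B(1)])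
  have d1: "((\<lambda>x. B x - \<gamma> * r 0 * x) has_real_derivative A x - \<gamma> * r 0) (at x)"
     "((\<lambda>x. A x - \<gamma> * r 0) has_real_derivative h x) (at x)"
     "((\<lambda>x. B x + \<gamma> * r 0 * x) has_real_derivative A x + \<gamma> * r 0) (at x)"
     "((\<lambda>x. A x + \<gamma> * r 0) has_real_derivative h x) (at x)" for x
    by (auto intro!: derivative_eq_intros A B)
  have zero: "(LINT x|lborel. (complex_of_real (r x) - complex_of_real (f x)) * vderiv (vderiv \<psi>) x) = 0"
    if \<psi>: "test_fun \<psi>" for \<psi>
  proof -
    have "(LINT x|lborel. complex_of_real (f x) * vderiv (vderiv \<psi>) x)
      = (LINT x|lborel. complex_of_real (h x) * \<psi> x) + complex_of_real ((A 0 - \<gamma> * r 0) - (A 0 + \<gamma> * r 0)) * \<psi> 0"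
      by (rule glued_second_derivative[OF fc hc _ _ _ _ d1 \<psi>]) (auto simp: f_def)
    also have "(A 0 - \<gamma> * r 0) - (A 0 + \<gamma> * r 0) = - 2 * \<gamma> * r 0" by simp
    also have "(LINT x|lborel. complex_of_real (h x) * \<psi> x) + complex_of_real (- 2 * \<gamma> * r 0) * \<psi> 0
       = (LINT x|lborel. complex_of_real (r x) * vderiv (vderiv \<psi>) x)"
      using sol real_solves_delta_NLS_iff[of r \<gamma>, OF H1 r0] \<psi> unfolding \<phi> h_def by simp
    finally have eq: "(LINT x|lborel. complex_of_real (f x) * vderiv (vderiv \<psi>) x)
      = (LINT x|lborel. complex_of_real (r x) * vderiv (vderiv \<psi>) x)" .
    have "integrable lborel (\<lambda>x. complex_of_real (f x) * vderiv (vderiv \<psi>) x)"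
      "integrable lborel (\<lambda>x. complex_of_real (r x) * vderiv (vderiv \<psi>) x)"
      by (intro locally_integrable_mult_test continuous_locally_integrable test_fun_vderiv \<psi> continuous_intros fc rc)+
    then show ?thesis unfolding left_diff_distrib using eq by (simp add: Bochner_Integration.integral_diff)
  qed
  obtain c' where c': "\<And>x. complex_of_real (r x) - complex_of_real (f x)
      = (complex_of_real (r 0) - complex_of_real (f 0)) + c' * complex_of_real x"
  proof -
    have "continuous_on UNIV (\<lambda>x. complex_of_real (r x) - complex_of_real (f x))"
      by (intro continuous_intros fc rc)
    from affine_if_second_derivative_0[OF this zero] show thesis using that by blast
  qed
  define c where "c = Re c'"
  have r_eq: "r x = B x - \<gamma> * r 0 * \<bar>x\<bar> + c * x + r 0" for x
    using arg_cong[OF c'[of x], of Re] by (simp add: f_def B(2) c_def)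
  define u u' where "u x = B x - \<gamma> * r 0 * x + c * x + r 0" and "u' x = A x - \<gamma> * r 0 + c" for x
  define v v' where "v x = B (- x) - \<gamma> * r 0 * x - c * x + r 0" and "v' x = - A (- x) - \<gamma> * r 0 - c" for x
  have ru: "r x = u x" and rv: "r (- x) = v x" if "x \<ge> 0" for x
    using r_eq[of x] r_eq[of "- x"] that by (auto simp: u_def v_def)
  have u_sol: "halfline_solution u u'"
    unfolding halfline_solution_def
  proof (intro conjI allI impI)
    fix x :: real assume x: "x \<ge> 0"
    show "u x > 0" using ru[OF x] r0[of x] by simp
    show "(u has_real_derivative u' x) (at x)"
      unfolding u_def[abs_def] u'_def by (auto intro!: derivative_eq_intros B)
    show "(u' has_real_derivative 2 * \<omega> * u x - 2 * u x powr p) (at x)"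
      unfolding u'_def[abs_def] ru[OF x, symmetric] h_def[symmetric] by (auto intro!: derivative_eq_intros A)
  next
    show "(u \<longlongrightarrow> 0) at_top"
      by (rule Lim_transform_eventually[OF rlim(1)])
         (rule eventually_mono[OF eventually_ge_at_top[of 0]], simp add: ru)
  qed
  have Bm: "((\<lambda>x. B (- x)) has_real_derivative - A (- x)) (at x)"
    and Am: "((\<lambda>x. A (- x)) has_real_derivative - h (- x)) (at x)" for x
    using DERIV_mirror[THEN iffD1, OF B(1)] DERIV_mirror[THEN iffD1, OF A(1)] by auto
  have v_sol: "halfline_solution v v'"
    unfolding halfline_solution_def
  proof (intro conjI allI impI)
    fix x :: real assume x: "x \<ge> 0"
    show "v x > 0" using rv[OF x] r0[of "- x"] by simp
    show "(v has_real_derivative v' x) (at x)"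
      unfolding v_def[abs_def] v'_def by (auto intro!: derivative_eq_intros Bm)
    show "(v' has_real_derivative 2 * \<omega> * v x - 2 * v x powr p) (at x)"
      unfolding v'_def[abs_def] rv[OF x, symmetric] h_def[symmetric] by (auto intro!: derivative_eq_intros Am)
  next
    have "((\<lambda>x. r (- x)) \<longlongrightarrow> 0) at_top"
      by (rule filterlim_compose[OF rlim(2) filterlim_uminus_at_bot_at_top])
    then show "(v \<longlongrightarrow> 0) at_top"
      by (rule Lim_transform_eventually)
         (rule eventually_mono[OF eventually_ge_at_top[of 0]], simp add: rv)
  qed
  have u0: "u 0 = r 0" "v 0 = r 0" "u' 0 = - \<gamma> * r 0 + c" "v' 0 = - \<gamma> * r 0 - c"
    by (simp_all add: u_def v_def u'_def v'_def A B)
  have "(- \<gamma> * r 0 + c)\<^sup>2 = W (r 0)" "(- \<gamma> * r 0 - c)\<^sup>2 = W (r 0)"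
    using halfline_first_integral[OF u_sol, of 0] halfline_first_integral[OF v_sol, of 0] u0 by simp_all
  then have "(- \<gamma> * r 0 + c)\<^sup>2 = (- \<gamma> * r 0 - c)\<^sup>2" and W0: "(- \<gamma> * r 0 + c)\<^sup>2 = W (r 0)" by simp_all
  then have "\<gamma> * r 0 * c = 0" by (simp add: power2_eq_square algebra_simps)
  then have c0: "c = 0" using assms(1) r0[of 0] by simp
  have "r 0 = delta_height \<gamma>"
  proof -
    have "(r 0)\<^sup>2 * \<gamma>\<^sup>2 = (r 0)\<^sup>2 * (2 * \<omega> - 4 / (p + 1) * r 0 powr (p - 1))"
      using W0 c0 W_factor[of "r 0"] r0[of 0] by (simp add: power_mult_distrib mult.commute)
    then have "\<gamma>\<^sup>2 = 2 * \<omega> - 4 / (p + 1) * r 0 powr (p - 1)" using r0[of 0] by simp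
    then have "r 0 powr (p - 1) = (p + 1) * (2 * \<omega> - \<gamma>\<^sup>2) / 4" using p_gt_5 by (simp add: field_simps)
    then have "(r 0 powr (p - 1)) powr (1 / (p - 1)) = delta_height \<gamma>"
      unfolding delta_height_def by (rule arg_cong)
    then show ?thesis using p_gt_5 r0[of 0] by (simp add: powr_powr)
  qed
  define y where "y = delta_shift \<gamma>"
  note y = delta_shift_properties[OF assms(1,2), folded y_def]
  have s0: "sol (0 - y) = r 0" using y(2) \<open>r 0 = delta_height \<gamma>\<close> sol_even[of y] by simp
  have s'0: "sol' (0 - y) = - \<gamma> * r 0"
    using y(3) speed_sol[of y] sol'_neg[OF y(1)] sol'_odd[of y] s0 sol_even[of y] by simp
  have "u x = sol (x - y)" "v x = sol (x - y)" if "x \<ge> 0" for x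
    using halfline_unique[OF u_sol halfline_sol[of y] _ _ that] halfline_unique[OF v_sol halfline_sol[of y] _ _ that]
      u0 s0 s'0 c0 by auto
  then have "r x = sol (\<bar>x\<bar> - y)" for x
    using ru[of x] rv[of "- x"] by (cases "x \<ge> 0") auto
  then show ?thesis unfolding Q_prof_eq \<phi> y_def[symmetric] radial_sol_def[abs_def] by simp
qed

end

theorem proposition1p2:
  fixes p \<gamma> \<omega> :: real
  assumes "p > 5" and "\<gamma> < 0" and "\<omega> > 0"
  shows "(n_inf p \<omega> \<gamma> = l_inf p \<omega> \<and> \<not> (\<exists>\<phi>. n_attained_by p \<omega> \<gamma> \<phi>))
    \<and> (n_inf p \<omega> \<gamma> < r_inf p \<omega> \<gamma>
       \<and> (\<omega> \<le> \<gamma>\<^sup>2 / 2 \<longrightarrow> r_inf p \<omega> \<gamma> = 2 * l_inf p \<omega>)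
       \<and> (\<omega> > \<gamma>\<^sup>2 / 2 \<longrightarrow> r_inf p \<omega> \<gamma> < 2 * l_inf p \<omega>))
    \<and> (\<omega> > \<gamma>\<^sup>2 / 2 \<longrightarrow>
         r_attained_by p \<omega> \<gamma> (Q_prof p \<omega> \<gamma>)
         \<and> positive_fun (Q_prof p \<omega> \<gamma>) \<and> solves_delta_NLS p \<omega> \<gamma> (Q_prof p \<omega> \<gamma>)
         \<and> (\<forall>\<phi>. positive_fun \<phi> \<and> solves_delta_NLS p \<omega> \<gamma> \<phi> \<longrightarrow> \<phi> = Q_prof p \<omega> \<gamma>))
    \<and> (\<omega> \<le> \<gamma>\<^sup>2 / 2 \<longrightarrow> \<not> (\<exists>\<phi>. r_attained_by p \<omega> \<gamma> \<phi>))"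
proof -
  interpret nls p \<omega> by unfold_locales (use assms in auto)
  note \<gamma> = \<open>\<gamma> < 0\<close>
  have n: "\<not> n_attained_by p \<omega> \<gamma> \<phi>" for \<phi>
    using action_ge_cost(2)[of \<phi> \<gamma>] \<gamma> unfolding n_attained_by_def n_inf_eq[OF \<gamma>] by auto
  have r: "n_inf p \<omega> \<gamma> < r_inf p \<omega> \<gamma>"
    using r_inf_eq_low[OF \<gamma>] r_inf_eq_high[OF \<gamma>] delta_barrier_bounds[OF \<gamma>] cost_peak_pos n_inf_eq[OF \<gamma>]
    by (cases "\<omega> \<le> \<gamma>\<^sup>2 / 2") auto
  have ra: "\<not> r_attained_by p \<omega> \<gamma> \<phi>" if "\<omega> \<le> \<gamma>\<^sup>2 / 2" for \<phi>
    using radial_action_gt_low[OF \<gamma> that, of \<phi>] unfolding r_attained_by_def r_inf_eq_low[OF \<gamma> that] by auto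
  have Q: "r_attained_by p \<omega> \<gamma> (Q_prof p \<omega> \<gamma>)" if "\<omega> > \<gamma>\<^sup>2 / 2"
    using Q_prof_optimal[OF \<gamma> that] unfolding r_attained_by_def r_inf_eq_high[OF \<gamma> that] by auto
  show ?thesis
    using n r ra Q n_inf_eq[OF \<gamma>] l_inf_eq r_inf_eq_low[OF \<gamma>] r_inf_eq_high[OF \<gamma>] delta_barrier_bounds(2)[OF \<gamma>]
      radial_sol_pos Q_prof_eq[of \<gamma>] Q_prof_solves[OF \<gamma>] positive_solution_unique[OF \<gamma>]
    by auto
qed

end
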